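(* Let a Lévy process $X$ on $\mathbb{R}$, a function $f:U_+\to\mathbb{R}$ and a real $q>0$ satisfy the following conditions: (a) there exist $\mu_-\le0\le\mu_+$ such that for all $\gamma\in[\mu_-,\mu_+]$, $\mathbb{E}[e^{-\gamma X_1}]<\infty$ and $q+\psi(i\gamma)>0$; (b) $f$ is a measurable function admitting the bound $$|f(x_1,x_2)|\le C(x_2)e^{-\mu_+x_1},$$ where $C(x_2)$ is independent of $x_1\le x_2$; (c) $((\mathcal{E}^-_q\otimes I)f)\circ\Delta$ is a measurable function admitting the bound $$|((\mathcal{E}^-_q\otimes I)f)(x_1,x_1)|\le Ce^{-\mu_-x_1},$$ where $C$ is independent of $x_1\ge0$. Then (i) for any $x_1\le x_2$, $$q\tilde V(f;q;x_1,x_2)=((\mathcal{E}_q\otimes I)f_+)(x_1,x_2)+(\mathcal{E}^+_q\, w(f;q,\cdot,x_2))(x_1),$$ where $$w(f;q,y,x_2)=\mathbf{1}_{[x_2,+\infty)}(y)\Big(((\mathcal{E}^-_q\otimes I)f_+)(y,y)-((\mathcal{E}^-_q\otimes I)f_+)(y,x_2)\Big);$$ (ii) the right-hand sides of the two displayed formulas in (i) admit analytic continuation with respect to $q$ to the right half-plane.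
   Context: $X=(X_t)_{t\ge0}$ is a one-dimensional Lévy process with $X_0=0$ on a filtered probability space satisfying the usual conditions, with probability $\mathbb{Q}$ and expectation $\mathbb{E}$; its characteristic exponent $\psi$ is defined by $\mathbb{E}[e^{i\xi X_t}]=e^{-t\psi(\xi)}$ (so $\mathbb{E}[e^{-\gamma X_1}]=e^{-\psi(i\gamma)}$ when finite). Put $\bar X_t=\sup_{0\le s\le t}X_s$, $\underline X_t=\inf_{0\le s\le t}X_s$. For $q>0$, $T_q$ is an exponentially distributed random variable of mean $1/q$ independent of $X$. The expected present value operators are $\mathcal{E}_qu(x)=\mathbb{E}[u(x+X_{T_q})]$, $\mathcal{E}^+_qu(x)=\mathbb{E}[u(x+\bar X_{T_q})]$, $\mathcal{E}^-_qu(x)=\mathbb{E}[u(x+\underline X_{T_q})]$. $I$ is the identity operator; for an operator $A$ on functions of one real variable, $A\otimes I$ acts on a function of $(x_1,x_2)$ through the first variable, with $x_2$ fixed, e.g. $((\mathcal{E}^-_q\otimes I)g)(x_1,x_2)=\mathbb{E}[g(x_1+\underline X_{T_q},x_2)]$. $\Delta(x)=(x,x)$ is the diagonal map. $U_+=\{(x_1,x_2)\in\mathbb{R}^2 : x_2\ge0,\ x_1\le x_2\}$, and $f_+$ is the extension of $f:U_+\to\mathbb{R}$ by zero to $\mathbb{R}^2$; wherever $f$ would be evaluated outside $U_+$, it is understood as $f_+$. For $T>0$ and $x_1\le x_2$, $V(f;T;x_1,x_2)=\mathbb{E}[f(x_1+X_T,\max\{x_2,x_1+\bar X_T\})]$,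 and $\tilde V(f;q;x_1,x_2)=\int_0^\infty e^{-qT}V(f;T;x_1,x_2)\,dT=q^{-1}\mathbb{E}[f(x_1+X_{T_q},\max\{x_2,x_1+\bar X_{T_q}\})]$ is its Laplace transform with respect to $T$. The right half-plane is $\{q\in\mathbb{C}:\Re q>0\}$.
   Formalization: The expectation of f(x_1+X_{T_q}, max{x_2, x_1+sup X}) is assumed to exist in [-∞,∞]; in (ii), continuation to the right half-plane assumes (a)-(c) for every q>0 (and, for the first formula, that expectation at every q), while (a)-(c) at one q give continuation to Re z>q only. *)

theory Defs
  imports "HOL-Probability.Probability" "HOL-Complex_Analysis.Complex_Analysis"
begin

section \<open>Levy processes\<close>

locale usual_filtered_space = prob_space M
  for M :: "'a measure" and F :: "real \<Rightarrow> 'a measure" +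
  assumes complete: "complete_measure M"
    and subalg: "\<And>t. 0 \<le> t \<Longrightarrow> subalgebra M (F t)"
    and filtration_mono: "\<And>s t. 0 \<le> s \<Longrightarrow> s \<le> t \<Longrightarrow> sets (F s) \<subseteq> sets (F t)"
    and null_sets_F0: "null_sets M \<subseteq> sets (F 0)"
    and right_continuous: "\<And>t. 0 \<le> t \<Longrightarrow> sets (F t) = (\<Inter>s\<in>{t<..}. sets (F s))"

text \<open>The time index ranges over all of \<^typ>\<open>real\<close>, but nothing is assumed about negative times
  and no definition below depends on them.\<close>

locale levy_process = usual_filtered_space M F
  for M :: "'a measure" and F :: "real \<Rightarrow> 'a measure" +
  fixes X :: "real \<Rightarrow> 'a \<Rightarrow> real"
  assumes adapted: "\<And>t. 0 \<le> t \<Longrightarrow> X t \<in> borel_measurable (F t)"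
    and start: "\<And>\<omega>. \<omega> \<in> space M \<Longrightarrow> X 0 \<omega> = 0"
    and indep_increments: "\<And>s t. 0 \<le> s \<Longrightarrow> s \<le> t \<Longrightarrow>
      indep_set (sets (F s)) (sets (vimage_algebra (space M) (\<lambda>\<omega>. X t \<omega> - X s \<omega>) borel))"
    and stationary_increments: "\<And>s t. 0 \<le> s \<Longrightarrow> s \<le> t \<Longrightarrow>
      distr M borel (\<lambda>\<omega>. X t \<omega> - X s \<omega>) = distr M borel (X (t - s))"
    and paths_right_continuous: "\<And>\<omega> t. \<omega> \<in> space M \<Longrightarrow> 0 \<le> t \<Longrightarrow>
      continuous (at_right t) (\<lambda>s. X s \<omega>)"
    and paths_left_limits: "\<And>\<omega> t. \<omega> \<in> space M \<Longrightarrow> 0 < t \<Longrightarrow>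
      \<exists>l. ((\<lambda>s. X s \<omega>) \<longlongrightarrow> l) (at_left t)"

text \<open>The number \<open>\<psi>(\<xi>)\<close> is determined by the identity for all \<open>t \<ge> 0\<close> simultaneously (at a single
  \<open>t\<close> only modulo a period of the exponential). The definition is meaningful for those complex
  \<open>\<xi>\<close> at which the exponential moments exist.\<close>

definition char_exponent :: "'a measure \<Rightarrow> (real \<Rightarrow> 'a \<Rightarrow> real) \<Rightarrow> complex \<Rightarrow> complex" where
  "char_exponent M X \<xi> = (THE z. \<forall>t\<ge>0.
     (LINT \<omega>|M. exp (\<i> * \<xi> * complex_of_real (X t \<omega>))) = exp (- (complex_of_real t * z)))"

definition running_sup :: "(real \<Rightarrow> 'a \<Rightarrow> real) \<Rightarrow> real \<Rightarrow> 'a \<Rightarrow> real" where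
  "running_sup X t \<omega> = (SUP s\<in>{0..t}. X s \<omega>)"

definition running_inf :: "(real \<Rightarrow> 'a \<Rightarrow> real) \<Rightarrow> real \<Rightarrow> 'a \<Rightarrow> real" where
  "running_inf X t \<omega> = (INF s\<in>{0..t}. X s \<omega>)"

section \<open>Expected present value operators\<close>

text \<open>The independent time \<open>T\<^sub>q\<close> is realised as the second coordinate of the product of \<open>M\<close> with the
  exponential law. That law lives on \<open>[0,\<infinity>)\<close> only, since \<open>X\<close> need not be measurable at negative
  times.\<close>

definition exp_law :: "real \<Rightarrow> real measure" where
  "exp_law q = restrict_space (density lborel (exponential_density q)) {0..}"

definition expectation_Tq :: "'a measure \<Rightarrow> real \<Rightarrow> ('a \<Rightarrow> real \<Rightarrow> real) \<Rightarrow> real" where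
  "expectation_Tq M q Z = (LINT (\<omega>, t)|(M \<Otimes>\<^sub>M exp_law q). Z \<omega> t)"

definition epv :: "'a measure \<Rightarrow> (real \<Rightarrow> 'a \<Rightarrow> real) \<Rightarrow> real \<Rightarrow> (real \<Rightarrow> real) \<Rightarrow> real \<Rightarrow> real" where
  "epv M X q u x = expectation_Tq M q (\<lambda>\<omega> t. u (x + X t \<omega>))"

definition epv_plus :: "'a measure \<Rightarrow> (real \<Rightarrow> 'a \<Rightarrow> real) \<Rightarrow> real \<Rightarrow> (real \<Rightarrow> real) \<Rightarrow> real \<Rightarrow> real" where
  "epv_plus M X q u x = expectation_Tq M q (\<lambda>\<omega> t. u (x + running_sup X t \<omega>))"

definition epv_minus :: "'a measure \<Rightarrow> (real \<Rightarrow> 'a \<Rightarrow> real) \<Rightarrow> real \<Rightarrow> (real \<Rightarrow> real) \<Rightarrow> real \<Rightarrow> real" where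
  "epv_minus M X q u x = expectation_Tq M q (\<lambda>\<omega> t. u (x + running_inf X t \<omega>))"

definition tensor_id ::
    "((real \<Rightarrow> real) \<Rightarrow> real \<Rightarrow> real) \<Rightarrow> (real \<times> real \<Rightarrow> real) \<Rightarrow> real \<times> real \<Rightarrow> real" where
  "tensor_id A g = (\<lambda>(x1, x2). A (\<lambda>y. g (y, x2)) x1)"

definition diag :: "real \<Rightarrow> real \<times> real" where
  "diag x = (x, x)"

section \<open>The payoff and its value\<close>

definition U_plus :: "(real \<times> real) set" where
  "U_plus = {(x1, x2). 0 \<le> x2 \<and> x1 \<le> x2}"

definition zero_ext :: "(real \<times> real \<Rightarrow> real) \<Rightarrow> real \<times> real \<Rightarrow> real" where
  "zero_ext f = (\<lambda>x. if x \<in> U_plus then f x else 0)"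

definition payoff ::
    "(real \<Rightarrow> 'a \<Rightarrow> real) \<Rightarrow> (real \<times> real \<Rightarrow> real) \<Rightarrow> real \<Rightarrow> real \<Rightarrow> 'a \<Rightarrow> real \<Rightarrow> real" where
  "payoff X f x1 x2 \<omega> t = zero_ext f (x1 + X t \<omega>, max x2 (x1 + running_sup X t \<omega>))"

definition V :: "'a measure \<Rightarrow> (real \<Rightarrow> 'a \<Rightarrow> real) \<Rightarrow> (real \<times> real \<Rightarrow> real) \<Rightarrow>
    real \<Rightarrow> real \<Rightarrow> real \<Rightarrow> real" where
  "V M X f T x1 x2 = (LINT \<omega>|M. payoff X f x1 x2 \<omega> T)"

definition V_tilde :: "'a measure \<Rightarrow> (real \<Rightarrow> 'a \<Rightarrow> real) \<Rightarrow> (real \<times> real \<Rightarrow> real) \<Rightarrow>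
    real \<Rightarrow> real \<Rightarrow> real \<Rightarrow> real" where
  "V_tilde M X f q x1 x2 = (LBINT T:{0<..}. exp (- q * T) * V M X f T x1 x2)"

text \<open>The expectation of the payoff at \<open>T\<^sub>q\<close> exists as an element of \<open>[-\<infinity>,\<infinity>]\<close>: its positive or its
  negative part is integrable. This is automatic if \<open>f\<close> has constant sign.\<close>

definition payoff_expectation_exists :: "'a measure \<Rightarrow> (real \<Rightarrow> 'a \<Rightarrow> real) \<Rightarrow>
    (real \<times> real \<Rightarrow> real) \<Rightarrow> real \<Rightarrow> real \<Rightarrow> real \<Rightarrow> bool" where
  "payoff_expectation_exists M X f q x1 x2 \<longleftrightarrow>
     (\<integral>\<^sup>+ (\<omega>, t). ennreal (payoff X f x1 x2 \<omega> t) \<partial>(M \<Otimes>\<^sub>M exp_law q)) < \<infinity> \<or>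
     (\<integral>\<^sup>+ (\<omega>, t). ennreal (- payoff X f x1 x2 \<omega> t) \<partial>(M \<Otimes>\<^sub>M exp_law q)) < \<infinity>"

definition w :: "'a measure \<Rightarrow> (real \<Rightarrow> 'a \<Rightarrow> real) \<Rightarrow> (real \<times> real \<Rightarrow> real) \<Rightarrow>
    real \<Rightarrow> real \<Rightarrow> real \<Rightarrow> real" where
  "w M X f q y x2 = indicator {x2..} y *
     (tensor_id (epv_minus M X q) (zero_ext f) (y, y)
      - tensor_id (epv_minus M X q) (zero_ext f) (y, x2))"

definition factorization_rhs :: "'a measure \<Rightarrow> (real \<Rightarrow> 'a \<Rightarrow> real) \<Rightarrow> (real \<times> real \<Rightarrow> real) \<Rightarrow>
    real \<Rightarrow> real \<Rightarrow> real \<Rightarrow> real" where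
  "factorization_rhs M X f q x1 x2 =
     tensor_id (epv M X q) (zero_ext f) (x1, x2) + epv_plus M X q (\<lambda>y. w M X f q y x2) x1"

section \<open>The standing conditions\<close>

text \<open>Where the exponential moment is finite, \<open>\<psi>(i\<gamma>)\<close> is real, so taking the real part only adapts
  the type.\<close>

definition cond_a :: "'a measure \<Rightarrow> (real \<Rightarrow> 'a \<Rightarrow> real) \<Rightarrow> real \<Rightarrow> real \<Rightarrow> real \<Rightarrow> bool" where
  "cond_a M X q \<mu>m \<mu>p \<longleftrightarrow> \<mu>m \<le> 0 \<and> 0 \<le> \<mu>p \<and>
     (\<forall>\<gamma>\<in>{\<mu>m..\<mu>p}. integrable M (\<lambda>\<omega>. exp (- \<gamma> * X 1 \<omega>)) \<and>
        0 < q + Re (char_exponent M X (\<i> * complex_of_real \<gamma>)))"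

definition cond_b :: "(real \<times> real \<Rightarrow> real) \<Rightarrow> real \<Rightarrow> bool" where
  "cond_b f \<mu>p \<longleftrightarrow> f \<in> borel_measurable (restrict_space borel U_plus) \<and>
     (\<exists>C :: real \<Rightarrow> real. \<forall>x1 x2. (x1, x2) \<in> U_plus \<longrightarrow> \<bar>f (x1, x2)\<bar> \<le> C x2 * exp (- \<mu>p * x1))"

definition cond_c :: "'a measure \<Rightarrow> (real \<Rightarrow> 'a \<Rightarrow> real) \<Rightarrow> (real \<times> real \<Rightarrow> real) \<Rightarrow>
    real \<Rightarrow> real \<Rightarrow> bool" where
  "cond_c M X f q \<mu>m \<longleftrightarrow>
     tensor_id (epv_minus M X q) (zero_ext f) \<circ> diag \<in> borel_measurable borel \<and>
     (\<exists>C :: real. \<forall>x1\<ge>0.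
        \<bar>tensor_id (epv_minus M X q) (zero_ext f) (x1, x1)\<bar> \<le> C * exp (- \<mu>m * x1))"

definition admissible :: "'a measure \<Rightarrow> (real \<Rightarrow> 'a \<Rightarrow> real) \<Rightarrow> (real \<times> real \<Rightarrow> real) \<Rightarrow>
    real \<Rightarrow> bool" where
  "admissible M X f q \<longleftrightarrow> (\<exists>\<mu>m \<mu>p. cond_a M X q \<mu>m \<mu>p \<and> cond_b f \<mu>p \<and> cond_c M X f q \<mu>m)"

section \<open>Analytic continuation in the killing rate\<close>

definition continues_to_halfplane :: "(real \<Rightarrow> real) \<Rightarrow> real \<Rightarrow> bool" where
  "continues_to_halfplane g \<sigma> \<longleftrightarrow> (\<exists>G :: complex \<Rightarrow> complex. G analytic_on {z. \<sigma> < Re z} \<and>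
     (\<forall>q>\<sigma>. G (complex_of_real q) = complex_of_real (g q)))"

text \<open>The variant including the boundary line, for functions known only on \<open>[\<sigma>,\<infinity>)\<close>.\<close>

definition continues_to_closed_halfplane :: "(real \<Rightarrow> real) \<Rightarrow> real \<Rightarrow> bool" where
  "continues_to_closed_halfplane g \<sigma> \<longleftrightarrow> (\<exists>G :: complex \<Rightarrow> complex. G analytic_on {z. \<sigma> < Re z} \<and>
     continuous_on {z. \<sigma> \<le> Re z} G \<and>
     (\<forall>q\<ge>\<sigma>. G (complex_of_real q) = complex_of_real (g q)))"

end

theory Submission
  imports Defs
begin

text \<open>
  Let \<open>S\<close> and \<open>I\<close> be the running supremum and infimum of \<open>X\<close> at an independent exponential time.  The
  formula rests on the Wiener-Hopf factorization (\<open>wiener_hopf\<close>): the drawdown \<open>X - S\<close> is independent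
  of \<open>S\<close> and has the law of \<open>I\<close>.  Given this, the payoff equals the one with the second argument frozen at
  \<open>x2\<close>, whose expectation is \<open>epv\<close> applied to \<open>f\<close>, plus a correction that lives on the event
  \<open>x2 \<le> x1 + S\<close>.  Conditioning the correction on \<open>S\<close>, with \<open>y = x1 + S\<close>, gives \<open>w\<close> at \<open>y\<close>, and averaging
  over \<open>S\<close> gives the \<open>epv_plus\<close> term (\<open>expectation_payoff_formula\<close>).

  The factorization is first proved for random walks at a geometric time.  Cutting the walk at its
  first maximum splits it into two independent pieces, so the generating function of the joint
  expectations is a product (\<open>geometric_mean_product\<close>), and a product form already implies independence;
  time reversal identifies the drawdown with the minimum (\<open>walk_reversal\<close>).  The process sampled on a
  grid of mesh \<open>1 / (n + 1)\<close> is such a walk, and an exponential time rounded to the grid is geometric.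
  As the mesh tends to \<open>0\<close>, right-continuity makes the sampled supremum, infimum and value converge on
  every path, which gives the factorization in integrated form against continuous functions
  (\<open>sup_and_excursion_factorize\<close>).

  Integrability comes from exponential moments.  The condition \<open>cond_a\<close> makes \<open>exp (- \<gamma> X)\<close> integrable at the
  exponential time, since \<open>E exp (- \<gamma> X\<^sub>t) = exp (- t \<psi>)\<close> with \<open>\<psi>\<close> the exponent at \<open>\<i> \<gamma>\<close>
  (\<open>exp_moment_exponential\<close>).  By the factorization
  this moment is a product, so both \<open>exp (- \<gamma> S)\<close> and \<open>exp (- \<gamma> I)\<close> are integrable.  The payoff above the
  level \<open>x2\<close> is not dominated by these; there \<open>cond_c\<close> and the existence of the expectation as an
  extended real number combine to give integrability (\<open>payoff_integrable\<close>).

  For the continuation, each of the two functions is an expectation at the exponential time, hence \<open>p\<close> times the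
  Laplace transform of a fixed function of time.  Absolute convergence at a rate \<open>\<sigma>\<close> makes this transform
  continuous on \<open>Re z \<ge> \<sigma>\<close> and holomorphic on \<open>Re z > \<sigma>\<close> (\<open>laplace_regular\<close>).
\<close>

section \<open>Cadlag paths on fine grids\<close>

text \<open>Only nonnegative times are constrained.  At time \<open>0\<close> there is no left limit to ask for, hence the strict inequality in the second part.\<close>

definition cadlag :: "(real \<Rightarrow> real) \<Rightarrow> bool" where
  "cadlag x \<longleftrightarrow> (\<forall>t\<ge>0. continuous (at_right t) x) \<and> (\<forall>t>0. \<exists>l. (x \<longlongrightarrow> l) (at_left t))"

text \<open>\<open>grid_index n t\<close> counts steps of length \<open>1 / (n + 1)\<close> up to the first grid point strictly after \<open>t\<close>.
  Rounding up makes the grid points approach \<open>t\<close> from the right, where the path is continuous.\<close>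

definition grid_index :: "nat \<Rightarrow> real \<Rightarrow> nat" where
  "grid_index n t = nat \<lfloor>t * real (Suc n)\<rfloor> + 1"

definition grid_point :: "nat \<Rightarrow> real \<Rightarrow> real" where
  "grid_point n t = real (grid_index n t) / real (Suc n)"

definition walk_max :: "(nat \<Rightarrow> real) \<Rightarrow> nat \<Rightarrow> real" where
  "walk_max y n = Max (y ` {..n})"

lemma grid_point_greater: "0 \<le> t \<Longrightarrow> t < grid_point n t"
proof -
  assume "0 \<le> t"
  have "t * real (Suc n) < real_of_int \<lfloor>t * real (Suc n)\<rfloor> + 1" by linarith
  also have "\<dots> = real (grid_index n t)"
    using \<open>0 \<le> t\<close> by (simp add: grid_index_def)
  finally show ?thesis unfolding grid_point_def by (simp add: field_simps)
qed

lemma grid_point_le: "0 \<le> t \<Longrightarrow> grid_point n t \<le> t + 1 / real (Suc n)"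
proof -
  assume t: "0 \<le> t"
  have "real (grid_index n t) \<le> t * real (Suc n) + 1"
    using t by (simp add: grid_index_def)
  then have "grid_point n t \<le> (t * real (Suc n) + 1) / real (Suc n)"
    unfolding grid_point_def by (intro divide_right_mono) auto
  then show ?thesis by (simp add: add_divide_distrib)
qed

lemma grid_point_tendsto:
  assumes "0 \<le> t"
  shows "filterlim (\<lambda>n. grid_point n t) (at_right t) sequentially"
proof -
  have "(\<lambda>n. t + 1 / real (Suc n)) \<longlonglongrightarrow> t + 0"
    by (intro tendsto_intros LIMSEQ_Suc lim_inverse_n')
  then have "(\<lambda>n. t + 1 / real (Suc n)) \<longlonglongrightarrow> t" by simp
  moreover have "\<forall>n. t \<le> grid_point n t"
    using grid_point_greater[OF assms] less_imp_le by blast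
  ultimately have "(\<lambda>n. grid_point n t) \<longlonglongrightarrow> t"
    using tendsto_sandwich[of "\<lambda>_. t" "\<lambda>n. grid_point n t" sequentially "\<lambda>n. t + 1 / real (Suc n)" t]
      grid_point_le[OF assms] by simp
  moreover have "grid_point n t \<in> {t<..} \<and> grid_point n t \<noteq> t" for n
    using grid_point_greater[OF assms, of n] by auto
  ultimately show ?thesis
    unfolding filterlim_at by simp
qed

lemma cadlag_grid_tendsto:
  assumes "cadlag x" "0 \<le> t"
  shows "(\<lambda>n. x (grid_point n t)) \<longlonglongrightarrow> x t"
proof -
  have "(x \<longlongrightarrow> x t) (at_right t)"
    using assms by (auto simp: cadlag_def continuous_within)
  from filterlim_compose[OF this grid_point_tendsto[OF assms(2)]] show ?thesis .
qed

lemma cadlag_uminus: "cadlag x \<Longrightarrow> cadlag (\<lambda>t. - x t)"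
  unfolding cadlag_def by (blast intro: continuous_minus tendsto_minus)

text \<open>One-sided limits bound the path near every point of the interval; compactness, in the form of
  interval bisection, turns this into a global bound.  Without the bound the supremum in
  \<^const>\<open>running_sup\<close> would be an arbitrary number.\<close>

lemma cadlag_bounded:
  assumes x: "cadlag x" and T: "0 \<le> T"
  shows "\<exists>B. \<forall>s\<in>{0..T}. \<bar>x s\<bar> \<le> B"
proof -
  \<comment> \<open>Bisection tests intervals reaching to the left of the point at hand; the cut-off at \<open>0\<close> removes negative times.\<close>
  define P where "P a b \<longleftrightarrow> (\<exists>B. \<forall>s\<in>{max 0 a..b}. \<bar>x s\<bar> \<le> B)" for a b :: real
  have "P 0 T"
  proof (rule Bolzano[OF T])
    fix a b c :: real assume *: "P a b" "P b c" "a \<le> b" "b \<le> c"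
    then obtain B B' where "\<forall>s\<in>{max 0 a..b}. \<bar>x s\<bar> \<le> B" "\<forall>s\<in>{max 0 b..c}. \<bar>x s\<bar> \<le> B'"
      unfolding P_def by blast
    then have "\<bar>x s\<bar> \<le> max B B'" if "s \<in> {max 0 a..c}" for s
      using that by (cases "s \<le> b") (auto simp: le_max_iff_disj)
    then show "P a c" unfolding P_def by blast
  next
    fix t :: real assume t: "0 \<le> t" "t \<le> T"
    have "(x \<longlongrightarrow> x t) (at_right t)"
      using x t by (auto simp: cadlag_def continuous_within)
    then have "eventually (\<lambda>s. dist (x s) (x t) < 1) (at_right t)"
      by (rule tendstoD) simp
    then obtain b where b: "b > t" "\<And>s. t < s \<Longrightarrow> s < b \<Longrightarrow> \<bar>x s\<bar> \<le> \<bar>x t\<bar> + 1"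
      unfolding eventually_at_right_field dist_real_def by fastforce
    obtain a l where a: "a < t" "\<And>s. 0 \<le> s \<Longrightarrow> a < s \<Longrightarrow> s < t \<Longrightarrow> \<bar>x s\<bar> \<le> \<bar>l\<bar> + 1"
    proof (cases "t = 0")
      case True
      then show ?thesis using that[of "-1" 0] by auto
    next
      case False
      then have "0 < t" using t by simp
      then obtain l where "(x \<longlongrightarrow> l) (at_left t)" using x unfolding cadlag_def by blast
      then have "eventually (\<lambda>s. dist (x s) l < 1) (at_left t)"
        by (rule tendstoD) simp
      then obtain a where a: "a < t" "\<And>s. a < s \<Longrightarrow> s < t \<Longrightarrow> dist (x s) l < 1"
        unfolding eventually_at_left_field by blast
      have "\<bar>x s\<bar> \<le> \<bar>l\<bar> + 1" if "a < s" "s < t" for s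
        using a(2)[OF that] by (simp add: dist_real_def)
      then show ?thesis using that a(1) by blast
    qed
    define d where "d = min (b - t) (t - a)"
    have "P u v" if "u \<le> t" "t \<le> v" "v - u < d" for u v
    proof -
      have "\<bar>x s\<bar> \<le> \<bar>x t\<bar> + \<bar>l\<bar> + 1" if "s \<in> {max 0 u..v}" for s
        using a(2)[of s] b(2)[of s] that \<open>u \<le> t\<close> \<open>t \<le> v\<close> \<open>v - u < d\<close>
        unfolding d_def by (cases s t rule: linorder_cases) auto
      then show ?thesis unfolding P_def by blast
    qed
    then show "\<exists>d>0. \<forall>u v. u \<le> t \<and> t \<le> v \<and> v - u < d \<longrightarrow> P u v"
      using a(1) b(1) by (intro exI[of _ d]) (auto simp: d_def)
  qed
  then show ?thesis by (simp add: P_def)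
qed

lemma cadlag_bdd_above: "cadlag x \<Longrightarrow> 0 \<le> T \<Longrightarrow> bdd_above (x ` {0..T})"
  using cadlag_bounded[of x T] by (auto simp: bdd_above_def abs_le_iff)

text \<open>From below: a point where the path nearly attains its supremum is approximated from the right by
  grid points, which stay inside the grid.  From above: every grid point but the last lies in
  \<open>[0, t]\<close>, and at the last one the path is close to its value at \<open>t\<close>.\<close>

lemma grid_max_tendsto:
  assumes x: "cadlag x" and t: "0 \<le> t"
  shows "(\<lambda>n. walk_max (\<lambda>k. x (real k / real (Suc n))) (grid_index n t)) \<longlonglongrightarrow> (SUP s\<in>{0..t}. x s)"
    (is "?m \<longlonglongrightarrow> ?S")
proof (rule order_tendstoI)
  have bdd: "bdd_above (x ` {0..t})" by (rule cadlag_bdd_above[OF x t])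
  fix a assume "a < ?S"
  then obtain s where s: "s \<in> {0..t}" "a < x s"
    using less_cSUP_iff[OF _ bdd, of a] t by auto
  have "eventually (\<lambda>n. a < x (grid_point n s)) sequentially"
    using cadlag_grid_tendsto[OF x, of s] s by (intro order_tendstoD(1)) auto
  then show "eventually (\<lambda>n. a < ?m n) sequentially"
  proof eventually_elim
    case (elim n)
    have "grid_index n s \<le> grid_index n t"
      unfolding grid_index_def using s by (intro add_right_mono nat_mono floor_mono mult_right_mono) auto
    then have "x (grid_point n s) \<le> ?m n"
      unfolding walk_max_def grid_point_def by (intro Max_ge) auto
    with elim show ?case by simp
  qed
next
  have bdd: "bdd_above (x ` {0..t})" by (rule cadlag_bdd_above[OF x t])
  fix a assume a: "?S < a"
  have "x t \<le> ?S" using bdd t by (intro cSUP_upper) auto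
  with a have "eventually (\<lambda>n. x (grid_point n t) < a) sequentially"
    using cadlag_grid_tendsto[OF x t] order_tendstoD(2) order.strict_trans1 by blast
  then show "eventually (\<lambda>n. ?m n < a) sequentially"
  proof eventually_elim
    case (elim n)
    have "x (real k / real (Suc n)) < a" if "k \<le> grid_index n t" for k
    proof (cases "k = grid_index n t")
      case True
      then show ?thesis using elim by (simp add: grid_point_def)
    next
      case False
      then have "k \<le> nat \<lfloor>t * real (Suc n)\<rfloor>" using that by (simp add: grid_index_def)
      moreover have "0 \<le> \<lfloor>t * real (Suc n)\<rfloor>" using t by simp
      ultimately have "int k \<le> \<lfloor>t * real (Suc n)\<rfloor>" by linarith
      then have "real k \<le> t * real (Suc n)" by linarith
      then have "real k / real (Suc n) \<in> {0..t}" by (simp add: field_simps)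
      then have "x (real k / real (Suc n)) \<le> ?S" by (intro cSUP_upper bdd)
      with a show ?thesis by simp
    qed
    then show ?case unfolding walk_max_def by (subst Max_less_iff) auto
  qed
qed

lemma grid_min_tendsto:
  assumes x: "cadlag x" and t: "0 \<le> t"
  shows "(\<lambda>n. - walk_max (\<lambda>k. - x (real k / real (Suc n))) (grid_index n t)) \<longlonglongrightarrow> (INF s\<in>{0..t}. x s)"
proof -
  have "(INF s\<in>{0..t}. x s) = - (SUP s\<in>{0..t}. - x s)"
    by (simp add: Inf_real_def image_image)
  with tendsto_minus[OF grid_max_tendsto[OF cadlag_uminus[OF x] t]] show ?thesis
    by presburger
qed

section \<open>Random walks at a geometric time\<close>

definition walk :: "(nat \<Rightarrow> real) \<Rightarrow> nat \<Rightarrow> real" where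
  "walk \<xi> k = (\<Sum>i<k. \<xi> i)"

lemma walk_0: "walk \<xi> 0 = 0"
  by (simp add: walk_def)

lemma walk_comb_seq_le: "j \<le> k \<Longrightarrow> walk (comb_seq k \<xi> \<eta>) j = walk \<xi> j"
  by (auto simp: walk_def comb_seq_less intro!: sum.cong)

lemma walk_comb_seq_add: "walk (comb_seq k \<xi> \<eta>) (k + m) = walk \<xi> k + walk \<eta> m"
proof (induction m)
  case 0
  then show ?case by (simp add: walk_comb_seq_le walk_0)
next
  case (Suc m)
  then show ?case using comb_seq_add[of k \<xi> \<eta> m] by (simp add: walk_def add.commute)
qed

text \<open>Strict inequality before \<open>k\<close> and weak inequality afterwards single out the first of several
  maximisers, so that the events below partition the path space.\<close>

definition first_max_at :: "(nat \<Rightarrow> real) \<Rightarrow> nat \<Rightarrow> nat \<Rightarrow> bool" where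
  "first_max_at y n k \<longleftrightarrow> (\<forall>j<k. y j < y k) \<and> (\<forall>j\<le>n. k \<le> j \<longrightarrow> y j \<le> y k)"

lemma first_max_at_ex1: "\<exists>!k. k \<le> n \<and> first_max_at y n k"
proof -
  define m where "m = walk_max y n"
  have ge: "y j \<le> m" if "j \<le> n" for j
    unfolding m_def walk_max_def using that by (intro Max_ge) auto
  have "m \<in> y ` {..n}"
    unfolding m_def walk_max_def by (intro Max_in) auto
  then have ex: "\<exists>k. k \<le> n \<and> y k = m" by auto
  define k where "k = (LEAST k. k \<le> n \<and> y k = m)"
  have k: "k \<le> n" "y k = m" using LeastI_ex[OF ex] by (auto simp: k_def)
  have "y j < y k" if "j < k" for j
    using not_less_Least[of j "\<lambda>k. k \<le> n \<and> y k = m"] that k ge[of j]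
    unfolding k_def[symmetric] by fastforce
  then have "first_max_at y n k" using k ge by (auto simp: first_max_at_def)
  moreover have "i = j" if "first_max_at y n i" "first_max_at y n j" "i \<le> n" "j \<le> n" for i j
    using that unfolding first_max_at_def
    by (metis linorder_neqE_nat not_less less_imp_le)
  ultimately show ?thesis using k(1) by blast
qed

lemma first_max_at_value: "k \<le> n \<Longrightarrow> first_max_at y n k \<Longrightarrow> walk_max y n = y k"
  unfolding walk_max_def first_max_at_def
  by (intro Max_eqI) (auto, metis less_imp_le not_less)

lemma first_max_decomposition:
  fixes \<phi> :: "real \<Rightarrow> real"
  shows "\<phi> (walk_max y n) = (\<Sum>k\<le>n. of_bool (first_max_at y n k) * \<phi> (y k))"
proof -
  define k where "k = (THE k. k \<le> n \<and> first_max_at y n k)"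
  have k: "k \<le> n" "first_max_at y n k"
    using theI'[OF first_max_at_ex1[of n y], folded k_def] by simp_all
  have u: "first_max_at y n j \<longleftrightarrow> j = k" if "j \<le> n" for j
    using the1_equality[OF first_max_at_ex1[of n y], of j, folded k_def] that k(2) by blast
  have "(\<Sum>j\<le>n. of_bool (first_max_at y n j) * \<phi> (y j)) = (\<Sum>j\<le>n. if j = k then \<phi> (y k) else 0)"
    by (intro sum.cong refl) (simp add: u)
  also have "\<dots> = \<phi> (y k)" using k by simp
  finally show ?thesis using first_max_at_value[OF k] by simp
qed

abbreviation step_space :: "(nat \<Rightarrow> real) measure" where
  "step_space \<equiv> \<Pi>\<^sub>M i\<in>UNIV. borel"

text \<open>The measurability facts are stated for the Borel product space.  A walk with step law \<open>\<nu>\<close> lives on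
  a product of copies of \<open>\<nu>\<close>, which has the same measurable sets.\<close>

lemma measurable_walk [measurable]: "(\<lambda>\<xi>. walk \<xi> k) \<in> borel_measurable step_space"
  unfolding walk_def by measurable

lemma measurable_walk_max [measurable]: "(\<lambda>\<xi>. walk_max (walk \<xi>) n) \<in> borel_measurable step_space"
  unfolding walk_max_def by measurable

lemma measurable_strict_max [measurable]:
  "Measurable.pred step_space (\<lambda>\<xi>. \<forall>j<k. walk \<xi> j < walk \<xi> k)"
  by measurable

lemma measurable_below [measurable]:
  "Measurable.pred step_space (\<lambda>\<xi>. \<forall>j\<le>m. walk \<xi> j \<le> 0)"
  by measurable

lemma measurable_first_max [measurable]:
  "Measurable.pred step_space (\<lambda>\<xi>. first_max_at (walk \<xi>) n k)"
proof -
  have le: "Measurable.pred step_space (\<lambda>\<xi>. walk \<xi> j \<le> walk \<xi> k)" for j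
    unfolding pred_def by (intro borel_measurable_le measurable_walk)
  have "Measurable.pred step_space (\<lambda>\<xi>. \<forall>j. j \<le> n \<longrightarrow> k \<le> j \<longrightarrow> walk \<xi> j \<le> walk \<xi> k)"
    by (rule pred_intros_countable(1), rule pred_intros_imp', rule pred_intros_imp', rule le)
  with measurable_strict_max show ?thesis
    unfolding first_max_at_def by (rule pred_intros_logic(3))
qed

lemma measurable_ladder_term:
  assumes "g \<in> borel_measurable borel"
  shows "(\<lambda>\<xi>. of_bool (\<forall>j<k. walk \<xi> j < walk \<xi> k) * g (walk \<xi> k) :: real) \<in> borel_measurable step_space"
  by (intro borel_measurable_times measurable_compose[OF measurable_strict_max measurable_of_bool]
      measurable_compose[OF measurable_walk assms])

lemma measurable_below_term:
  assumes "h \<in> borel_measurable borel"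
  shows "(\<lambda>\<xi>. of_bool (\<forall>j\<le>m. walk \<xi> j \<le> 0) * h (walk \<xi> m) :: real) \<in> borel_measurable step_space"
  by (intro borel_measurable_times measurable_compose[OF measurable_below measurable_of_bool]
      measurable_compose[OF measurable_walk assms])

lemma measurable_first_max_term:
  assumes "g \<in> borel_measurable borel" "h \<in> borel_measurable borel"
  shows "(\<lambda>\<xi>. of_bool (first_max_at (walk \<xi>) n k) * (g (walk \<xi> k) * h (walk \<xi> n - walk \<xi> k)) :: real)
    \<in> borel_measurable step_space"
  by (intro borel_measurable_times measurable_compose[OF measurable_first_max measurable_of_bool]
      measurable_compose[OF measurable_walk assms(1)]
      measurable_compose[OF borel_measurable_diff[OF measurable_walk measurable_walk] assms(2)])

locale random_walk = sequence_space \<nu> for \<nu> :: "real measure" +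
  assumes sets_step: "sets \<nu> = sets borel"
begin

lemma sets_S [measurable_cong]: "sets S = sets step_space"
  by (intro sets_PiM_cong refl sets_step)

text \<open>The walk up to its first maximiser \<open>k\<close> contributes \<open>ladder_part g k\<close>, the walk restarted there
  contributes \<open>below_part h (n - k)\<close>, and \<open>max_part g h n\<close> is the expectation that they make up.\<close>

definition ladder_part :: "(real \<Rightarrow> real) \<Rightarrow> nat \<Rightarrow> real" where
  "ladder_part g k = (\<integral>\<xi>. of_bool (\<forall>j<k. walk \<xi> j < walk \<xi> k) * g (walk \<xi> k) \<partial>S)"

definition below_part :: "(real \<Rightarrow> real) \<Rightarrow> nat \<Rightarrow> real" where
  "below_part h m = (\<integral>\<xi>. of_bool (\<forall>j\<le>m. walk \<xi> j \<le> 0) * h (walk \<xi> m) \<partial>S)"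

definition max_part :: "(real \<Rightarrow> real) \<Rightarrow> (real \<Rightarrow> real) \<Rightarrow> nat \<Rightarrow> real" where
  "max_part g h n =
     (\<integral>\<xi>. g (walk_max (walk \<xi>) n) * h (walk \<xi> n - walk_max (walk \<xi>) n) \<partial>S)"

text \<open>Splicing two step sequences at \<open>k\<close> decouples the event: the part before \<open>k\<close> sees only the first
  sequence, the part after \<open>k\<close> only the second.\<close>

lemma first_max_at_comb_seq:
  assumes "k \<le> n"
  shows "first_max_at (walk (comb_seq k \<xi> \<eta>)) n k \<longleftrightarrow>
    (\<forall>j<k. walk \<xi> j < walk \<xi> k) \<and> (\<forall>j\<le>n - k. walk \<eta> j \<le> 0)"
proof -
  have "(\<forall>j\<le>n. k \<le> j \<longrightarrow> walk (comb_seq k \<xi> \<eta>) j \<le> walk (comb_seq k \<xi> \<eta>) k) \<longleftrightarrow>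
    (\<forall>j\<le>n - k. walk (comb_seq k \<xi> \<eta>) (k + j) \<le> walk (comb_seq k \<xi> \<eta>) k)" (is "?L \<longleftrightarrow> ?R")
  proof
    assume ?R
    show ?L
    proof (intro allI impI)
      fix j assume "j \<le> n" "k \<le> j"
      then have "j = k + (j - k)" "j - k \<le> n - k" by auto
      with \<open>?R\<close> show "walk (comb_seq k \<xi> \<eta>) j \<le> walk (comb_seq k \<xi> \<eta>) k" by metis
    qed
  qed (use assms in auto)
  then show ?thesis
    unfolding first_max_at_def by (auto simp: walk_comb_seq_le walk_comb_seq_add)
qed

text \<open>Decompose according to the time \<open>k\<close> of the first maximum.  The infinite product law is invariant
  under splicing two independent copies at \<open>k\<close>, and on the spliced sequence the integrand is a
  product of functions of the two copies.\<close>

lemma max_part_convolution: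
  assumes [measurable]: "g \<in> borel_measurable borel" "h \<in> borel_measurable borel"
    and bnd: "\<And>x. \<bar>g x\<bar> \<le> 1" "\<And>x. \<bar>h x\<bar> \<le> 1"
  shows "max_part g h n = (\<Sum>k\<le>n. ladder_part g k * below_part h (n - k))"
proof -
  interpret SS: pair_prob_space S S
    by (intro pair_prob_space.intro pair_sigma_finite.intro P.sigma_finite_measure_axioms P.prob_space_axioms)
  define T where "T k \<xi> = of_bool (first_max_at (walk \<xi>) n k) * (g (walk \<xi> k) * h (walk \<xi> n - walk \<xi> k))"
    for k \<xi>
  define A where "A k \<xi> = of_bool (\<forall>j<k. walk \<xi> j < walk \<xi> k) * g (walk \<xi> k)" for k \<xi>
  define B where "B m \<xi> = of_bool (\<forall>j\<le>m. walk \<xi> j \<le> 0) * h (walk \<xi> m)" for m \<xi>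
  have [measurable]: "A k \<in> borel_measurable S" "B k \<in> borel_measurable S" "T k \<in> borel_measurable S" for k
    unfolding A_def[abs_def] B_def[abs_def] T_def[abs_def] measurable_cong_sets[OF sets_S refl]
    by (intro measurable_ladder_term measurable_below_term measurable_first_max_term assms)+
  have bA: "\<bar>A k \<xi>\<bar> \<le> 1" and bB: "\<bar>B k \<xi>\<bar> \<le> 1" and bT: "\<bar>T k \<xi>\<bar> \<le> 1" for k \<xi>
    using bnd by (auto simp: A_def B_def T_def abs_mult intro!: mult_le_one)
  have iA: "integrable S (A k)" for k by (rule P.integrable_const_bound[where B=1]) (auto simp: bA)
  have iB: "integrable S (B k)" for k by (rule P.integrable_const_bound[where B=1]) (auto simp: bB)
  have iT: "integrable S (T k)" for k by (rule P.integrable_const_bound[where B=1]) (auto simp: bT)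
  have T: "(\<integral>\<xi>. T k \<xi> \<partial>S) = ladder_part g k * below_part h (n - k)" if "k \<le> n" for k
  proof -
    have split: "T k (comb_seq k \<xi> \<eta>) = A k \<xi> * B (n - k) \<eta>" for \<xi> \<eta>
      using that walk_comb_seq_add[of k \<xi> \<eta> "n - k"]
      by (simp add: T_def A_def B_def first_max_at_comb_seq walk_comb_seq_le of_bool_conj)
    have "(\<integral>\<xi>. T k \<xi> \<partial>S) = (\<integral>\<xi>. T k \<xi> \<partial>distr (S \<Otimes>\<^sub>M S) S (\<lambda>(\<xi>, \<eta>). comb_seq k \<xi> \<eta>))"
      by (simp only: PiM_comb_seq)
    also have "\<dots> = (\<integral>z. T k (case z of (\<xi>, \<eta>) \<Rightarrow> comb_seq k \<xi> \<eta>) \<partial>(S \<Otimes>\<^sub>M S))"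
      by (rule integral_distr) measurable
    also have "\<dots> = (\<integral>z. (case z of (\<xi>, \<eta>) \<Rightarrow> A k \<xi> * B (n - k) \<eta>) \<partial>(S \<Otimes>\<^sub>M S))"
      by (intro Bochner_Integration.integral_cong refl) (auto simp: split)
    also have "\<dots> = (\<integral>\<xi>. (\<integral>\<eta>. A k \<xi> * B (n - k) \<eta> \<partial>S) \<partial>S)"
    proof (rule SS.integral_fst[symmetric])
      show "integrable (S \<Otimes>\<^sub>M S) (\<lambda>(\<xi>, \<eta>). A k \<xi> * B (n - k) \<eta>)"
        by (rule SS.P.integrable_const_bound[where B=1], rule AE_I2)
          (auto simp: abs_mult split_beta intro!: mult_le_one bA bB)
    qed
    also have "\<dots> = ladder_part g k * below_part h (n - k)"
      unfolding ladder_part_def below_part_def A_def[symmetric] B_def[symmetric] by simp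
    finally show ?thesis .
  qed
  have "max_part g h n = (\<integral>\<xi>. (\<Sum>k\<le>n. T k \<xi>) \<partial>S)"
    unfolding max_part_def T_def
    by (rule Bochner_Integration.integral_cong[OF refl])
      (rule first_max_decomposition[where \<phi>="\<lambda>m. g m * h (walk _ n - m)"])
  also have "\<dots> = (\<Sum>k\<le>n. \<integral>\<xi>. T k \<xi> \<partial>S)"
    by (rule Bochner_Integration.integral_sum) (rule iT)
  finally show ?thesis using T by simp
qed

lemma abs_integral_le_one:
  fixes u :: "(nat \<Rightarrow> real) \<Rightarrow> real"
  assumes "\<And>\<xi>. \<bar>u \<xi>\<bar> \<le> 1"
  shows "\<bar>\<integral>\<xi>. u \<xi> \<partial>S\<bar> \<le> 1"
proof (cases "integrable S u")
  case True
  have "\<bar>\<integral>\<xi>. u \<xi> \<partial>S\<bar> \<le> (\<integral>\<xi>. \<bar>u \<xi>\<bar> \<partial>S)"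
    using integral_norm_bound[of S u] by simp
  also have "\<dots> \<le> (\<integral>\<xi>. 1 \<partial>S)"
    using True assms by (intro integral_mono) auto
  finally show ?thesis by (simp add: P.prob_space)
next
  case False
  then show ?thesis by (simp add: not_integrable_integral_eq)
qed

lemma part_bounds:
  assumes "\<And>x. \<bar>g x\<bar> \<le> 1"
  shows "\<bar>ladder_part g n\<bar> \<le> 1" "\<bar>below_part g n\<bar> \<le> 1"
  unfolding ladder_part_def below_part_def using assms
  by (auto intro!: abs_integral_le_one simp: abs_mult)

lemma max_part_bound:
  assumes "\<And>x. \<bar>g x\<bar> \<le> 1" "\<And>x. \<bar>h x\<bar> \<le> 1"
  shows "\<bar>max_part g h n\<bar> \<le> 1"
  unfolding max_part_def using assms
  by (auto intro!: abs_integral_le_one mult_le_one simp: abs_mult)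

text \<open>The expectation of \<open>g M\<^sub>N * h (Y\<^sub>N - M\<^sub>N)\<close> for the walk \<open>Y\<close> with running maximum \<open>M\<close> and an independent
  geometric time \<open>N\<close> with \<open>P (N = n) = (1 - \<rho>) \<rho>\<^sup>n\<close>.\<close>

definition geometric_mean :: "real \<Rightarrow> (real \<Rightarrow> real) \<Rightarrow> (real \<Rightarrow> real) \<Rightarrow> real" where
  "geometric_mean \<rho> g h = (1 - \<rho>) * (\<Sum>n. \<rho> ^ n * max_part g h n)"

text \<open>The generating function of a convolution is the product of the generating functions.\<close>

lemma geometric_mean_product:
  assumes \<rho>: "0 \<le> \<rho>" "\<rho> < 1"
    and g: "g \<in> borel_measurable borel" "\<And>x. \<bar>g x\<bar> \<le> 1"
    and h: "h \<in> borel_measurable borel" "\<And>x. \<bar>h x\<bar> \<le> 1"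
  shows "geometric_mean \<rho> g h =
    (1 - \<rho>) * (\<Sum>k. \<rho> ^ k * ladder_part g k) * (\<Sum>m. \<rho> ^ m * below_part h m)"
proof -
  have summ: "summable (\<lambda>k. norm (\<rho> ^ k * c k))" if "\<And>k. \<bar>c k\<bar> \<le> 1" for c :: "nat \<Rightarrow> real"
  proof (rule summable_comparison_test'[of "\<lambda>k. \<rho> ^ k" 0])
    show "summable (\<lambda>k. \<rho> ^ k)" using \<rho> by (simp add: summable_geometric)
    show "norm (norm (\<rho> ^ k * c k)) \<le> \<rho> ^ k" if "k \<ge> 0" for k
      using \<open>\<And>k. \<bar>c k\<bar> \<le> 1\<close>[of k] \<rho> by (simp add: abs_mult mult_left_le)
  qed
  have "(\<Sum>n. \<rho> ^ n * max_part g h n) =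
    (\<Sum>n. \<Sum>k\<le>n. (\<rho> ^ k * ladder_part g k) * (\<rho> ^ (n - k) * below_part h (n - k)))"
  proof (intro suminf_cong)
    fix n
    have "\<rho> ^ n * max_part g h n = (\<Sum>k\<le>n. \<rho> ^ n * (ladder_part g k * below_part h (n - k)))"
      using max_part_convolution[OF g(1) h(1) g(2) h(2)] by (simp add: sum_distrib_left)
    also have "\<dots> = (\<Sum>k\<le>n. (\<rho> ^ k * ladder_part g k) * (\<rho> ^ (n - k) * below_part h (n - k)))"
    proof (intro sum.cong refl)
      fix k assume "k \<in> {..n}"
      then have "\<rho> ^ n = \<rho> ^ k * \<rho> ^ (n - k)" by (simp add: power_add[symmetric])
      then show "\<rho> ^ n * (ladder_part g k * below_part h (n - k)) =
        (\<rho> ^ k * ladder_part g k) * (\<rho> ^ (n - k) * below_part h (n - k))" by (simp only: ac_simps)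
    qed
    finally show "\<rho> ^ n * max_part g h n =
      (\<Sum>k\<le>n. (\<rho> ^ k * ladder_part g k) * (\<rho> ^ (n - k) * below_part h (n - k)))" .
  qed
  also have "\<dots> = (\<Sum>k. \<rho> ^ k * ladder_part g k) * (\<Sum>m. \<rho> ^ m * below_part h m)"
    by (rule Cauchy_product[symmetric]) (intro summ part_bounds g h)+
  finally show ?thesis by (simp add: geometric_mean_def)
qed

lemma geometric_mean_one: "0 \<le> \<rho> \<Longrightarrow> \<rho> < 1 \<Longrightarrow> geometric_mean \<rho> (\<lambda>_. 1) (\<lambda>_. 1) = 1"
  by (simp add: geometric_mean_def max_part_def P.prob_space suminf_geometric)

text \<open>Maximum and drawdown at a geometric time are independent.  Writing \<open>W\<close> for the geometric
  mean, the product form gives \<open>W g h * W 1 1 = W g 1 * W 1 h\<close>, and \<open>W 1 1 = 1\<close> normalises it.\<close>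

lemma geometric_mean_factorizes:
  assumes \<rho>: "0 \<le> \<rho>" "\<rho> < 1"
    and g: "g \<in> borel_measurable borel" "\<And>x. \<bar>g x\<bar> \<le> 1"
    and h: "h \<in> borel_measurable borel" "\<And>x. \<bar>h x\<bar> \<le> 1"
  shows "geometric_mean \<rho> g h = geometric_mean \<rho> g (\<lambda>_. 1) * geometric_mean \<rho> (\<lambda>_. 1) h"
proof -
  note prod = geometric_mean_product[OF \<rho>]
  have "geometric_mean \<rho> g h * geometric_mean \<rho> (\<lambda>_. 1) (\<lambda>_. 1) =
    geometric_mean \<rho> g (\<lambda>_. 1) * geometric_mean \<rho> (\<lambda>_. 1) h"
    by (simp add: prod[OF g h] prod[OF g, of "\<lambda>_. 1"] prod[OF _ _ h, of "\<lambda>_. 1"]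
        prod[of "\<lambda>_. 1" "\<lambda>_. 1"])
  then show ?thesis by (simp add: geometric_mean_one \<rho>)
qed

text \<open>Reversing the first \<open>n\<close> steps preserves the product law and turns \<open>Y\<^sub>k\<close> into \<open>Y\<^sub>n - Y\<^bsub>n-k\<^esub>\<close>, hence the
  minimum of the walk into its drawdown.  The minimum is written as \<open>- max (- Y)\<close>.\<close>

lemma walk_reversal:
  fixes h :: "real \<Rightarrow> real"
  assumes [measurable]: "h \<in> borel_measurable borel"
  shows "(\<integral>\<xi>. h (walk \<xi> n - walk_max (walk \<xi>) n) \<partial>S) =
    (\<integral>\<xi>. h (- walk_max (\<lambda>k. - walk \<xi> k) n) \<partial>S)"
proof -
  define r where "r i = (if i < n then n - Suc i else i)" for i
  have inj: "inj r" unfolding r_def inj_def by (auto split: if_splits)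
  have meas_r [measurable]: "(\<lambda>\<xi> i. \<xi> (r i)) \<in> measurable S S"
    by (rule measurable_PiM_single') (auto simp: space_PiM sets_eq_imp_space_eq[OF sets_step])
  have meas_neg [measurable]: "(\<lambda>\<xi>. walk_max (\<lambda>k. - walk \<xi> k) n) \<in> borel_measurable S"
    unfolding walk_max_def by measurable
  have hm: "(\<lambda>\<xi>. h (- walk_max (\<lambda>k. - walk \<xi> k) n)) \<in> borel_measurable S" by measurable
  have S: "distr S S (\<lambda>\<xi> i. \<xi> (r i)) = S"
    using distr_PiM_reindex[of UNIV "\<lambda>_. \<nu>" r UNIV] inj M.prob_space_axioms by (simp add: restrict_def)
  have walk_r: "walk (\<lambda>i. \<xi> (r i)) k = walk \<xi> n - walk \<xi> (n - k)" if "k \<le> n" for \<xi> k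
  proof -
    have "walk (\<lambda>i. \<xi> (r i)) k = (\<Sum>i<k. \<xi> (n - Suc i))"
      unfolding walk_def r_def using that by (intro sum.cong) auto
    also have "\<dots> = (\<Sum>i\<in>{n-k..<n}. \<xi> i)"
      by (rule sum.reindex_bij_witness[of _ "\<lambda>i. n - Suc i" "\<lambda>i. n - Suc i"]) (use that in auto)
    also have "\<dots> = walk \<xi> n - walk \<xi> (n - k)"
      unfolding walk_def using sum_diff_nat_ivl[of 0 "n - k" n \<xi>] that
      by (simp add: lessThan_atLeast0)
    finally show ?thesis .
  qed
  have max_r: "- walk_max (\<lambda>k. - walk (\<lambda>i. \<xi> (r i)) k) n = walk \<xi> n - walk_max (walk \<xi>) n" for \<xi>
  proof -
    have "(\<lambda>k. - walk (\<lambda>i. \<xi> (r i)) k) ` {..n} = (\<lambda>k. walk \<xi> (n - k) - walk \<xi> n) ` {..n}"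
      by (intro image_cong) (auto simp: walk_r)
    also have "\<dots> = (\<lambda>y. y + - walk \<xi> n) ` walk \<xi> ` {..n}"
    proof -
      have "(\<lambda>k. n - k) ` {..n} = {..n}"
      proof (intro equalityI subsetI)
        fix i assume "i \<in> {..n}"
        then show "i \<in> (\<lambda>k. n - k) ` {..n}" by (intro image_eqI[of _ _ "n - i"]) auto
      qed auto
      then have "walk \<xi> ` {..n} = walk \<xi> ` (\<lambda>k. n - k) ` {..n}" by simp
      then show ?thesis by (simp add: image_image)
    qed
    finally have "walk_max (\<lambda>k. - walk (\<lambda>i. \<xi> (r i)) k) n = walk_max (walk \<xi>) n + - walk \<xi> n"
      unfolding walk_max_def
      using Max_add_commute[of "walk \<xi> ` {..n}" "\<lambda>y. y" "- walk \<xi> n"] by simp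
    then show ?thesis by simp
  qed
  have "(\<integral>\<xi>. h (- walk_max (\<lambda>k. - walk \<xi> k) n) \<partial>S) =
    (\<integral>\<xi>. h (- walk_max (\<lambda>k. - walk \<xi> k) n) \<partial>distr S S (\<lambda>\<xi> i. \<xi> (r i)))"
    by (simp only: S)
  also have "\<dots> = (\<integral>\<xi>. h (- walk_max (\<lambda>k. - walk (\<lambda>i. \<xi> (r i)) k) n) \<partial>S)"
    by (rule integral_distr[OF meas_r hm])
  finally show ?thesis by (simp add: max_r)
qed

end

section \<open>The Levy process on a grid\<close>

abbreviation time_space :: "real measure" where
  "time_space \<equiv> restrict_space borel {0..}"

lemma measurable_grid_index [measurable]: "grid_index n \<in> measurable time_space (count_space UNIV)"
proof -
  have "grid_index n \<in> measurable borel (count_space UNIV)"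
    unfolding grid_index_def[abs_def] by measurable
  then show ?thesis by (rule measurable_restrict_space1)
qed

context levy_process
begin

definition incr :: "real \<Rightarrow> 'a \<Rightarrow> nat \<Rightarrow> real" where
  "incr d \<omega> j = X (real (Suc j) / d) \<omega> - X (real j / d) \<omega>"

lemma cadlag_path: "\<omega> \<in> space M \<Longrightarrow> cadlag (\<lambda>t. X t \<omega>)"
  unfolding cadlag_def using paths_right_continuous paths_left_limits by blast

lemma measurable_X_filtration: "0 \<le> s \<Longrightarrow> s \<le> t \<Longrightarrow> X s \<in> borel_measurable (F t)"
proof -
  assume st: "0 \<le> s" "s \<le> t"
  have "subalgebra (F t) (F s)"
    using subalg[of s] subalg[of t] filtration_mono[of s t] st by (auto simp: subalgebra_def)
  then show ?thesis using adapted[OF st(1)] by (rule measurable_from_subalg)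
qed

lemma measurable_X [measurable (raw)]: "0 \<le> t \<Longrightarrow> X t \<in> borel_measurable M"
  using subalg adapted by (rule measurable_from_subalg)

lemma measurable_incr: "0 < d \<Longrightarrow> (\<lambda>\<omega>. incr d \<omega> j) \<in> borel_measurable M"
  unfolding incr_def by (intro borel_measurable_diff measurable_X) auto

lemma walk_incr:
  assumes "0 < d" "\<omega> \<in> space M"
  shows "walk (incr d \<omega>) k = X (real k / d) \<omega>"
  unfolding walk_def incr_def
  using sum_lessThan_telescope[of "\<lambda>j. X (real j / d) \<omega>" k] start[OF assms(2)] by simp

text \<open>Events about the first \<open>n\<close> increments belong to the filtration at the \<open>n\<close>-th grid time, so the next
  increment is independent of them.  The membership has to be carried through the induction.\<close>

lemma prob_incr_Inter:
  assumes d: "0 < d"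
    and E: "\<And>j. j < n \<Longrightarrow> \<exists>B\<in>sets borel. E j = (\<lambda>\<omega>. incr d \<omega> j) -` B \<inter> space M"
  shows "space M \<inter> (\<Inter>j<n. E j) \<in> sets (F (real n / d)) \<and>
    prob (space M \<inter> (\<Inter>j<n. E j)) = (\<Prod>j<n. prob (E j))"
  using E
proof (induction n)
  case 0
  have "space M \<in> sets (F 0)" using subalg[of 0] sets.top[of "F 0"] by (simp add: subalgebra_def)
  then show ?case by (simp add: prob_space)
next
  case (Suc n)
  let ?A = "space M \<inter> (\<Inter>j<n. E j)"
  have IH: "?A \<in> sets (F (real n / d))" "prob ?A = (\<Prod>j<n. prob (E j))"
    using Suc by auto
  obtain B where B: "B \<in> sets borel" "E n = (\<lambda>\<omega>. incr d \<omega> n) -` B \<inter> space M"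
    using Suc.prems[of n] by auto
  have le: "0 \<le> real n / d" "real n / d \<le> real (Suc n) / d"
    using d by (auto intro: divide_right_mono)
  have sp: "space (F (real (Suc n) / d)) = space M"
    using subalg[of "real (Suc n) / d"] d by (simp add: subalgebra_def)
  have split: "space M \<inter> (\<Inter>j<Suc n. E j) = ?A \<inter> E n"
    by (auto simp: lessThan_Suc)
  have EnF: "E n \<in> sets (F (real (Suc n) / d))"
  proof -
    have "(\<lambda>\<omega>. incr d \<omega> n) \<in> borel_measurable (F (real (Suc n) / d))"
      unfolding incr_def using le by (intro borel_measurable_diff measurable_X_filtration) auto
    from measurable_sets[OF this B(1)] show ?thesis by (simp only: B(2) sp)
  qed
  have "?A \<in> sets (F (real (Suc n) / d))"
    using IH(1) filtration_mono[OF le] by blast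
  with EnF have 1: "?A \<inter> E n \<in> sets (F (real (Suc n) / d))" by blast
  have "E n \<in> sets (vimage_algebra (space M) (\<lambda>\<omega>. X (real (Suc n) / d) \<omega> - X (real n / d) \<omega>) borel)"
    unfolding B(2) incr_def by (rule in_vimage_algebra[OF B(1)])
  from indep_setD[OF indep_increments[OF le] IH(1) this]
  have "prob (?A \<inter> E n) = (\<Prod>j<Suc n. prob (E j))" by (simp add: IH(2))
  with 1 show ?case by (simp add: split)
qed

text \<open>Independence asks for arbitrary finite index sets; padding with the sure event reduces them to
  initial segments.\<close>

lemma indep_vars_incr:
  assumes d: "0 < d"
  shows "indep_vars (\<lambda>_. borel) (\<lambda>j \<omega>. incr d \<omega> j) UNIV"
  unfolding indep_vars_def2
proof (intro conjI ballI indep_setsI)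
  fix j show "random_variable borel (\<lambda>\<omega>. incr d \<omega> j)" by (rule measurable_incr[OF d])
  show "{(\<lambda>\<omega>. incr d \<omega> j) -` A \<inter> space M |A. A \<in> sets borel} \<subseteq> events"
    using measurable_incr[OF d] by (auto simp: measurable_sets)
next
  fix A :: "nat \<Rightarrow> 'a set" and J :: "nat set"
  assume J: "J \<noteq> {}" "finite J"
    and A: "\<forall>j\<in>J. A j \<in> {(\<lambda>\<omega>. incr d \<omega> j) -` A \<inter> space M |A. A \<in> sets borel}"
  define E where "E j = (if j \<in> J then A j else space M)" for j
  obtain n where n: "J \<subseteq> {..<n}" using finite_nat_bounded[OF J(2)] by blast
  have E: "\<exists>B\<in>sets borel. E j = (\<lambda>\<omega>. incr d \<omega> j) -` B \<inter> space M" for j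
  proof (cases "j \<in> J")
    case True
    with A obtain B where "A j = (\<lambda>\<omega>. incr d \<omega> j) -` B \<inter> space M" "B \<in> sets borel" by blast
    with True show ?thesis by (auto simp: E_def)
  qed (auto simp: E_def intro: bexI[of _ UNIV])
  have "A j \<subseteq> space M" if "j \<in> J" for j using A that by auto
  then have "(\<Inter>j\<in>J. A j) = space M \<inter> (\<Inter>j<n. E j)"
    using J(1) n unfolding E_def by (auto split: if_splits)
  then have "prob (\<Inter>j\<in>J. A j) = (\<Prod>j<n. prob (E j))"
    using prob_incr_Inter[OF d, of n E] E by simp
  also have "\<dots> = (\<Prod>j\<in>J. prob (A j))"
    using n by (intro prod.mono_neutral_cong_right) (auto simp: E_def prob_space)
  finally show "prob (\<Inter>j\<in>J. A j) = (\<Prod>j\<in>J. prob (A j))" .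
qed

lemma random_walk_step: "0 \<le> t \<Longrightarrow> random_walk (distr M borel (X t))"
proof -
  assume "0 \<le> t"
  then interpret N: prob_space "distr M borel (X t)"
    by (intro prob_space_distr measurable_X)
  show ?thesis
    by unfold_locales simp_all
qed

lemma distr_incr:
  assumes d: "0 < d"
  shows "distr M step_space (incr d) = (\<Pi>\<^sub>M j\<in>UNIV. distr M borel (X (1 / d)))"
proof -
  have "distr M borel (\<lambda>\<omega>. incr d \<omega> j) = distr M borel (X (1 / d))" for j
  proof -
    have "real j / d \<le> real (Suc j) / d" using d by (simp add: divide_right_mono)
    moreover have "real (Suc j) / d - real j / d = 1 / d" by (simp add: diff_divide_distrib[symmetric])
    ultimately show ?thesis
      using stationary_increments[of "real j / d" "real (Suc j) / d"] d by (simp add: incr_def)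
  qed
  then show ?thesis
    using indep_vars_iff_distr_eq_PiM[where I=UNIV and M'="\<lambda>_. borel" and X="\<lambda>j \<omega>. incr d \<omega> j"]
      indep_vars_incr[OF d] measurable_incr[OF d]
    by (simp add: restrict_def)
qed

lemma integral_incr:
  fixes u :: "(nat \<Rightarrow> real) \<Rightarrow> real"
  assumes d: "0 < d" and u: "u \<in> borel_measurable step_space"
  shows "(\<integral>\<omega>. u (incr d \<omega>) \<partial>M) = (\<integral>\<xi>. u \<xi> \<partial>(\<Pi>\<^sub>M j\<in>UNIV. distr M borel (X (1 / d))))"
proof -
  have "incr d \<in> measurable M step_space"
    using measurable_incr[OF d] by (intro measurable_PiM_single') (auto simp: space_PiM)
  from integral_distr[OF this u] show ?thesis by (simp add: distr_incr[OF d])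
qed

lemma measurable_grid_process [measurable]:
  "(\<lambda>z. X (grid_point n (snd z)) (fst z)) \<in> borel_measurable (M \<Otimes>\<^sub>M time_space)"
  unfolding grid_point_def
  by (rule measurable_compose_countable[where f="\<lambda>k z. X (real k / real (Suc n)) (fst z)"
        and g="\<lambda>z. grid_index n (snd z)"])
    (auto intro!: measurable_compose[OF measurable_fst measurable_X]
      measurable_compose[OF measurable_snd measurable_grid_index])

lemma measurable_grid_max [measurable]:
  "(\<lambda>z. walk_max (\<lambda>k. X (real k / real (Suc n)) (fst z)) (grid_index n (snd z)))
    \<in> borel_measurable (M \<Otimes>\<^sub>M time_space)"
proof (rule measurable_compose_countable[where f="\<lambda>m z. walk_max (\<lambda>k. X (real k / real (Suc n)) (fst z)) m"
        and g="\<lambda>z. grid_index n (snd z)"])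
  show "(\<lambda>z. walk_max (\<lambda>k. X (real k / real (Suc n)) (fst z)) m) \<in> borel_measurable (M \<Otimes>\<^sub>M time_space)" for m
    unfolding walk_max_def
    by (intro borel_measurable_Max measurable_compose[OF measurable_fst measurable_X]) auto
qed (intro measurable_compose[OF measurable_snd measurable_grid_index])

lemma measurable_grid_min [measurable]:
  "(\<lambda>z. - walk_max (\<lambda>k. - X (real k / real (Suc n)) (fst z)) (grid_index n (snd z)))
    \<in> borel_measurable (M \<Otimes>\<^sub>M time_space)"
proof (rule measurable_compose_countable[where f="\<lambda>m z. - walk_max (\<lambda>k. - X (real k / real (Suc n)) (fst z)) m"
        and g="\<lambda>z. grid_index n (snd z)"])
  show "(\<lambda>z. - walk_max (\<lambda>k. - X (real k / real (Suc n)) (fst z)) m) \<in> borel_measurable (M \<Otimes>\<^sub>M time_space)" for m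
    unfolding walk_max_def
    by (intro borel_measurable_uminus borel_measurable_Max measurable_compose[OF measurable_fst measurable_X]) auto
qed (intro measurable_compose[OF measurable_snd measurable_grid_index])

lemma grid_limits:
  assumes "z \<in> space (M \<Otimes>\<^sub>M time_space)"
  shows "(\<lambda>n. X (grid_point n (snd z)) (fst z)) \<longlonglongrightarrow> X (snd z) (fst z)"
    and "(\<lambda>n. walk_max (\<lambda>k. X (real k / real (Suc n)) (fst z)) (grid_index n (snd z)))
      \<longlonglongrightarrow> running_sup X (snd z) (fst z)"
    and "(\<lambda>n. - walk_max (\<lambda>k. - X (real k / real (Suc n)) (fst z)) (grid_index n (snd z)))
      \<longlonglongrightarrow> running_inf X (snd z) (fst z)"
proof -
  have z: "fst z \<in> space M" "0 \<le> snd z" using assms by (auto simp: space_pair_measure space_restrict_space)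
  note c = cadlag_path[OF z(1)]
  show "(\<lambda>n. X (grid_point n (snd z)) (fst z)) \<longlonglongrightarrow> X (snd z) (fst z)"
    by (rule cadlag_grid_tendsto[OF c z(2)])
  show "(\<lambda>n. walk_max (\<lambda>k. X (real k / real (Suc n)) (fst z)) (grid_index n (snd z)))
      \<longlonglongrightarrow> running_sup X (snd z) (fst z)"
    unfolding running_sup_def by (rule grid_max_tendsto[OF c z(2)])
  show "(\<lambda>n. - walk_max (\<lambda>k. - X (real k / real (Suc n)) (fst z)) (grid_index n (snd z)))
      \<longlonglongrightarrow> running_inf X (snd z) (fst z)"
    unfolding running_inf_def by (rule grid_min_tendsto[OF c z(2)])
qed

text \<open>Joint measurability in path and time is inherited from the grid approximations, which take
  countably many values of time only.\<close>

lemma measurable_process [measurable]: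
  "(\<lambda>z. X (snd z) (fst z)) \<in> borel_measurable (M \<Otimes>\<^sub>M time_space)"
  "(\<lambda>z. running_sup X (snd z) (fst z)) \<in> borel_measurable (M \<Otimes>\<^sub>M time_space)"
  "(\<lambda>z. running_inf X (snd z) (fst z)) \<in> borel_measurable (M \<Otimes>\<^sub>M time_space)"
  by (rule borel_measurable_LIMSEQ_real[OF grid_limits(1) measurable_grid_process],
      assumption)
    (rule borel_measurable_LIMSEQ_real[OF grid_limits(2) measurable_grid_max]
       borel_measurable_LIMSEQ_real[OF grid_limits(3) measurable_grid_min], assumption)+

end

section \<open>Exponential times and measures on the plane\<close>

lemma sets_exp_law [measurable_cong]: "sets (exp_law p) = sets time_space"
  unfolding exp_law_def by (intro sets_restrict_space_cong) simp

lemma space_exp_law: "space (exp_law p) = {0..}"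
  by (simp add: exp_law_def space_restrict_space)

lemma nn_integral_exp_law:
  assumes "k \<in> borel_measurable time_space"
  shows "(\<integral>\<^sup>+ t. k t \<partial>exp_law p) =
    (\<integral>\<^sup>+ t. ennreal (p * exp (- p * t)) * (k t * indicator {0..} t) \<partial>lborel)"
proof -
  have k: "(\<lambda>t. k t * indicator {0..} t) \<in> borel_measurable lborel"
    using assms by (subst (asm) borel_measurable_restrict_space_iff_ennreal) auto
  have "(\<integral>\<^sup>+ t. k t \<partial>exp_law p) =
    (\<integral>\<^sup>+ t. k t * indicator {0..} t \<partial>density lborel (exponential_density p))"
    unfolding exp_law_def by (rule nn_integral_restrict_space) auto
  also have "\<dots> = (\<integral>\<^sup>+ t. ennreal (exponential_density p t) * (k t * indicator {0..} t) \<partial>lborel)"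
    by (rule nn_integral_density) (use k in auto)
  also have "\<dots> = (\<integral>\<^sup>+ t. ennreal (p * exp (- p * t)) * (k t * indicator {0..} t) \<partial>lborel)"
    by (intro nn_integral_cong) (auto simp: exponential_density_def indicator_def mult.commute)
  finally show ?thesis .
qed

lemma integral_exp_law:
  fixes k :: "real \<Rightarrow> 'b::{banach, second_countable_topology}"
  assumes p: "0 < p" and k: "k \<in> borel_measurable time_space"
  shows "integrable (exp_law p) k \<longleftrightarrow> integrable lborel (\<lambda>t. indicator {0..} t *\<^sub>R (p * exp (- p * t)) *\<^sub>R k t)"
    and "(LINT t|exp_law p. k t) = (LINT t|lborel. indicator {0..} t *\<^sub>R (p * exp (- p * t)) *\<^sub>R k t)"
proof -
  have m: "(\<lambda>t. indicator {0..} t *\<^sub>R k t) \<in> borel_measurable lborel"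
    using k by (subst (asm) borel_measurable_restrict_space_iff) auto
  have nn: "AE t in lborel. 0 \<le> exponential_density p t"
    using p by (intro AE_I2 exponential_density_nonneg)
  have eq: "exponential_density p t *\<^sub>R indicator {0..} t *\<^sub>R k t =
      indicator {0..} t *\<^sub>R (p * exp (- p * t)) *\<^sub>R k t" for t
    by (auto simp: exponential_density_def indicator_def mult.commute)
  have S: "{0..} \<inter> space (density lborel (exponential_density p)) \<in> sets (density lborel (exponential_density p))"
    by simp
  show "integrable (exp_law p) k \<longleftrightarrow> integrable lborel (\<lambda>t. indicator {0..} t *\<^sub>R (p * exp (- p * t)) *\<^sub>R k t)"
    unfolding exp_law_def integrable_restrict_space[OF S] eq[symmetric]
    by (rule integrable_density[OF m _ nn]) simp
  show "(LINT t|exp_law p. k t) = (LINT t|lborel. indicator {0..} t *\<^sub>R (p * exp (- p * t)) *\<^sub>R k t)"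
    unfolding exp_law_def integral_restrict_space[OF S] eq[symmetric]
    by (rule integral_density[OF m _ nn]) simp
qed

lemma prob_space_exp_law: "0 < p \<Longrightarrow> prob_space (exp_law p)"
proof -
  assume p: "0 < p"
  interpret D: prob_space "density lborel (exponential_density p)"
    by (rule prob_space_exponential_density[OF p])
  have "emeasure (density lborel (exponential_density p)) {0..} =
    emeasure (density lborel (exponential_density p)) UNIV"
    by (subst (1 2) emeasure_density) (auto simp: exponential_density_def indicator_def intro!: nn_integral_cong)
  then show ?thesis
    unfolding exp_law_def using D.emeasure_space_1 by (intro prob_space_restrict_space) auto
qed

lemma emeasure_exp_law_interval:
  assumes p: "0 < p" and ab: "0 \<le> a" "a \<le> b"
  shows "emeasure (exp_law p) {a..<b} = ennreal (exp (- p * a) - exp (- p * b))"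
proof -
  have "{a..<b} = {0..} \<inter> {a..<b}" using ab by auto
  then have s: "{a..<b} \<in> sets time_space"
    unfolding sets_restrict_space by (metis image_eqI atLeastLessThan_borel)
  have "emeasure (exp_law p) {a..<b} = (\<integral>\<^sup>+ t. indicator {a..<b} t \<partial>exp_law p)"
    using s by (simp add: sets_exp_law)
  also have "\<dots> = (\<integral>\<^sup>+ t. ennreal (p * exp (- p * t)) * (indicator {a..<b} t * indicator {0..} t) \<partial>lborel)"
    using s by (intro nn_integral_exp_law borel_measurable_indicator)
  also have "\<dots> = (\<integral>\<^sup>+ t. ennreal (p * exp (- p * t)) * indicator {a..b} t \<partial>lborel)"
  proof (rule nn_integral_cong_AE)
    show "AE t in lborel. ennreal (p * exp (- p * t)) * (indicator {a..<b} t * indicator {0..} t) =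
        ennreal (p * exp (- p * t)) * indicator {a..b} t"
      using AE_lborel_singleton[of b] by eventually_elim (use ab in \<open>auto simp: indicator_def\<close>)
  qed
  also have "\<dots> = ennreal ((- exp (- p * b)) - (- exp (- p * a)))"
    using p ab by (intro nn_integral_FTC_Icc) (auto intro!: derivative_eq_intros)
  finally show ?thesis by simp
qed

lemma measurable_floor_exp_law: "(\<lambda>t. nat \<lfloor>t * d\<rfloor>) \<in> measurable (exp_law p) (count_space UNIV)"
proof -
  have "(\<lambda>t. nat \<lfloor>t * d\<rfloor>) \<in> measurable borel (count_space UNIV)" by measurable
  then show ?thesis
    unfolding measurable_cong_sets[OF sets_exp_law refl] by (rule measurable_restrict_space1)
qed

text \<open>Rounding an exponential time down to a grid gives a geometric time; this is the bridge between
  the exponential killing of the process and the geometric killing of the walk.\<close>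

lemma distr_floor_exp_law:
  assumes p: "0 < p" and d: "0 < d"
  shows "distr (exp_law p) (count_space UNIV) (\<lambda>t. nat \<lfloor>t * d\<rfloor>) =
    density (count_space UNIV) (\<lambda>k. ennreal ((1 - exp (- p / d)) * exp (- p / d) ^ k))"
proof (rule measure_eqI_countable[of _ UNIV])
  fix k :: nat
  have "(\<lambda>t. nat \<lfloor>t * d\<rfloor>) -` {k} \<inter> space (exp_law p) = {real k / d..<real (Suc k) / d}"
  proof (intro set_eqI iffI)
    fix t assume "t \<in> (\<lambda>t. nat \<lfloor>t * d\<rfloor>) -` {k} \<inter> space (exp_law p)"
    then have "0 \<le> t" "nat \<lfloor>t * d\<rfloor> = k" by (auto simp: space_exp_law)
    moreover from this d have "0 \<le> \<lfloor>t * d\<rfloor>" by simp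
    ultimately have "\<lfloor>t * d\<rfloor> = int k" by linarith
    then have "real k \<le> t * d" "t * d < real k + 1" by (simp_all add: floor_eq_iff)
    then show "t \<in> {real k / d..<real (Suc k) / d}" using d by (simp add: field_simps)
  next
    fix t assume "t \<in> {real k / d..<real (Suc k) / d}"
    then have t: "real k \<le> t * d" "t * d < real k + 1" using d by (simp_all add: field_simps)
    then have "0 \<le> t" using d by (metis of_nat_0_le_iff order_trans zero_le_mult_iff not_less)
    moreover have "\<lfloor>t * d\<rfloor> = int k" using t by (simp add: floor_eq_iff)
    ultimately show "t \<in> (\<lambda>t. nat \<lfloor>t * d\<rfloor>) -` {k} \<inter> space (exp_law p)" by (simp add: space_exp_law)
  qed
  then have "emeasure (distr (exp_law p) (count_space UNIV) (\<lambda>t. nat \<lfloor>t * d\<rfloor>)) {k} =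
    ennreal (exp (- p * (real k / d)) - exp (- p * (real (Suc k) / d)))"
    using p d by (subst emeasure_distr[OF measurable_floor_exp_law]) (simp_all add: emeasure_exp_law_interval divide_right_mono)
  also have "exp (- p * (real k / d)) - exp (- p * (real (Suc k) / d)) = (1 - exp (- p / d)) * exp (- p / d) ^ k"
  proof -
    have e: "exp (- p * (real j / d)) = exp (- p / d) ^ j" for j
      by (simp add: exp_of_nat_mult[symmetric] mult.commute)
    show ?thesis unfolding e by (simp add: algebra_simps)
  qed
  finally show "emeasure (distr (exp_law p) (count_space UNIV) (\<lambda>t. nat \<lfloor>t * d\<rfloor>)) {k} =
    emeasure (density (count_space UNIV) (\<lambda>k. ennreal ((1 - exp (- p / d)) * exp (- p / d) ^ k))) {k}"
    by (subst emeasure_density) (auto simp: nn_integral_count_space_indicator nn_integral_count_space_finite intro: nn_integral_cong)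
qed auto

lemma integral_grid_exp_law:
  fixes c :: "nat \<Rightarrow> real"
  assumes p: "0 < p" and d: "0 < d" and c: "\<And>k. \<bar>c k\<bar> \<le> 1"
  shows "(LINT t|exp_law p. c (nat \<lfloor>t * d\<rfloor>)) = (1 - exp (- p / d)) * (\<Sum>k. exp (- p / d) ^ k * c k)"
proof -
  define \<rho> where "\<rho> = exp (- p / d)"
  have \<rho>: "0 \<le> \<rho>" "\<rho> < 1" using p d by (auto simp: \<rho>_def)
  have summ: "summable (\<lambda>k. norm (\<rho> ^ k * c k))"
  proof (rule summable_comparison_test'[of "\<lambda>k. \<rho> ^ k" 0])
    show "summable (\<lambda>k. \<rho> ^ k)" using \<rho> by (simp add: summable_geometric)
    show "norm (norm (\<rho> ^ k * c k)) \<le> \<rho> ^ k" for k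
      using c[of k] \<rho> by (simp add: abs_mult mult_left_le)
  qed
  have "(LINT t|exp_law p. c (nat \<lfloor>t * d\<rfloor>)) =
    (LINT k|distr (exp_law p) (count_space UNIV) (\<lambda>t. nat \<lfloor>t * d\<rfloor>). c k)"
    by (rule integral_distr[OF measurable_floor_exp_law, symmetric]) simp
  also have "\<dots> = (LINT k|count_space UNIV. ((1 - \<rho>) * \<rho> ^ k) *\<^sub>R c k)"
    unfolding distr_floor_exp_law[OF p d] \<rho>_def[symmetric] using \<rho>
    by (intro integral_density) auto
  also have "\<dots> = (\<Sum>k. (1 - \<rho>) * (\<rho> ^ k * c k))"
  proof -
    have "summable (\<lambda>k. norm (((1 - \<rho>) * \<rho> ^ k) *\<^sub>R c k))"
      using summable_mult[OF summ, of "\<bar>1 - \<rho>\<bar>"] by (simp add: abs_mult mult.assoc)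
    then have "integrable (count_space UNIV) (\<lambda>k. ((1 - \<rho>) * \<rho> ^ k) *\<^sub>R c k)"
      by (simp add: integrable_count_space_nat_iff)
    from sums_integral_count_space_nat[OF this] show ?thesis
      by (simp add: sums_iff mult.assoc)
  qed
  also have "\<dots> = (1 - \<rho>) * (\<Sum>k. \<rho> ^ k * c k)"
    using summable_norm_cancel[OF summ] by (rule suminf_mult)
  finally show ?thesis by (simp add: \<rho>_def)
qed

lemma cts_step_tendsto: "(\<lambda>k. cts_step a (a + 1 / real (Suc k)) x) \<longlonglongrightarrow> indicator {..a} x"
proof (cases "x \<le> a")
  case True
  then show ?thesis by (simp add: cts_step_def)
next
  case False
  then have "0 < x - a" by simp
  have "(\<lambda>k. 1 / real (Suc k)) \<longlonglongrightarrow> 0" by (intro LIMSEQ_Suc lim_inverse_n')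
  then have "eventually (\<lambda>k. 1 / real (Suc k) < x - a) sequentially"
    using \<open>0 < x - a\<close> by (rule order_tendstoD(2))
  then have "eventually (\<lambda>k. cts_step a (a + 1 / real (Suc k)) x = indicator {..a} x) sequentially"
    by eventually_elim (use False in \<open>auto simp: cts_step_def\<close>)
  then show ?thesis by (rule tendsto_eventually)
qed

lemma cts_step_bounds: "a < b \<Longrightarrow> \<bar>cts_step a b x\<bar> \<le> 1"
  by (auto simp: cts_step_def field_simps)

text \<open>Products of step functions approximate indicators of quadrants \<open>{..a}\<close>, which form a
  generator of the Borel sets of the plane that is closed under intersection.\<close>

lemma real_plane_measure_eqI:
  fixes N1 N2 :: "(real \<times> real) measure"
  assumes N1: "prob_space N1" "sets N1 = sets borel" and N2: "prob_space N2" "sets N2 = sets borel"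
    and eq: "\<And>g h :: real \<Rightarrow> real. continuous_on UNIV g \<Longrightarrow> continuous_on UNIV h \<Longrightarrow>
      (\<And>x. \<bar>g x\<bar> \<le> 1) \<Longrightarrow> (\<And>x. \<bar>h x\<bar> \<le> 1) \<Longrightarrow>
      (LINT z|N1. g (fst z) * h (snd z)) = (LINT z|N2. g (fst z) * h (snd z))"
  shows "N1 = N2"
proof (rule measure_eqI_generator_eq[where E="range (\<lambda>a::real \<times> real. {..a})" and \<Omega>=UNIV
      and A="\<lambda>i. {..(real i, real i)}"])
  interpret N1: prob_space N1 by fact
  interpret N2: prob_space N2 by fact
  have le: "{..a} = {z. fst z \<le> fst a \<and> snd z \<le> snd a}" for a :: "real \<times> real"
    by (auto simp: less_eq_prod_def)
  show "Int_stable (range (\<lambda>a::real \<times> real. {..a}))"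
  proof (rule Int_stableI_image)
    fix a b :: "real \<times> real"
    have "{..a} \<inter> {..b} = {..(min (fst a) (fst b), min (snd a) (snd b))}" unfolding le by auto
    then show "\<exists>c\<in>UNIV. {..a} \<inter> {..b} = {..c}" by blast
  qed
  show "sets N1 = sigma_sets UNIV (range (\<lambda>a::real \<times> real. {..a}))"
    "sets N2 = sigma_sets UNIV (range (\<lambda>a::real \<times> real. {..a}))"
    unfolding N1(2) N2(2) by (subst borel_eq_atMost, simp)+
  show "(\<Union>i. {..(real i, real i)}) = (UNIV :: (real \<times> real) set)"
  proof -
    have "\<exists>i. z \<in> {..(real i, real i)}" for z :: "real \<times> real"
    proof -
      obtain i where "max (fst z) (snd z) \<le> real i" using real_arch_simple by blast
      then show ?thesis by (auto simp: le)
    qed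
    then show ?thesis by blast
  qed
  show "emeasure N1 {..(real i, real i)} \<noteq> \<infinity>" for i by simp
  fix X assume "X \<in> range (\<lambda>a::real \<times> real. {..a})"
  then obtain a where X: "X = {..a}" by blast
  have lim: "(\<lambda>k. LINT z|N. cts_step (fst a) (fst a + 1 / real (Suc k)) (fst z) *
      cts_step (snd a) (snd a + 1 / real (Suc k)) (snd z)) \<longlonglongrightarrow> measure N X"
    if N: "prob_space N" "sets N = sets borel" for N :: "(real \<times> real) measure"
  proof -
    interpret N: prob_space N by fact
    note [measurable_cong] = N(2)
    have m [measurable]: "cts_step u v \<in> borel_measurable borel" if "u < v" for u v
      by (intro borel_measurable_continuous_onI uniformly_continuous_imp_continuous cts_step_uniformly_continuous that)
    have "(\<lambda>k. LINT z|N. cts_step (fst a) (fst a + 1 / real (Suc k)) (fst z) *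
      cts_step (snd a) (snd a + 1 / real (Suc k)) (snd z)) \<longlonglongrightarrow>
      (LINT z|N. indicator {..fst a} (fst z) * indicator {..snd a} (snd z))"
    proof (rule integral_dominated_convergence[where w="\<lambda>_. 1"])
      show "(\<lambda>z. cts_step (fst a) (fst a + 1 / real (Suc k)) (fst z) *
        cts_step (snd a) (snd a + 1 / real (Suc k)) (snd z)) \<in> borel_measurable N" for k
        unfolding measurable_cong_sets[OF N(2) refl]
        by (intro borel_measurable_times measurable_compose[OF _ m])
          (auto intro!: borel_measurable_continuous_onI continuous_intros)
      show "(\<lambda>z. indicator {..fst a} (fst z) * indicator {..snd a} (snd z) :: real) \<in> borel_measurable N"
        unfolding measurable_cong_sets[OF N(2) refl]
        by (intro borel_measurable_times measurable_compose[OF _ borel_measurable_indicator])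
          (auto intro!: borel_measurable_continuous_onI continuous_intros)
      show "AE z in N. (\<lambda>k. cts_step (fst a) (fst a + 1 / real (Suc k)) (fst z) *
        cts_step (snd a) (snd a + 1 / real (Suc k)) (snd z)) \<longlonglongrightarrow>
        indicator {..fst a} (fst z) * indicator {..snd a} (snd z)"
        by (intro AE_I2 tendsto_mult cts_step_tendsto)
      show "AE z in N. norm (cts_step (fst a) (fst a + 1 / real (Suc k)) (fst z) *
        cts_step (snd a) (snd a + 1 / real (Suc k)) (snd z)) \<le> 1" for k
        by (intro AE_I2) (auto simp: abs_mult intro!: mult_le_one cts_step_bounds)
    qed simp
    also have "(LINT z|N. indicator {..fst a} (fst z) * indicator {..snd a} (snd z)) = (LINT z|N. (indicator X z :: real))"
      by (intro Bochner_Integration.integral_cong refl) (auto simp: X le indicator_def)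
    also have "(LINT z|N. (indicator X z :: real)) = measure N X"
      using sets_eq_imp_space_eq[OF N(2)] by simp
    finally show ?thesis .
  qed
  have "measure N1 X = measure N2 X"
  proof (rule LIMSEQ_unique[OF lim[OF N1]])
    have "(LINT z|N1. cts_step (fst a) (fst a + 1 / real (Suc k)) (fst z) *
        cts_step (snd a) (snd a + 1 / real (Suc k)) (snd z)) =
      (LINT z|N2. cts_step (fst a) (fst a + 1 / real (Suc k)) (fst z) *
        cts_step (snd a) (snd a + 1 / real (Suc k)) (snd z))" for k
      by (intro eq cts_step_bounds uniformly_continuous_imp_continuous cts_step_uniformly_continuous) auto
    with lim[OF N2] show "(\<lambda>k. LINT z|N1. cts_step (fst a) (fst a + 1 / real (Suc k)) (fst z) *
      cts_step (snd a) (snd a + 1 / real (Suc k)) (snd z)) \<longlonglongrightarrow> measure N2 X" by simp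
  qed
  then show "emeasure N1 X = emeasure N2 X"
    by (simp add: N1.emeasure_eq_measure N2.emeasure_eq_measure)
qed auto

section \<open>The Wiener-Hopf factorization\<close>

abbreviation (input) killed_space :: "'a measure \<Rightarrow> real \<Rightarrow> ('a \<times> real) measure" where
  "killed_space M p \<equiv> M \<Otimes>\<^sub>M exp_law p"

lemma sets_killed_space [measurable_cong]: "sets (killed_space M p) = sets (M \<Otimes>\<^sub>M time_space)"
  by (intro sets_pair_measure_cong refl sets_exp_law)

lemma (in prob_space) pair_prob_space_killed: "0 < p \<Longrightarrow> pair_prob_space M (exp_law p)"
  using prob_space_exp_law prob_space_axioms
  by (intro pair_prob_space.intro pair_sigma_finite.intro prob_space_imp_sigma_finite)

lemma (in prob_space) prob_space_killed: "0 < p \<Longrightarrow> prob_space (killed_space M p)"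
  using prob_space_exp_law prob_space_axioms by (intro prob_space_pair)

context levy_process
begin

definition grid_value :: "nat \<Rightarrow> 'a \<times> real \<Rightarrow> real" where
  "grid_value n z = X (grid_point n (snd z)) (fst z)"

definition grid_max :: "nat \<Rightarrow> 'a \<times> real \<Rightarrow> real" where
  "grid_max n z = walk_max (\<lambda>k. X (real k / real (Suc n)) (fst z)) (grid_index n (snd z))"

definition grid_min :: "nat \<Rightarrow> 'a \<times> real \<Rightarrow> real" where
  "grid_min n z = - walk_max (\<lambda>k. - X (real k / real (Suc n)) (fst z)) (grid_index n (snd z))"

lemma measurable_grid_functions:
  "grid_value n \<in> borel_measurable (killed_space M p)"
  "grid_max n \<in> borel_measurable (killed_space M p)"
  "grid_min n \<in> borel_measurable (killed_space M p)"
  unfolding measurable_cong_sets[OF sets_killed_space refl] grid_value_def[abs_def]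
    grid_max_def[abs_def] grid_min_def[abs_def]
  by (rule measurable_grid_process measurable_grid_max measurable_grid_min)+

lemma measurable_killed_functions:
  "(\<lambda>z. X (snd z) (fst z)) \<in> borel_measurable (killed_space M p)"
  "(\<lambda>z. running_sup X (snd z) (fst z)) \<in> borel_measurable (killed_space M p)"
  "(\<lambda>z. running_inf X (snd z) (fst z)) \<in> borel_measurable (killed_space M p)"
  unfolding measurable_cong_sets[OF sets_killed_space refl]
  by (rule measurable_process)+

lemma grid_function_limits:
  assumes "z \<in> space (killed_space M p)"
  shows "(\<lambda>n. grid_value n z) \<longlonglongrightarrow> X (snd z) (fst z)"
    and "(\<lambda>n. grid_max n z) \<longlonglongrightarrow> running_sup X (snd z) (fst z)"
    and "(\<lambda>n. grid_min n z) \<longlonglongrightarrow> running_inf X (snd z) (fst z)"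
  unfolding grid_value_def grid_max_def grid_min_def
  using assms grid_limits[of z] unfolding sets_eq_imp_space_eq[OF sets_killed_space] by auto

lemma grid_walk:
  assumes "\<omega> \<in> space M"
  shows "(\<lambda>k. X (real k / real (Suc n)) \<omega>) = walk (incr (real (Suc n)) \<omega>)"
  using walk_incr[OF _ assms, of "real (Suc n)"] by auto

text \<open>For fixed time the grid functionals are functionals of the embedded random walk; the index is one
  more than the rounded-down time because grid times are rounded up.\<close>

lemma integral_grid:
  fixes g h :: "real \<Rightarrow> real"
  assumes p: "0 < p"
    and g: "g \<in> borel_measurable borel" "\<And>x. \<bar>g x\<bar> \<le> 1"
    and h: "h \<in> borel_measurable borel" "\<And>x. \<bar>h x\<bar> \<le> 1"
  defines "\<nu> \<equiv> \<lambda>n. distr M borel (X (1 / real (Suc n)))"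
  shows "(LINT z|killed_space M p. g (grid_max n z) * h (grid_value n z - grid_max n z)) =
    (LINT t|exp_law p. random_walk.max_part (\<nu> n) g h (nat \<lfloor>t * real (Suc n)\<rfloor> + 1))"
proof -
  interpret KK: pair_prob_space M "exp_law p" by (rule pair_prob_space_killed[OF p])
  interpret W: random_walk "\<nu> n" unfolding \<nu>_def by (rule random_walk_step) simp
  let ?f = "\<lambda>z. g (grid_max n z) * h (grid_value n z - grid_max n z)"
  have m: "?f \<in> borel_measurable (killed_space M p)"
    by (intro borel_measurable_times measurable_compose[OF _ g(1)] measurable_compose[OF _ h(1)]
        borel_measurable_diff measurable_grid_functions)
  have b: "\<bar>?f z\<bar> \<le> 1" for z using g(2) h(2) by (auto simp: abs_mult intro!: mult_le_one)
  have i: "integrable (killed_space M p) ?f"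
    by (rule KK.P.integrable_const_bound[where B=1, OF _ m]) (use b in \<open>auto intro!: AE_I2\<close>)
  then have i': "integrable (killed_space M p) (case_prod (\<lambda>\<omega> t. ?f (\<omega>, t)))" by (simp add: split_beta')
  have "(LINT z|killed_space M p. ?f z) = (LINT t|exp_law p. (LINT \<omega>|M. ?f (\<omega>, t)))"
    using KK.integral_snd[OF i'] by (simp add: split_beta')
  also have "\<dots> = (LINT t|exp_law p. W.max_part g h (nat \<lfloor>t * real (Suc n)\<rfloor> + 1))"
  proof (intro Bochner_Integration.integral_cong refl)
    fix t
    let ?m = "nat \<lfloor>t * real (Suc n)\<rfloor> + 1"
    have "(LINT \<omega>|M. ?f (\<omega>, t)) = (LINT \<omega>|M. (\<lambda>\<xi>. g (walk_max (walk \<xi>) ?m) *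
        h (walk \<xi> ?m - walk_max (walk \<xi>) ?m)) (incr (real (Suc n)) \<omega>))"
      by (intro Bochner_Integration.integral_cong refl)
        (simp add: grid_max_def grid_value_def grid_walk grid_point_def grid_index_def
          walk_incr[symmetric] del: of_nat_Suc)
    also have "\<dots> = W.max_part g h ?m"
      unfolding W.max_part_def unfolding \<nu>_def
      by (rule integral_incr)
        (use g(1) h(1) in \<open>auto intro!: borel_measurable_times borel_measurable_diff
            measurable_compose[OF _ g(1)] measurable_compose[OF _ h(1)] measurable_walk measurable_walk_max\<close>)
    finally show "(LINT \<omega>|M. ?f (\<omega>, t)) = W.max_part g h ?m" .
  qed
  finally show ?thesis .
qed

lemma integral_grid_reversal:
  fixes h :: "real \<Rightarrow> real"
  assumes p: "0 < p"
    and h: "h \<in> borel_measurable borel" "\<And>x. \<bar>h x\<bar> \<le> 1"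
  shows "(LINT z|killed_space M p. h (grid_value n z - grid_max n z)) =
    (LINT z|killed_space M p. h (grid_min n z))"
proof -
  interpret KK: pair_prob_space M "exp_law p" by (rule pair_prob_space_killed[OF p])
  interpret W: random_walk "distr M borel (X (1 / real (Suc n)))" by (rule random_walk_step) simp
  have m: "(\<lambda>z. h (grid_value n z - grid_max n z)) \<in> borel_measurable (killed_space M p)"
    "(\<lambda>z. h (grid_min n z)) \<in> borel_measurable (killed_space M p)"
    by (intro measurable_compose[OF _ h(1)] borel_measurable_diff measurable_grid_functions)+
  have i: "integrable (killed_space M p) (case_prod (\<lambda>\<omega> t. h (grid_value n (\<omega>, t) - grid_max n (\<omega>, t))))"
    "integrable (killed_space M p) (case_prod (\<lambda>\<omega> t. h (grid_min n (\<omega>, t))))"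
    using KK.P.integrable_const_bound[where B=1, OF _ m(1)] KK.P.integrable_const_bound[where B=1, OF _ m(2)] h(2)
    by (auto simp: split_beta')
  have "(LINT \<omega>|M. h (grid_value n (\<omega>, t) - grid_max n (\<omega>, t))) = (LINT \<omega>|M. h (grid_min n (\<omega>, t)))" for t
  proof -
    let ?m = "nat \<lfloor>t * real (Suc n)\<rfloor> + 1"
    have "(LINT \<omega>|M. h (grid_value n (\<omega>, t) - grid_max n (\<omega>, t))) =
      (LINT \<omega>|M. (\<lambda>\<xi>. h (walk \<xi> ?m - walk_max (walk \<xi>) ?m)) (incr (real (Suc n)) \<omega>))"
      by (intro Bochner_Integration.integral_cong refl)
        (simp add: grid_max_def grid_value_def grid_walk grid_point_def grid_index_def
          walk_incr[symmetric] del: of_nat_Suc)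
    also have "\<dots> = (LINT \<xi>|W.S. h (walk \<xi> ?m - walk_max (walk \<xi>) ?m))"
      by (rule integral_incr)
        (auto intro!: borel_measurable_diff measurable_compose[OF _ h(1)] measurable_walk measurable_walk_max)
    also have "\<dots> = (LINT \<xi>|W.S. h (- walk_max (\<lambda>k. - walk \<xi> k) ?m))"
      by (rule W.walk_reversal[OF h(1)])
    also have "\<dots> = (LINT \<omega>|M. (\<lambda>\<xi>. h (- walk_max (\<lambda>k. - walk \<xi> k) ?m)) (incr (real (Suc n)) \<omega>))"
    proof (rule integral_incr[symmetric])
      show "(\<lambda>\<xi>. h (- walk_max (\<lambda>k. - walk \<xi> k) ?m)) \<in> borel_measurable step_space"
        unfolding walk_max_def
        by (intro measurable_compose[OF _ h(1)] borel_measurable_uminus borel_measurable_Max measurable_walk) auto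
    qed simp
    also have "\<dots> = (LINT \<omega>|M. h (grid_min n (\<omega>, t)))"
      by (intro Bochner_Integration.integral_cong refl)
        (simp add: grid_min_def grid_walk[symmetric] grid_index_def fun_cong[OF grid_walk, symmetric] del: of_nat_Suc)
    finally show ?thesis .
  qed
  then show ?thesis
    using KK.integral_snd[OF i(1)] KK.integral_snd[OF i(2)] by (simp add: split_beta')
qed

lemma grid_integral_tendsto:
  fixes g h :: "real \<Rightarrow> real"
  assumes p: "0 < p"
    and g: "continuous_on UNIV g" "\<And>x. \<bar>g x\<bar> \<le> 1"
    and h: "continuous_on UNIV h" "\<And>x. \<bar>h x\<bar> \<le> 1"
  shows "(\<lambda>n. LINT z|killed_space M p. g (grid_max n z) * h (grid_value n z - grid_max n z)) \<longlonglongrightarrow>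
    (LINT z|killed_space M p. g (running_sup X (snd z) (fst z)) *
      h (X (snd z) (fst z) - running_sup X (snd z) (fst z)))"
    and "(\<lambda>n. LINT z|killed_space M p. h (grid_min n z)) \<longlonglongrightarrow>
    (LINT z|killed_space M p. h (running_inf X (snd z) (fst z)))"
proof -
  interpret P: prob_space "killed_space M p" by (rule prob_space_killed[OF p])
  have mg: "g \<in> borel_measurable borel" and mh: "h \<in> borel_measurable borel"
    using g h by (auto intro: borel_measurable_continuous_onI)
  have cg: "isCont g x" and ch: "isCont h x" for x
    using g(1) h(1) by (auto simp: continuous_on_eq_continuous_at)
  show "(\<lambda>n. LINT z|killed_space M p. g (grid_max n z) * h (grid_value n z - grid_max n z)) \<longlonglongrightarrow>
    (LINT z|killed_space M p. g (running_sup X (snd z) (fst z)) *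
      h (X (snd z) (fst z) - running_sup X (snd z) (fst z)))"
  proof (rule integral_dominated_convergence[where w="\<lambda>_. 1"])
    show "AE z in killed_space M p. (\<lambda>n. g (grid_max n z) * h (grid_value n z - grid_max n z)) \<longlonglongrightarrow>
      g (running_sup X (snd z) (fst z)) * h (X (snd z) (fst z) - running_sup X (snd z) (fst z))"
      by (intro AE_I2 tendsto_mult isCont_tendsto_compose[OF cg] isCont_tendsto_compose[OF ch]
          tendsto_diff grid_function_limits)
    show "AE z in killed_space M p. norm (g (grid_max n z) * h (grid_value n z - grid_max n z)) \<le> 1" for n
      using g(2) h(2) by (intro AE_I2) (auto simp: abs_mult intro!: mult_le_one)
  qed (auto intro!: borel_measurable_times measurable_compose[OF _ mg] measurable_compose[OF _ mh]
        borel_measurable_diff measurable_grid_functions measurable_killed_functions)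
  show "(\<lambda>n. LINT z|killed_space M p. h (grid_min n z)) \<longlonglongrightarrow>
    (LINT z|killed_space M p. h (running_inf X (snd z) (fst z)))"
  proof (rule integral_dominated_convergence[where w="\<lambda>_. 1"])
    show "AE z in killed_space M p. (\<lambda>n. h (grid_min n z)) \<longlonglongrightarrow> h (running_inf X (snd z) (fst z))"
      by (intro AE_I2 isCont_tendsto_compose[OF ch] grid_function_limits)
    show "AE z in killed_space M p. norm (h (grid_min n z)) \<le> 1" for n
      using h(2) by (intro AE_I2) auto
  qed (auto intro!: measurable_compose[OF _ mh] measurable_grid_functions measurable_killed_functions)
qed

text \<open>The factorization at a geometric time passes to the limit of fine grids.  The geometric mean starts
  at index \<open>0\<close>, the grid integral at index \<open>1\<close>; the extra term has weight \<open>1 - \<rho> \<longlongrightarrow> 0\<close>.  Reversal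
  identifies the second factor with an expectation of the infimum.\<close>

lemma sup_and_excursion_factorize:
  fixes g h :: "real \<Rightarrow> real"
  assumes p: "0 < p"
    and g: "continuous_on UNIV g" "\<And>x. \<bar>g x\<bar> \<le> 1"
    and h: "continuous_on UNIV h" "\<And>x. \<bar>h x\<bar> \<le> 1"
  shows "(LINT z|killed_space M p. g (running_sup X (snd z) (fst z)) *
      h (X (snd z) (fst z) - running_sup X (snd z) (fst z))) =
    (LINT z|killed_space M p. g (running_sup X (snd z) (fst z))) *
    (LINT z|killed_space M p. h (running_inf X (snd z) (fst z)))"
proof -
  define \<rho> where "\<rho> n = exp (- p / real (Suc n))" for n
  define \<nu> where "\<nu> n = distr M borel (X (1 / real (Suc n)))" for n
  define \<Phi> where "\<Phi> n g h = (LINT z|killed_space M p. g (grid_max n z) * h (grid_value n z - grid_max n z))"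
    for n and g h :: "real \<Rightarrow> real"
  define L where "L g h = (LINT z|killed_space M p. g (running_sup X (snd z) (fst z)) *
      h (X (snd z) (fst z) - running_sup X (snd z) (fst z)))" for g h :: "real \<Rightarrow> real"
  have \<rho>: "0 \<le> \<rho> n" "\<rho> n < 1" for n using p by (auto simp: \<rho>_def)
  have \<rho>_lim: "\<rho> \<longlonglongrightarrow> 1"
  proof -
    have "(\<lambda>n. - p * (1 / real (Suc n))) \<longlonglongrightarrow> - p * 0"
      by (intro tendsto_intros LIMSEQ_Suc lim_inverse_n')
    from tendsto_exp[OF this] show ?thesis by (simp add: \<rho>_def[abs_def])
  qed
  have W: "random_walk (\<nu> n)" for n unfolding \<nu>_def by (rule random_walk_step) simp
  have geo: "random_walk.geometric_mean (\<nu> n) (\<rho> n) g h = \<rho> n * \<Phi> n g h + (1 - \<rho> n) * (g 0 * h 0)"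
    if g: "continuous_on UNIV g" "\<And>x. \<bar>g x\<bar> \<le> 1" and h: "continuous_on UNIV h" "\<And>x. \<bar>h x\<bar> \<le> 1"
    for n and g h :: "real \<Rightarrow> real"
  proof -
    interpret W: random_walk "\<nu> n" by (rule W)
    have mg: "g \<in> borel_measurable borel" and mh: "h \<in> borel_measurable borel"
      using g h by (auto intro: borel_measurable_continuous_onI)
    define c where "c = W.max_part g h"
    have c: "\<bar>c k\<bar> \<le> 1" for k unfolding c_def using g h by (intro W.max_part_bound)
    have "\<Phi> n g h = (LINT t|exp_law p. c (nat \<lfloor>t * real (Suc n)\<rfloor> + 1))"
      unfolding \<Phi>_def c_def \<nu>_def by (rule integral_grid[OF p mg g(2) mh h(2)])
    also have "\<dots> = (1 - \<rho> n) * (\<Sum>k. \<rho> n ^ k * c (k + 1))"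
      unfolding \<rho>_def by (rule integral_grid_exp_law[OF p, of "real (Suc n)" "\<lambda>k. c (k + 1)"]) (simp_all add: c)
    finally have 1: "\<Phi> n g h = (1 - \<rho> n) * (\<Sum>k. \<rho> n ^ k * c (k + 1))" .
    have summ: "summable (\<lambda>k. \<rho> n ^ k * c k)" "summable (\<lambda>k. \<rho> n ^ k * c (k + 1))"
      by (rule summable_comparison_test'[of "\<lambda>k. \<rho> n ^ k" 0];
          use \<rho>[of n] c in \<open>simp add: summable_geometric abs_mult mult_left_le\<close>)+
    have c0: "c 0 = g 0 * h 0"
      by (simp add: c_def W.max_part_def walk_max_def walk_0 W.P.prob_space)
    have "(\<Sum>k. \<rho> n ^ k * c k) = (\<Sum>k. \<rho> n ^ Suc k * c (Suc k)) + \<rho> n ^ 0 * c 0"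
      using suminf_split_head[OF summ(1)] by simp
    also have "(\<Sum>k. \<rho> n ^ Suc k * c (Suc k)) = \<rho> n * (\<Sum>k. \<rho> n ^ k * c (k + 1))"
      using suminf_mult[OF summ(2), of "\<rho> n"] by (simp add: mult.assoc)
    finally have "W.geometric_mean (\<rho> n) g h =
      (1 - \<rho> n) * (\<rho> n * (\<Sum>k. \<rho> n ^ k * c (k + 1)) + g 0 * h 0)"
      by (simp add: W.geometric_mean_def c_def[symmetric] c0)
    then show ?thesis unfolding 1 by (simp add: algebra_simps)
  qed
  have geo_lim: "(\<lambda>n. random_walk.geometric_mean (\<nu> n) (\<rho> n) g h) \<longlonglongrightarrow> L g h"
    if g: "continuous_on UNIV g" "\<And>x. \<bar>g x\<bar> \<le> 1" and h: "continuous_on UNIV h" "\<And>x. \<bar>h x\<bar> \<le> 1"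
    for g h :: "real \<Rightarrow> real"
  proof -
    have "(\<lambda>n. \<rho> n * \<Phi> n g h + (1 - \<rho> n) * (g 0 * h 0)) \<longlonglongrightarrow> 1 * L g h + (1 - 1) * (g 0 * h 0)"
      unfolding \<Phi>_def L_def
      by (intro tendsto_intros \<rho>_lim grid_integral_tendsto[OF p that])
    then show ?thesis by (simp add: geo[OF that])
  qed
  have one: "continuous_on UNIV (\<lambda>_::real. 1::real)" "\<And>x::real. \<bar>1::real\<bar> \<le> 1" by auto
  have "(\<lambda>n. random_walk.geometric_mean (\<nu> n) (\<rho> n) g h) \<longlonglongrightarrow> L g (\<lambda>_. 1) * L (\<lambda>_. 1) h"
  proof -
    have "random_walk.geometric_mean (\<nu> n) (\<rho> n) g h = random_walk.geometric_mean (\<nu> n) (\<rho> n) g (\<lambda>_. 1) *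
      random_walk.geometric_mean (\<nu> n) (\<rho> n) (\<lambda>_. 1) h" for n
      using g h \<rho> by (intro random_walk.geometric_mean_factorizes[OF W] borel_measurable_continuous_onI)
    then show ?thesis
      using tendsto_mult[OF geo_lim[OF g one] geo_lim[OF one h]] by simp
  qed
  from LIMSEQ_unique[OF geo_lim[OF g h] this]
  have "L g h = L g (\<lambda>_. 1) * L (\<lambda>_. 1) h" .
  moreover have "L (\<lambda>_. 1) h = (LINT z|killed_space M p. h (running_inf X (snd z) (fst z)))"
  proof (rule LIMSEQ_unique)
    show "(\<lambda>n. LINT z|killed_space M p. h (grid_min n z)) \<longlonglongrightarrow>
      (LINT z|killed_space M p. h (running_inf X (snd z) (fst z)))"
      by (rule grid_integral_tendsto(2)[OF p one h])
    show "(\<lambda>n. LINT z|killed_space M p. h (grid_min n z)) \<longlonglongrightarrow> L (\<lambda>_. 1) h"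
      using grid_integral_tendsto(1)[OF p one h]
        integral_grid_reversal[of p h, OF p borel_measurable_continuous_onI[OF h(1)] h(2)]
      by (simp add: L_def)
  qed
  ultimately show ?thesis by (simp add: L_def)
qed

definition sup_law :: "real \<Rightarrow> real measure" where
  "sup_law p = distr (killed_space M p) borel (\<lambda>z. running_sup X (snd z) (fst z))"

definition inf_law :: "real \<Rightarrow> real measure" where
  "inf_law p = distr (killed_space M p) borel (\<lambda>z. running_inf X (snd z) (fst z))"

lemma sets_sup_inf_law [measurable_cong, simp]:
  "sets (sup_law p) = sets borel" "sets (inf_law p) = sets borel"
  by (simp_all add: sup_law_def inf_law_def)

lemma prob_space_sup_inf_law:
  "0 < p \<Longrightarrow> prob_space (sup_law p)" "0 < p \<Longrightarrow> prob_space (inf_law p)"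
  unfolding sup_law_def inf_law_def
  by (intro prob_space.prob_space_distr prob_space_killed measurable_killed_functions; assumption)+

text \<open>Products of bounded continuous functions determine a measure on the plane, and on these the joint law
  of supremum and drawdown agrees with the product law.\<close>

theorem wiener_hopf:
  assumes p: "0 < p"
  shows "distr (killed_space M p) borel
      (\<lambda>z. (running_sup X (snd z) (fst z), X (snd z) (fst z) - running_sup X (snd z) (fst z))) =
    sup_law p \<Otimes>\<^sub>M inf_law p"
proof (rule real_plane_measure_eqI)
  interpret S: prob_space "sup_law p" by (rule prob_space_sup_inf_law[OF p])
  interpret I: prob_space "inf_law p" by (rule prob_space_sup_inf_law[OF p])
  interpret SI: pair_prob_space "sup_law p" "inf_law p" ..
  have m: "(\<lambda>z. (running_sup X (snd z) (fst z), X (snd z) (fst z) - running_sup X (snd z) (fst z)))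
    \<in> borel_measurable (killed_space M p)"
    by (intro borel_measurable_Pair borel_measurable_diff measurable_killed_functions)
  show "prob_space (distr (killed_space M p) borel
      (\<lambda>z. (running_sup X (snd z) (fst z), X (snd z) (fst z) - running_sup X (snd z) (fst z))))"
    by (rule prob_space.prob_space_distr[OF prob_space_killed[OF p] m])
  show "prob_space (sup_law p \<Otimes>\<^sub>M inf_law p)" by (rule SI.P.prob_space_axioms)
  show "sets (sup_law p \<Otimes>\<^sub>M inf_law p) = sets borel"
    by (simp add: borel_prod[symmetric] cong: sets_pair_measure_cong)
  fix g h :: "real \<Rightarrow> real"
  assume g: "continuous_on UNIV g" "\<And>x. \<bar>g x\<bar> \<le> 1" and h: "continuous_on UNIV h" "\<And>x. \<bar>h x\<bar> \<le> 1"
  have mg [measurable]: "g \<in> borel_measurable borel" and mh [measurable]: "h \<in> borel_measurable borel"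
    using g h by (auto intro: borel_measurable_continuous_onI)
  have "(LINT z|distr (killed_space M p) borel
      (\<lambda>z. (running_sup X (snd z) (fst z), X (snd z) (fst z) - running_sup X (snd z) (fst z))).
        g (fst z) * h (snd z)) =
    (LINT z|killed_space M p. g (running_sup X (snd z) (fst z)) *
      h (X (snd z) (fst z) - running_sup X (snd z) (fst z)))"
  proof (subst integral_distr[OF m])
    show "(\<lambda>z. g (fst z) * h (snd z)) \<in> borel_measurable borel"
      by (intro borel_measurable_times measurable_compose[OF _ mg] measurable_compose[OF _ mh]
          borel_measurable_continuous_onI continuous_intros)
  qed simp
  also have "\<dots> = (LINT z|killed_space M p. g (running_sup X (snd z) (fst z))) *
    (LINT z|killed_space M p. h (running_inf X (snd z) (fst z)))"
    by (rule sup_and_excursion_factorize[OF p g h])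
  also have "\<dots> = (LINT s|sup_law p. g s) * (LINT i|inf_law p. h i)"
    unfolding sup_law_def inf_law_def
    by (subst (1 2) integral_distr) (auto intro: measurable_killed_functions)
  also have "\<dots> = (LINT s|sup_law p. (LINT i|inf_law p. g s * h i))" by simp
  also have "\<dots> = (LINT z|(sup_law p \<Otimes>\<^sub>M inf_law p). (case z of (s, i) \<Rightarrow> g s * h i))"
  proof (rule SI.integral_fst)
    show "integrable (sup_law p \<Otimes>\<^sub>M inf_law p) (\<lambda>(s, i). g s * h i)"
      by (rule SI.P.integrable_const_bound[where B=1], rule AE_I2)
        (use g(2) h(2) in \<open>auto simp: abs_mult split_beta intro!: mult_le_one\<close>)
  qed
  finally show "(LINT z|distr (killed_space M p) borel
      (\<lambda>z. (running_sup X (snd z) (fst z), X (snd z) (fst z) - running_sup X (snd z) (fst z))).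
        g (fst z) * h (snd z)) = (LINT z|(sup_law p \<Otimes>\<^sub>M inf_law p). g (fst z) * h (snd z))"
    by (simp add: split_beta')
qed simp

end

section \<open>Exponential moments\<close>

text \<open>Subtracting the linear function through \<open>\<phi> 1\<close> leaves an additive \<open>\<psi>\<close> that vanishes at the integers.
  So \<open>n \<psi>(t) = \<psi>(n t)\<close> depends only on the fractional part of \<open>n t\<close> and is bounded below uniformly
  in \<open>n\<close>; this forces \<open>\<psi> \<ge> 0\<close>, and \<open>\<psi>(t) + \<psi>(N - t) = 0\<close> gives the reverse inequality.\<close>

lemma additive_bounded_below_linear:
  fixes \<phi> :: "real \<Rightarrow> real"
  assumes add: "\<And>s t. 0 \<le> s \<Longrightarrow> 0 \<le> t \<Longrightarrow> \<phi> (s + t) = \<phi> s + \<phi> t"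
    and \<delta>: "0 < \<delta>" and bnd: "\<And>t. 0 \<le> t \<Longrightarrow> t \<le> \<delta> \<Longrightarrow> - L \<le> \<phi> t"
    and t: "0 \<le> t"
  shows "\<phi> t = t * \<phi> 1"
proof -
  define \<psi> where "\<psi> t = \<phi> t - t * \<phi> 1" for t
  have \<psi>_add: "\<psi> (s + t) = \<psi> s + \<psi> t" if "0 \<le> s" "0 \<le> t" for s t
    using add[OF that] by (simp add: \<psi>_def algebra_simps)
  have \<psi>_mult: "\<psi> (real n * t) = real n * \<psi> t" if "0 \<le> t" for n t
  proof (induction n)
    case 0
    then show ?case using \<psi>_add[of 0 0] by simp
  next
    case (Suc n)
    then show ?case using \<psi>_add[of "real n * t" t] that by (simp add: algebra_simps)
  qed
  have \<psi>_nat: "\<psi> (real n) = 0" for n using \<psi>_mult[of 1 n] by (simp add: \<psi>_def)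
  obtain N :: nat where N: "0 < N" "1 / real N \<le> \<delta>"
  proof -
    obtain n where "1 / \<delta> < real n" using reals_Archimedean2 by blast
    moreover have "0 < 1 / \<delta>" using \<delta> by simp
    ultimately have n: "0 < real n" "1 < real n * \<delta>" using \<delta> by (linarith, simp add: pos_divide_less_eq)
    then have "1 / real n \<le> \<delta>" by (simp add: pos_divide_le_eq mult.commute)
    with n(1) show ?thesis using that[of n] by simp
  qed
  define B where "B = real N * (L + \<bar>\<phi> 1\<bar>)"
  have low: "- B \<le> \<psi> t" if t: "0 \<le> t" "t \<le> 1" for t
  proof -
    have 0: "0 \<le> t / real N" "t / real N \<le> 1 / real N" "t / real N \<le> 1"
      using t N(1) by (auto simp: field_simps)
    then have "- L \<le> \<phi> (t / real N)" using bnd[of "t / real N"] N(2) by linarith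
    moreover have "t / real N * \<phi> 1 \<le> 1 * \<bar>\<phi> 1\<bar>"
      by (rule order_trans[OF mult_left_mono[OF abs_ge_self 0(1)] mult_right_mono[OF 0(3) abs_ge_zero]])
    ultimately have "- (L + \<bar>\<phi> 1\<bar>) \<le> \<psi> (t / real N)" by (simp add: \<psi>_def)
    then have "real N * (- (L + \<bar>\<phi> 1\<bar>)) \<le> real N * \<psi> (t / real N)" by (intro mult_left_mono) auto
    also have "\<dots> = \<psi> t" using \<psi>_mult[of "t / real N" N] 0(1) N(1) by simp
    finally show ?thesis by (simp only: B_def mult_minus_right)
  qed
  have nonneg: "0 \<le> \<psi> t" if t: "0 \<le> t" for t
  proof (rule ccontr)
    assume neg: "\<not> 0 \<le> \<psi> t"
    then obtain n where n: "B < real n * (- \<psi> t)" using reals_Archimedean3[of "- \<psi> t"] by auto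
    define k where "k = nat \<lfloor>real n * t\<rfloor>"
    have k: "real k \<le> real n * t" "real n * t - real k \<le> 1"
      using t unfolding k_def by (auto, linarith)
    have "real n * \<psi> t = \<psi> (real k + (real n * t - real k))" using \<psi>_mult[OF t] by simp
    also have "\<dots> = \<psi> (real n * t - real k)" using \<psi>_add[of "real k" "real n * t - real k"] k \<psi>_nat by simp
    also have "\<dots> \<ge> - B" using k by (intro low) auto
    finally show False using n by simp
  qed
  obtain n where n: "t \<le> real n" using real_arch_simple by blast
  have "\<psi> t + \<psi> (real n - t) = 0" using \<psi>_add[of t "real n - t"] t n \<psi>_nat by simp
  with nonneg[OF t] nonneg[of "real n - t"] n have "\<psi> t = 0" by simp
  then show ?thesis by (simp add: \<psi>_def)
qed

text \<open>At \<open>t = 1\<close> the rates can differ only by \<open>2 \<pi> n \<i>\<close>; the time \<open>1 / (2 \<bar>n\<bar>)\<close> then excludes \<open>n \<noteq> 0\<close>.  This is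
  what makes the description in \<^const>\<open>char_exponent\<close> definite.\<close>

lemma exp_rate_unique:
  fixes z z' :: complex
  assumes eq: "\<And>t::real. 0 \<le> t \<Longrightarrow> exp (- (complex_of_real t * z)) = exp (- (complex_of_real t * z'))"
  shows "z = z'"
proof -
  define d where "d = z' - z"
  have one: "exp (complex_of_real t * d) = 1" if "0 \<le> t" for t
  proof -
    have "complex_of_real t * d = complex_of_real t * z' + - (complex_of_real t * z)"
      by (simp add: d_def algebra_simps)
    then have "exp (complex_of_real t * d) = exp (complex_of_real t * z') * exp (- (complex_of_real t * z))"
      by (simp only: exp_add)
    also have "\<dots> = 1" by (simp add: eq[OF that] exp_add[symmetric])
    finally show ?thesis .
  qed
  from one[of 1] obtain n :: int where n: "Re d = 0" "Im d = of_int (2 * n) * pi"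
    by (auto simp: exp_eq_1)
  have "n = 0"
  proof (rule ccontr)
    assume "n \<noteq> 0"
    then obtain m :: int where "Im (complex_of_real (1 / (2 * \<bar>real_of_int n\<bar>)) * d) = of_int (2 * m) * pi"
      using one[of "1 / (2 * \<bar>real_of_int n\<bar>)"] by (auto simp: exp_eq_1)
    then have "real_of_int n = real_of_int (m * (\<bar>n\<bar> * 2))"
      using n \<open>n \<noteq> 0\<close> by (simp add: field_simps)
    then have "n = m * (\<bar>n\<bar> * 2)" by (simp only: of_int_eq_iff)
    then have "\<bar>n\<bar> = \<bar>m * (\<bar>n\<bar> * 2)\<bar>" by simp
    then have "\<bar>n\<bar> * 1 = \<bar>n\<bar> * (\<bar>m\<bar> * 2)" by (simp add: abs_mult)
    then have "\<bar>m\<bar> * 2 = 1" using \<open>n \<noteq> 0\<close> by simp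
    then show False by presburger
  qed
  with n have "d = 0" by (simp add: complex_eq_iff)
  then show ?thesis by (simp add: d_def)
qed

context levy_process
begin

definition exp_moment :: "real \<Rightarrow> real \<Rightarrow> ennreal" where
  "exp_moment \<gamma> t = (\<integral>\<^sup>+ \<omega>. ennreal (exp (- \<gamma> * X t \<omega>)) \<partial>M)"

lemma measurable_exp_X: "0 \<le> t \<Longrightarrow> (\<lambda>\<omega>. ennreal (exp (- \<gamma> * X t \<omega>))) \<in> borel_measurable M"
  by measurable

lemma indep_past_increment:
  assumes "0 \<le> s" "0 \<le> t"
  shows "indep_var borel (X s) borel (\<lambda>\<omega>. X (s + t) \<omega> - X s \<omega>)"
  unfolding indep_var_eq
proof (intro conjI)
  show "random_variable borel (X s)" using assms by (intro measurable_X)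
  show "random_variable borel (\<lambda>\<omega>. X (s + t) \<omega> - X s \<omega>)"
    using assms by (intro borel_measurable_diff measurable_X) auto
  have sp: "space (F s) = space M" using subalg[OF assms(1)] by (simp add: subalgebra_def)
  have ind: "indep_set (sets (F s)) (sets (vimage_algebra (space M) (\<lambda>\<omega>. X (s + t) \<omega> - X s \<omega>) borel))"
    using assms by (intro indep_increments) auto
  have 1: "sigma_sets (space M) {X s -` A \<inter> space M |A. A \<in> sets borel} \<subseteq> sets (F s)"
    unfolding sp[symmetric]
    by (rule sets.sigma_sets_subset) (auto intro: measurable_sets[OF adapted[OF assms(1)]])
  have 2: "sigma_sets (space M) {(\<lambda>\<omega>. X (s + t) \<omega> - X s \<omega>) -` A \<inter> space M |A. A \<in> sets borel} =
    sets (vimage_algebra (space M) (\<lambda>\<omega>. X (s + t) \<omega> - X s \<omega>) borel)"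
    by (simp add: sets_vimage_algebra)
  show "indep_set (sigma_sets (space M) {X s -` A \<inter> space M |A. A \<in> sets borel})
     (sigma_sets (space M) {(\<lambda>\<omega>. X (s + t) \<omega> - X s \<omega>) -` A \<inter> space M |A. A \<in> sets borel})"
    unfolding 2 indep_sets2_eq using ind 1 unfolding indep_sets2_eq by blast
qed

lemma exp_moment_add:
  assumes "0 \<le> s" "0 \<le> t"
  shows "exp_moment \<gamma> (s + t) = exp_moment \<gamma> s * exp_moment \<gamma> t"
proof -
  let ?D = "\<lambda>\<omega>. X (s + t) \<omega> - X s \<omega>"
  let ?e = "\<lambda>x::real. ennreal (exp (- \<gamma> * x))"
  have ms: "X s \<in> borel_measurable M" and mt: "X t \<in> borel_measurable M" and mD: "?D \<in> borel_measurable M"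
    using assms by (auto intro!: borel_measurable_diff measurable_X)
  interpret T: prob_space "distr M borel ?D" by (rule prob_space_distr[OF mD])
  have pair: "distr M borel (X s) \<Otimes>\<^sub>M distr M borel ?D = distr M (borel \<Otimes>\<^sub>M borel) (\<lambda>\<omega>. (X s \<omega>, ?D \<omega>))"
    using indep_past_increment[OF assms] unfolding indep_var_distribution_eq by simp
  have "exp_moment \<gamma> (s + t) = (\<integral>\<^sup>+ \<omega>. ?e (X s \<omega>) * ?e (?D \<omega>) \<partial>M)"
    unfolding exp_moment_def
    by (intro nn_integral_cong) (simp add: ennreal_mult[symmetric] exp_add[symmetric] algebra_simps)
  also have "\<dots> = (\<integral>\<^sup>+ z. ?e (fst z) * ?e (snd z) \<partial>distr M (borel \<Otimes>\<^sub>M borel) (\<lambda>\<omega>. (X s \<omega>, ?D \<omega>)))"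
    by (subst nn_integral_distr) (use ms mD in auto)
  also have "\<dots> = (\<integral>\<^sup>+ x. \<integral>\<^sup>+ y. ?e x * ?e y \<partial>distr M borel ?D \<partial>distr M borel (X s))"
    unfolding pair[symmetric] by (subst T.nn_integral_fst[symmetric]) auto
  also have "\<dots> = (\<integral>\<^sup>+ x. ?e x \<partial>distr M borel (X s)) * (\<integral>\<^sup>+ y. ?e y \<partial>distr M borel ?D)"
    by (simp add: nn_integral_cmult nn_integral_multc)
  also have "distr M borel ?D = distr M borel (X t)"
    using stationary_increments[of s "s + t"] assms by simp
  also have "(\<integral>\<^sup>+ x. ?e x \<partial>distr M borel (X s)) * (\<integral>\<^sup>+ y. ?e y \<partial>distr M borel (X t)) =
      exp_moment \<gamma> s * exp_moment \<gamma> t"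
    unfolding exp_moment_def using ms mt by (subst (1 2) nn_integral_distr) auto
  finally show ?thesis .
qed

lemma exp_moment_nonzero: "0 \<le> t \<Longrightarrow> exp_moment \<gamma> t \<noteq> 0"
proof
  assume t: "0 \<le> t" and "exp_moment \<gamma> t = 0"
  then have "AE \<omega> in M. ennreal (exp (- \<gamma> * X t \<omega>)) = 0"
    unfolding exp_moment_def using measurable_exp_X[OF t] by (subst (asm) nn_integral_0_iff_AE) auto
  then have "AE \<omega> in M. False" by eventually_elim simp
  then show False by simp
qed

lemma exp_moment_0: "exp_moment \<gamma> 0 = 1"
proof -
  have "exp_moment \<gamma> 0 = (\<integral>\<^sup>+ \<omega>. 1 \<partial>M)"
    unfolding exp_moment_def by (intro nn_integral_cong) (simp add: start)
  then show ?thesis by (simp add: emeasure_space_1)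
qed

text \<open>For \<open>t \<le> n\<close> the moment at \<open>n\<close> is the product of the moments at \<open>t\<close> and \<open>n - t\<close>, and neither factor
  vanishes.\<close>

lemma exp_moment_finite:
  assumes fin: "exp_moment \<gamma> 1 \<noteq> \<infinity>" and t: "0 \<le> t"
  shows "exp_moment \<gamma> t \<noteq> \<infinity>"
proof
  assume inf: "exp_moment \<gamma> t = \<infinity>"
  have n: "exp_moment \<gamma> (real n) \<noteq> \<infinity>" for n
  proof (induction n)
    case (Suc n)
    then show ?case using fin exp_moment_add[of "real n" 1 \<gamma>]
      by (simp add: ennreal_mult_eq_top_iff add.commute)
  qed (simp add: exp_moment_0)
  obtain n where "t \<le> real n" using real_arch_simple by blast
  then have "exp_moment \<gamma> (real n) = exp_moment \<gamma> t * exp_moment \<gamma> (real n - t)" "exp_moment \<gamma> (real n - t) \<noteq> 0"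
    using exp_moment_add[of t "real n - t" \<gamma>] exp_moment_nonzero[of "real n - t" \<gamma>] t by auto
  with inf n show False by (simp add: ennreal_top_mult)
qed

text \<open>Fatou along times tending to \<open>0\<close>, where the path tends to \<open>0\<close>.  This one-sided bound is the
  regularity that the functional equation needs.\<close>

lemma exp_moment_near_0: "\<exists>\<delta>>0. \<forall>t. 0 \<le> t \<longrightarrow> t \<le> \<delta> \<longrightarrow> ennreal (exp (- 1)) \<le> exp_moment \<gamma> t"
proof (rule ccontr)
  assume "\<not> ?thesis"
  then have "\<forall>n. \<exists>t. 0 \<le> t \<and> t \<le> 1 / real (Suc n) \<and> exp_moment \<gamma> t < ennreal (exp (- 1))"
    by (auto simp: not_le)
  then obtain t where t: "\<And>n. 0 \<le> t n" "\<And>n. t n \<le> 1 / real (Suc n)"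
    and small: "\<And>n. exp_moment \<gamma> (t n) < ennreal (exp (- 1))" by metis
  have t0: "t \<longlonglongrightarrow> 0"
    by (rule tendsto_sandwich[of "\<lambda>_. 0" _ _ "\<lambda>n. 1 / real (Suc n)"])
      (use t in \<open>auto intro!: always_eventually LIMSEQ_Suc lim_inverse_n' simp del: of_nat_Suc\<close>)
  have conv: "(\<lambda>n. ennreal (exp (- \<gamma> * X (t n) \<omega>))) \<longlonglongrightarrow> 1" if \<omega>: "\<omega> \<in> space M" for \<omega>
  proof -
    have "((\<lambda>s. X s \<omega>) \<longlongrightarrow> X 0 \<omega>) (at_right 0)"
      using paths_right_continuous[OF \<omega>, of 0] by (simp add: continuous_within)
    then have "((\<lambda>s. X s \<omega>) \<longlongrightarrow> X 0 \<omega>) (at 0 within {0..})"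
      by (simp add: at_within_Ici_at_right)
    then have "(\<lambda>n. X (t n) \<omega>) \<longlonglongrightarrow> X 0 \<omega>"
      using t0 t(1) continuous_within_tendsto_compose'[of 0 "{0..}" "\<lambda>s. X s \<omega>" t sequentially]
      by (simp add: continuous_within)
    then have "(\<lambda>n. ennreal (exp (- \<gamma> * X (t n) \<omega>))) \<longlonglongrightarrow> ennreal (exp (- \<gamma> * X 0 \<omega>))"
      by (intro tendsto_intros)
    then show ?thesis by (simp add: start[OF \<omega>])
  qed
  have "1 = (\<integral>\<^sup>+ \<omega>. 1 \<partial>M)" by (simp add: emeasure_space_1)
  also have "\<dots> = (\<integral>\<^sup>+ \<omega>. liminf (\<lambda>n. ennreal (exp (- \<gamma> * X (t n) \<omega>))) \<partial>M)"
    by (intro nn_integral_cong lim_imp_Liminf[symmetric] conv) auto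
  also have "\<dots> \<le> liminf (\<lambda>n. exp_moment \<gamma> (t n))"
    unfolding exp_moment_def by (intro nn_integral_liminf measurable_exp_X t)
  also have "\<dots> \<le> liminf (\<lambda>n::nat. ennreal (exp (- 1)))"
    using small by (intro Liminf_mono always_eventually) (auto intro: less_imp_le)
  also have "\<dots> = ennreal (exp (- 1))" by (intro lim_imp_Liminf) auto
  finally show False by (simp add: ennreal_1[symmetric] del: ennreal_1)
qed

text \<open>The logarithm of the moment is additive in time and bounded below near \<open>0\<close>, hence linear; its
  slope is real and satisfies the description of the characteristic exponent.\<close>

lemma exp_moment_exponential:
  assumes int: "integrable M (\<lambda>\<omega>. exp (- \<gamma> * X 1 \<omega>))" and t: "0 \<le> t"
  shows "exp_moment \<gamma> t = ennreal (exp (- t * Re (char_exponent M X (\<i> * complex_of_real \<gamma>))))"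
proof -
  have fin1: "exp_moment \<gamma> 1 \<noteq> \<infinity>"
    using int unfolding integrable_iff_bounded exp_moment_def by simp
  note fin = exp_moment_finite[OF fin1]
  define m where "m t = enn2real (exp_moment \<gamma> t)" for t
  have m: "exp_moment \<gamma> t = ennreal (m t)" "0 < m t" if "0 \<le> t" for t
    using fin[OF that] exp_moment_nonzero[OF that, of \<gamma>]
    by (auto simp: m_def enn2real_positive_iff less_top[symmetric] zero_less_iff_neq_zero)
  define \<phi> where "\<phi> t = ln (m t)" for t
  have \<phi>_add: "\<phi> (s + t) = \<phi> s + \<phi> t" if "0 \<le> s" "0 \<le> t" for s t
    using m[OF that(1)] m[OF that(2)] exp_moment_add[OF that, of \<gamma>]
    by (simp add: \<phi>_def m_def enn2real_mult ln_mult)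
  obtain \<delta> where \<delta>: "0 < \<delta>" "\<And>t. 0 \<le> t \<Longrightarrow> t \<le> \<delta> \<Longrightarrow> ennreal (exp (- 1)) \<le> exp_moment \<gamma> t"
    using exp_moment_near_0[of \<gamma>] by blast
  have \<phi>_low: "- 1 \<le> \<phi> t" if "0 \<le> t" "t \<le> \<delta>" for t
  proof -
    have "exp (- 1) \<le> m t" using \<delta>(2)[OF that] m[OF that(1)] by (simp add: ennreal_le_iff)
    then show ?thesis using m(2)[OF that(1)] by (simp add: \<phi>_def ln_ge_iff)
  qed
  have \<phi>_lin: "\<phi> t = t * \<phi> 1" if "0 \<le> t" for t
    by (rule additive_bounded_below_linear[OF \<phi>_add \<delta>(1) \<phi>_low that])
  define \<kappa> where "\<kappa> = - \<phi> 1"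
  have m_exp: "m t = exp (- (t * \<kappa>))" if "0 \<le> t" for t
    using m(2)[OF that] \<phi>_lin[OF that] by (metis \<kappa>_def \<phi>_def exp_ln minus_minus mult_minus_right)
  have char: "(LINT \<omega>|M. exp (\<i> * (\<i> * complex_of_real \<gamma>) * complex_of_real (X t \<omega>))) =
      exp (- (complex_of_real t * complex_of_real \<kappa>))" if t: "0 \<le> t" for t
  proof -
    have i: "integrable M (\<lambda>\<omega>. exp (- \<gamma> * X t \<omega>))"
      unfolding integrable_iff_bounded using fin[OF t] measurable_X[OF t]
      by (auto simp: exp_moment_def less_top[symmetric])
    have "(LINT \<omega>|M. exp (- \<gamma> * X t \<omega>)) = m t"
      unfolding m_def exp_moment_def using i by (subst integral_eq_nn_integral) auto
    then have re: "(LINT \<omega>|M. complex_of_real (exp (- \<gamma> * X t \<omega>))) = complex_of_real (m t)"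
      by (simp only: integral_complex_of_real)
    have "exp (\<i> * (\<i> * complex_of_real \<gamma>) * complex_of_real (X t \<omega>)) =
        complex_of_real (exp (- \<gamma> * X t \<omega>))" for \<omega>
      by (simp add: exp_of_real[symmetric] mult.assoc[symmetric])
    then show ?thesis by (simp only: re) (simp add: m_exp[OF t] exp_of_real[symmetric])
  qed
  have "char_exponent M X (\<i> * complex_of_real \<gamma>) = complex_of_real \<kappa>"
    unfolding char_exponent_def
  proof (rule the_equality)
    show "\<forall>t\<ge>0. (LINT \<omega>|M. exp (\<i> * (\<i> * complex_of_real \<gamma>) * complex_of_real (X t \<omega>))) =
      exp (- (complex_of_real t * complex_of_real \<kappa>))"
      using char by blast
    fix z assume z: "\<forall>t\<ge>0. (LINT \<omega>|M. exp (\<i> * (\<i> * complex_of_real \<gamma>) * complex_of_real (X t \<omega>))) =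
      exp (- (complex_of_real t * z))"
    show "z = complex_of_real \<kappa>"
    proof (rule exp_rate_unique)
      fix t :: real assume t: "0 \<le> t"
      show "exp (- (complex_of_real t * z)) = exp (- (complex_of_real t * complex_of_real \<kappa>))"
        by (rule trans[OF sym[OF z[rule_format, OF t]] char[OF t]])
    qed
  qed
  then show ?thesis using m(1)[OF t] m_exp[OF t] by simp
qed

lemma killed_exp_moment:
  assumes int: "integrable M (\<lambda>\<omega>. exp (- \<gamma> * X 1 \<omega>))" and p: "0 < p"
    and pos: "0 < p + Re (char_exponent M X (\<i> * complex_of_real \<gamma>))"
  shows "integrable (killed_space M p) (\<lambda>z. exp (- \<gamma> * X (snd z) (fst z)))"
proof -
  interpret KK: pair_prob_space M "exp_law p" by (rule pair_prob_space_killed[OF p])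
  define \<kappa> where "\<kappa> = Re (char_exponent M X (\<i> * complex_of_real \<gamma>))"
  have pk: "0 < p + \<kappa>" using pos by (simp add: \<kappa>_def)
  interpret E: prob_space "exp_law (p + \<kappa>)" by (rule prob_space_exp_law[OF pk])
  have m: "(\<lambda>z. exp (- \<gamma> * X (snd z) (fst z))) \<in> borel_measurable (killed_space M p)"
    using measurable_killed_functions(1)[of p] by measurable
  have mt: "(\<lambda>t. ennreal (exp (- t * \<kappa>))) \<in> borel_measurable time_space"
    by (intro measurable_restrict_space1) measurable
  have "(\<integral>\<^sup>+ z. ennreal (exp (- \<gamma> * X (snd z) (fst z))) \<partial>killed_space M p) =
    (\<integral>\<^sup>+ t. exp_moment \<gamma> t \<partial>exp_law p)"
    unfolding exp_moment_def using KK.nn_integral_snd[of "\<lambda>z. ennreal (exp (- \<gamma> * X (snd z) (fst z)))"] m by simp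
  also have "\<dots> = (\<integral>\<^sup>+ t. ennreal (exp (- t * \<kappa>)) \<partial>exp_law p)"
    unfolding \<kappa>_def by (intro nn_integral_cong exp_moment_exponential int) (simp add: space_exp_law)
  also have "\<dots> = (\<integral>\<^sup>+ t. ennreal (p * exp (- p * t)) * (ennreal (exp (- t * \<kappa>)) * indicator {0..} t) \<partial>lborel)"
    by (rule nn_integral_exp_law[OF mt])
  also have "\<dots> = (\<integral>\<^sup>+ t. ennreal (p / (p + \<kappa>)) * (ennreal ((p + \<kappa>) * exp (- (p + \<kappa>) * t)) * (1 * indicator {0..} t)) \<partial>lborel)"
  proof (intro nn_integral_cong)
    fix t :: real
    have "exp (- p * t) * exp (- t * \<kappa>) = exp (- (p + \<kappa>) * t)"
      by (simp add: exp_add[symmetric] algebra_simps)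
    then have "p * exp (- p * t) * exp (- t * \<kappa>) = p / (p + \<kappa>) * ((p + \<kappa>) * exp (- (p + \<kappa>) * t))"
      using pk by simp
    then have "ennreal (p * exp (- p * t)) * ennreal (exp (- t * \<kappa>)) =
        ennreal (p / (p + \<kappa>)) * ennreal ((p + \<kappa>) * exp (- (p + \<kappa>) * t))"
      using p pk by (simp only: ennreal_mult[symmetric] exp_ge_zero mult_nonneg_nonneg
          divide_nonneg_nonneg less_imp_le)
    then show "ennreal (p * exp (- p * t)) * (ennreal (exp (- t * \<kappa>)) * indicator {0..} t) =
        ennreal (p / (p + \<kappa>)) * (ennreal ((p + \<kappa>) * exp (- (p + \<kappa>) * t)) * (1 * indicator {0..} t))"
      by (simp only: mult.assoc[symmetric] mult_1)
  qed
  also have "\<dots> = ennreal (p / (p + \<kappa>)) * (\<integral>\<^sup>+ t. 1 \<partial>exp_law (p + \<kappa>))"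
    by (subst nn_integral_exp_law, simp, rule nn_integral_cmult) measurable
  also have "\<dots> < \<infinity>" by (simp add: E.emeasure_space_1 ennreal_mult_less_top)
  finally show ?thesis using m by (simp add: integrable_iff_bounded)
qed

lemma wiener_hopf_nn_integral:
  assumes p: "0 < p" and k: "k \<in> borel_measurable borel"
  shows "(\<integral>\<^sup>+ z. k (running_sup X (snd z) (fst z), X (snd z) (fst z) - running_sup X (snd z) (fst z)) \<partial>killed_space M p) =
    (\<integral>\<^sup>+ s. \<integral>\<^sup>+ i. k (s, i) \<partial>inf_law p \<partial>sup_law p)"
proof -
  interpret I: prob_space "inf_law p" by (rule prob_space_sup_inf_law[OF p])
  have m: "(\<lambda>z. (running_sup X (snd z) (fst z), X (snd z) (fst z) - running_sup X (snd z) (fst z)))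
    \<in> borel_measurable (killed_space M p)"
    by (intro borel_measurable_Pair borel_measurable_diff measurable_killed_functions)
  have s: "sets (sup_law p \<Otimes>\<^sub>M inf_law p) = sets borel"
    by (simp add: borel_prod[symmetric] cong: sets_pair_measure_cong)
  have k': "k \<in> borel_measurable (sup_law p \<Otimes>\<^sub>M inf_law p)"
    using k by (simp add: measurable_cong_sets[OF s refl])
  show ?thesis
    using nn_integral_distr[OF m, of k] k' unfolding wiener_hopf[OF p] I.nn_integral_fst[OF k', symmetric] by simp
qed

lemma wiener_hopf_integral:
  fixes k :: "real \<times> real \<Rightarrow> real"
  assumes p: "0 < p" and k: "k \<in> borel_measurable borel"
  shows "integrable (killed_space M p)
      (\<lambda>z. k (running_sup X (snd z) (fst z), X (snd z) (fst z) - running_sup X (snd z) (fst z))) \<longleftrightarrow>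
    integrable (sup_law p \<Otimes>\<^sub>M inf_law p) k"
    and "(LINT z|killed_space M p. k (running_sup X (snd z) (fst z), X (snd z) (fst z) - running_sup X (snd z) (fst z))) =
    (LINT z|(sup_law p \<Otimes>\<^sub>M inf_law p). k z)"
proof -
  have m: "(\<lambda>z. (running_sup X (snd z) (fst z), X (snd z) (fst z) - running_sup X (snd z) (fst z)))
    \<in> borel_measurable (killed_space M p)"
    by (intro borel_measurable_Pair borel_measurable_diff measurable_killed_functions)
  show "integrable (killed_space M p)
      (\<lambda>z. k (running_sup X (snd z) (fst z), X (snd z) (fst z) - running_sup X (snd z) (fst z))) \<longleftrightarrow>
    integrable (sup_law p \<Otimes>\<^sub>M inf_law p) k"
    using integrable_distr_eq[OF m k] unfolding wiener_hopf[OF p] by simp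
  show "(LINT z|killed_space M p. k (running_sup X (snd z) (fst z), X (snd z) (fst z) - running_sup X (snd z) (fst z))) =
    (LINT z|(sup_law p \<Otimes>\<^sub>M inf_law p). k z)"
    using integral_distr[OF m k] unfolding wiener_hopf[OF p] by simp
qed

text \<open>The moment of the sum of supremum and drawdown is the product of two nonzero moments, so both are
  finite as soon as it is.\<close>

lemma exp_moment_factors:
  assumes p: "0 < p" and int: "integrable (killed_space M p) (\<lambda>z. exp (- \<gamma> * X (snd z) (fst z)))"
  shows "integrable (sup_law p) (\<lambda>s. exp (- \<gamma> * s))" "integrable (inf_law p) (\<lambda>i. exp (- \<gamma> * i))"
proof -
  let ?e = "\<lambda>x::real. ennreal (exp (- \<gamma> * x))"
  interpret S: prob_space "sup_law p" by (rule prob_space_sup_inf_law[OF p])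
  interpret I: prob_space "inf_law p" by (rule prob_space_sup_inf_law[OF p])
  have mk: "(\<lambda>z. ?e (fst z + snd z)) \<in> borel_measurable borel"
    by (intro measurable_compose[OF _ measurable_ennreal] borel_measurable_continuous_onI continuous_intros)
  have "(\<integral>\<^sup>+ z. ?e (X (snd z) (fst z)) \<partial>killed_space M p) = (\<integral>\<^sup>+ s. \<integral>\<^sup>+ i. ?e (s + i) \<partial>inf_law p \<partial>sup_law p)"
    using wiener_hopf_nn_integral[OF p mk] by simp
  also have "\<dots> = (\<integral>\<^sup>+ s. \<integral>\<^sup>+ i. ?e s * ?e i \<partial>inf_law p \<partial>sup_law p)"
    by (intro nn_integral_cong) (simp add: ennreal_mult[symmetric] exp_add[symmetric] algebra_simps)
  also have "\<dots> = (\<integral>\<^sup>+ s. ?e s \<partial>sup_law p) * (\<integral>\<^sup>+ i. ?e i \<partial>inf_law p)"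
    by (simp add: nn_integral_cmult nn_integral_multc)
  finally have prod: "(\<integral>\<^sup>+ s. ?e s \<partial>sup_law p) * (\<integral>\<^sup>+ i. ?e i \<partial>inf_law p) < \<infinity>"
    using int by (simp add: integrable_iff_bounded)
  have nz: "(\<integral>\<^sup>+ x. ?e x \<partial>N) \<noteq> 0" if N: "prob_space N" "sets N = sets borel" for N
  proof
    interpret N: prob_space N by fact
    assume "(\<integral>\<^sup>+ x. ?e x \<partial>N) = 0"
    then have "AE x in N. ?e x = 0"
      by (subst (asm) nn_integral_0_iff_AE) (simp_all add: measurable_cong_sets[OF N(2) refl])
    then have "AE x in N. False" by eventually_elim simp
    then show False by simp
  qed
  have "(\<integral>\<^sup>+ s. ?e s \<partial>sup_law p) \<noteq> 0" "(\<integral>\<^sup>+ i. ?e i \<partial>inf_law p) \<noteq> 0"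
    by (intro nz S.prob_space_axioms I.prob_space_axioms sets_sup_inf_law)+
  with prod have "(\<integral>\<^sup>+ s. ?e s \<partial>sup_law p) < \<infinity>" "(\<integral>\<^sup>+ i. ?e i \<partial>inf_law p) < \<infinity>"
    by (auto simp: ennreal_mult_less_top)
  then show "integrable (sup_law p) (\<lambda>s. exp (- \<gamma> * s))" "integrable (inf_law p) (\<lambda>i. exp (- \<gamma> * i))"
    by (simp_all add: integrable_iff_bounded)
qed

end

section \<open>Laplace transforms and analytic continuation\<close>

lemma laplace_transform_continuous:
  fixes k :: "real \<Rightarrow> real"
  assumes k: "integrable lborel k" and supp: "\<And>t. t < 0 \<Longrightarrow> k t = 0"
  shows "continuous_on {w::complex. 0 \<le> Re w} (\<lambda>w. LINT t|lborel. exp (- (w * complex_of_real t)) * complex_of_real (k t))"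
  unfolding continuous_on_sequentially
proof (intro allI ballI impI, elim conjE)
  fix x :: "nat \<Rightarrow> complex" and a :: complex
  assume a: "a \<in> {w. 0 \<le> Re w}" and x: "\<forall>n. x n \<in> {w. 0 \<le> Re w}" "x \<longlonglongrightarrow> a"
  have mk [measurable]: "k \<in> borel_measurable borel" using borel_measurable_integrable[OF k] by simp
  have me [measurable]: "(\<lambda>t. exp (- (w * complex_of_real t))) \<in> borel_measurable borel" for w
    by (intro borel_measurable_continuous_onI continuous_intros)
  show "((\<lambda>w. LINT t|lborel. exp (- (w * complex_of_real t)) * complex_of_real (k t)) \<circ> x) \<longlonglongrightarrow>
    (LINT t|lborel. exp (- (a * complex_of_real t)) * complex_of_real (k t))"
    unfolding comp_def
  proof (rule integral_dominated_convergence[where w="\<lambda>t. \<bar>k t\<bar>"])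
    show "integrable lborel (\<lambda>t. \<bar>k t\<bar>)" using k by simp
    show "AE t in lborel. (\<lambda>n. exp (- (x n * complex_of_real t)) * complex_of_real (k t)) \<longlonglongrightarrow>
        exp (- (a * complex_of_real t)) * complex_of_real (k t)"
      by (intro AE_I2 tendsto_intros x)
    show "AE t in lborel. norm (exp (- (x n * complex_of_real t)) * complex_of_real (k t)) \<le> \<bar>k t\<bar>" for n
    proof (intro AE_I2)
      fix t :: real
      show "norm (exp (- (x n * complex_of_real t)) * complex_of_real (k t)) \<le> \<bar>k t\<bar>"
      proof (cases "t < 0")
        case False
        then have "0 \<le> Re (x n) * t" using x(1) by (intro mult_nonneg_nonneg) auto
        then show ?thesis by (simp add: norm_mult mult_left_le_one_le)
      qed (simp add: supp)
    qed
  qed measurable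
qed

text \<open>Differentiation under the integral sign.  On a ball around \<open>w\<close> of radius \<open>r = Re w / 2\<close> the real
  part is at least \<open>r\<close>, and the mean value inequality bounds the difference quotients of the
  exponential by \<open>t exp (- r t) \<le> 1 / r\<close>, which dominates.\<close>

lemma laplace_transform_holomorphic:
  fixes k :: "real \<Rightarrow> real"
  assumes k: "integrable lborel k" and supp: "\<And>t. t < 0 \<Longrightarrow> k t = 0"
  shows "(\<lambda>w. LINT t|lborel. exp (- (w * complex_of_real t)) * complex_of_real (k t))
    holomorphic_on {w::complex. 0 < Re w}"
proof -
  let ?L = "\<lambda>w. LINT t|lborel. exp (- (w * complex_of_real t)) * complex_of_real (k t)"
  have mk [measurable]: "k \<in> borel_measurable borel" using borel_measurable_integrable[OF k] by simp
  have me [measurable]: "(\<lambda>t. exp (- (w * complex_of_real t))) \<in> borel_measurable borel" for w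
    by (intro borel_measurable_continuous_onI continuous_intros)
  have int: "integrable lborel (\<lambda>t. exp (- (w * complex_of_real t)) * complex_of_real (k t))" if "0 \<le> Re w" for w
  proof (rule Bochner_Integration.integrable_bound[OF k])
    show "AE t in lborel. norm (exp (- (w * complex_of_real t)) * complex_of_real (k t)) \<le> norm (k t)"
    proof (intro AE_I2)
      fix t :: real
      show "norm (exp (- (w * complex_of_real t)) * complex_of_real (k t)) \<le> norm (k t)"
      proof (cases "t < 0")
        case False
        then have "0 \<le> Re w * t" using that by (intro mult_nonneg_nonneg) auto
        then show ?thesis by (simp add: norm_mult mult_left_le_one_le)
      qed (simp add: supp)
    qed
  qed measurable
  have "\<exists>D. (?L has_field_derivative D) (at w)" if w: "0 < Re w" for w
  proof -
    define r where "r = Re w / 2"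
    have r: "0 < r" using w by (simp add: r_def)
    have ball: "r \<le> Re z" if "z \<in> ball w r" for z
    proof -
      have "\<bar>Re (w - z)\<bar> \<le> norm (w - z)" by (rule abs_Re_le_cmod)
      also have "\<dots> < r" using that by (simp add: dist_norm)
      finally have "\<bar>Re w - Re z\<bar> < r" by simp
      then show ?thesis unfolding r_def by linarith
    qed
    let ?q = "\<lambda>z t. (exp (- (z * complex_of_real t)) - exp (- (w * complex_of_real t))) / (z - w) * complex_of_real (k t)"
    let ?D = "LINT t|lborel. - complex_of_real t * exp (- (w * complex_of_real t)) * complex_of_real (k t)"
    have quot: "(?L z - ?L w) / (z - w) = (LINT t|lborel. ?q z t)" if "z \<in> ball w r" for z
    proof -
      have "?L z - ?L w = (LINT t|lborel. exp (- (z * complex_of_real t)) * complex_of_real (k t) -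
          exp (- (w * complex_of_real t)) * complex_of_real (k t))"
        using int[of z] int[of w] ball[OF that] r w by (intro Bochner_Integration.integral_diff[symmetric]) auto
      then show ?thesis
        by (simp add: integral_divide_zero[symmetric] left_diff_distrib diff_divide_distrib del: integral_divide_zero)
    qed
    have "((\<lambda>z. (?L z - ?L w) / (z - w)) \<longlongrightarrow> ?D) (at w within ball w r)"
      unfolding tendsto_at_iff_sequentially
    proof (intro allI impI)
      fix x assume x: "\<forall>i. x i \<in> ball w r - {w}" "x \<longlonglongrightarrow> w"
      have "(\<lambda>i. LINT t|lborel. ?q (x i) t) \<longlonglongrightarrow> ?D"
      proof (rule integral_dominated_convergence[where w="\<lambda>t. (1 / r) * \<bar>k t\<bar>"])
        show "integrable lborel (\<lambda>t. (1 / r) * \<bar>k t\<bar>)" using k by simp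
        show "AE t in lborel. (\<lambda>i. ?q (x i) t) \<longlonglongrightarrow>
            - complex_of_real t * exp (- (w * complex_of_real t)) * complex_of_real (k t)"
        proof (intro AE_I2 tendsto_mult tendsto_const)
          fix t :: real
          have "((\<lambda>z. exp (- (z * complex_of_real t))) has_field_derivative
              - complex_of_real t * exp (- (w * complex_of_real t))) (at w)"
            by (auto intro!: derivative_eq_intros)
          then have "((\<lambda>z. (exp (- (z * complex_of_real t)) - exp (- (w * complex_of_real t))) / (z - w)) \<longlongrightarrow>
              - complex_of_real t * exp (- (w * complex_of_real t))) (at w)"
            by (simp add: has_field_derivative_iff)
          then show "(\<lambda>i. (exp (- (x i * complex_of_real t)) - exp (- (w * complex_of_real t))) / (x i - w)) \<longlonglongrightarrow>
              - complex_of_real t * exp (- (w * complex_of_real t))"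
            using x unfolding tendsto_at_iff_sequentially by (auto simp: comp_def)
        qed
        show "AE t in lborel. norm (?q (x i) t) \<le> (1 / r) * \<bar>k t\<bar>" for i
        proof (intro AE_I2)
          fix t :: real
          show "norm (?q (x i) t) \<le> (1 / r) * \<bar>k t\<bar>"
          proof (cases "t < 0")
            case False
            then have t: "0 \<le> t" by simp
            have xi: "x i \<in> ball w r" "x i \<noteq> w" using x(1) by auto
            have "norm (exp (- (x i * complex_of_real t)) - exp (- (w * complex_of_real t))) \<le> (1 / r) * norm (x i - w)"
            proof (rule field_differentiable_bound[of "ball w r" "\<lambda>z. exp (- (z * complex_of_real t))"
                  "\<lambda>z. - complex_of_real t * exp (- (z * complex_of_real t))"])
              fix z assume z: "z \<in> ball w r"
              show "((\<lambda>z. exp (- (z * complex_of_real t))) has_field_derivative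
                  - complex_of_real t * exp (- (z * complex_of_real t))) (at z within ball w r)"
                by (auto intro!: derivative_eq_intros)
              have "norm (- complex_of_real t * exp (- (z * complex_of_real t))) = t * exp (- (Re z * t))"
                using t by (simp add: norm_mult)
              also have "\<dots> \<le> t * exp (- (r * t))"
                using ball[OF z] t by (intro mult_left_mono) (auto intro: mult_right_mono)
              also have "\<dots> \<le> 1 / r"
              proof -
                have "r * t \<le> exp (r * t)" using exp_ge_add_one_self[of "r * t"] by linarith
                then show ?thesis using r by (simp add: exp_minus field_simps)
              qed
              finally show "norm (- complex_of_real t * exp (- (z * complex_of_real t))) \<le> 1 / r" .
            qed (use xi r in auto)
            then have "norm ((exp (- (x i * complex_of_real t)) - exp (- (w * complex_of_real t))) / (x i - w)) \<le> 1 / r"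
              using xi by (simp add: norm_divide pos_divide_le_eq)
            then show ?thesis
              unfolding norm_mult using r by (intro mult_mono) auto
          qed (simp add: supp)
        qed
      qed measurable
      moreover have "(?L (x i) - ?L w) / (x i - w) = (LINT t|lborel. ?q (x i) t)" for i
        using quot x(1) by blast
      ultimately show "((\<lambda>z. (?L z - ?L w) / (z - w)) \<circ> x) \<longlonglongrightarrow> ?D"
        by (simp only: comp_def)
    qed
    moreover have "at w within ball w r = at w" using r by (intro at_within_open) auto
    ultimately have "(?L has_field_derivative ?D) (at w)" by (simp add: has_field_derivative_iff)
    then show ?thesis by blast
  qed
  then show ?thesis
    by (auto simp: holomorphic_on_def field_differentiable_def intro: has_field_derivative_at_within)
qed

definition laplace :: "(real \<Rightarrow> real) \<Rightarrow> complex \<Rightarrow> complex" where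
  "laplace v z = (LINT t|lborel. exp (- (z * complex_of_real t)) * complex_of_real (indicator {0..} t * v t))"

text \<open>Absorbing the factor \<open>exp (- \<sigma> t)\<close> into the density moves the abscissa of convergence to \<open>0\<close>.\<close>

lemma laplace_shift:
  "laplace v z = (LINT t|lborel. exp (- ((z - complex_of_real \<sigma>) * complex_of_real t)) *
     complex_of_real (indicator {0..} t * (exp (- \<sigma> * t) * v t)))"
  unfolding laplace_def
proof (intro Bochner_Integration.integral_cong refl)
  fix t :: real
  have "exp (- (z * complex_of_real t)) =
      exp (- ((z - complex_of_real \<sigma>) * complex_of_real t)) * complex_of_real (exp (- \<sigma> * t))"
    by (simp add: exp_of_real[symmetric] exp_add[symmetric] algebra_simps)
  then show "exp (- (z * complex_of_real t)) * complex_of_real (indicator {0..} t * v t) =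
     exp (- ((z - complex_of_real \<sigma>) * complex_of_real t)) *
     complex_of_real (indicator {0..} t * (exp (- \<sigma> * t) * v t))" by simp
qed

lemma laplace_regular:
  assumes "integrable lborel (\<lambda>t. indicator {0..} t * (exp (- \<sigma> * t) * v t))"
  shows "continuous_on {z. \<sigma> \<le> Re z} (laplace v)" "laplace v holomorphic_on {z. \<sigma> < Re z}"
proof -
  let ?k = "\<lambda>t. indicator {0..} t * (exp (- \<sigma> * t) * v t)"
  let ?L = "\<lambda>w. LINT t|lborel. exp (- (w * complex_of_real t)) * complex_of_real (?k t)"
  have eq: "laplace v = ?L \<circ> (\<lambda>z. z - complex_of_real \<sigma>)"
    by (intro ext) (simp only: laplace_shift[of v _ \<sigma>] comp_def)
  have supp: "?k t = 0" if "t < 0" for t using that by simp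
  show "continuous_on {z. \<sigma> \<le> Re z} (laplace v)"
    unfolding eq
    by (rule continuous_on_compose[OF _ continuous_on_subset[OF laplace_transform_continuous[OF assms supp]]])
      (auto intro!: continuous_intros)
  show "laplace v holomorphic_on {z. \<sigma> < Re z}"
    unfolding eq
    by (rule holomorphic_on_compose_gen[OF _ laplace_transform_holomorphic[OF assms supp]])
      (auto intro!: holomorphic_intros)
qed

lemma laplace_of_real:
  "laplace v (complex_of_real p) = complex_of_real (LINT t|lborel. indicator {0..} t * (exp (- p * t) * v t))"
proof -
  have "laplace v (complex_of_real p) = (LINT t|lborel. complex_of_real (indicator {0..} t * (exp (- p * t) * v t)))"
    unfolding laplace_def
    by (intro Bochner_Integration.integral_cong refl) (simp add: exp_of_real[symmetric])
  then show ?thesis by (simp only: integral_complex_of_real)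
qed

context prob_space
begin

text \<open>For \<open>q \<le> p\<close> the exponential density with rate \<open>p\<close> is at most \<open>p / q\<close> times the one with rate \<open>q\<close>.\<close>

lemma killed_integrable_mono:
  fixes Z :: "'a \<times> real \<Rightarrow> real"
  assumes q: "0 < q" "q \<le> p" and int: "integrable (killed_space M q) Z"
  shows "integrable (killed_space M p) Z"
proof -
  have p: "0 < p" using q by simp
  interpret Q: pair_prob_space M "exp_law q" by (rule pair_prob_space_killed[OF q(1)])
  interpret P: pair_prob_space M "exp_law p" by (rule pair_prob_space_killed[OF p])
  have mq [measurable]: "Z \<in> borel_measurable (killed_space M q)" using int by (rule borel_measurable_integrable)
  have mp [measurable]: "Z \<in> borel_measurable (killed_space M p)"
    using mq by (simp add: measurable_cong_sets[OF sets_killed_space refl])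
  define n where "n t = (\<integral>\<^sup>+ \<omega>. ennreal (norm (Z (\<omega>, t))) \<partial>M)" for t
  have mn: "n \<in> borel_measurable time_space"
  proof -
    have "n \<in> borel_measurable (exp_law q)" unfolding n_def by measurable
    then show ?thesis by (simp add: measurable_cong_sets[OF sets_exp_law refl])
  qed
  then have mn': "(\<lambda>t. n t * indicator {0..} t) \<in> borel_measurable lborel"
    by (subst (asm) borel_measurable_restrict_space_iff_ennreal) auto
  have "(\<integral>\<^sup>+ z. ennreal (norm (Z z)) \<partial>killed_space M p) = (\<integral>\<^sup>+ t. n t \<partial>exp_law p)"
    unfolding n_def by (rule P.nn_integral_snd[symmetric, of "\<lambda>z. ennreal (norm (Z z))"]) measurable
  also have "\<dots> = (\<integral>\<^sup>+ t. ennreal (p * exp (- p * t)) * (n t * indicator {0..} t) \<partial>lborel)"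
    by (rule nn_integral_exp_law[OF mn])
  also have "\<dots> \<le> (\<integral>\<^sup>+ t. ennreal (p / q) * (ennreal (q * exp (- q * t)) * (n t * indicator {0..} t)) \<partial>lborel)"
  proof (intro nn_integral_mono)
    fix t :: real
    show "ennreal (p * exp (- p * t)) * (n t * indicator {0..} t) \<le>
        ennreal (p / q) * (ennreal (q * exp (- q * t)) * (n t * indicator {0..} t))"
    proof (cases "0 \<le> t")
      case True
      then have "p * exp (- p * t) \<le> p / q * (q * exp (- q * t))"
        using q p by (simp add: mult_right_mono)
      then have "ennreal (p * exp (- p * t)) \<le> ennreal (p / q) * ennreal (q * exp (- q * t))"
        using p q by (simp add: ennreal_mult[symmetric] ennreal_leI)
      then show ?thesis unfolding mult.assoc[symmetric] by (intro mult_right_mono) auto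
    qed simp
  qed
  also have "\<dots> = ennreal (p / q) * (\<integral>\<^sup>+ t. ennreal (q * exp (- q * t)) * (n t * indicator {0..} t) \<partial>lborel)"
    by (rule nn_integral_cmult) (use mn' in measurable)
  also have "\<dots> = ennreal (p / q) * (\<integral>\<^sup>+ t. n t \<partial>exp_law q)"
    by (simp only: nn_integral_exp_law[OF mn])
  also have "(\<integral>\<^sup>+ t. n t \<partial>exp_law q) = (\<integral>\<^sup>+ z. ennreal (norm (Z z)) \<partial>killed_space M q)"
    unfolding n_def by (rule Q.nn_integral_snd[of "\<lambda>z. ennreal (norm (Z z))"]) measurable
  also have "ennreal (p / q) * (\<integral>\<^sup>+ z. ennreal (norm (Z z)) \<partial>killed_space M q) < \<infinity>"
    using int by (simp add: integrable_iff_bounded ennreal_mult_less_top)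
  finally show ?thesis by (simp add: integrable_iff_bounded)
qed

lemma expectation_Tq_laplace:
  fixes Z :: "'a \<Rightarrow> real \<Rightarrow> real"
  assumes p: "0 < p" and int: "integrable (killed_space M p) (\<lambda>(\<omega>, t). Z \<omega> t)"
  defines "v \<equiv> \<lambda>t. LINT \<omega>|M. Z \<omega> t"
  shows "integrable lborel (\<lambda>t. indicator {0..} t * (exp (- p * t) * v t))"
    and "expectation_Tq M p Z = p * (LINT t|lborel. indicator {0..} t * (exp (- p * t) * v t))"
proof -
  interpret P: pair_prob_space M "exp_law p" by (rule pair_prob_space_killed[OF p])
  have iv: "integrable (exp_law p) v" unfolding v_def by (rule P.integrable_snd[OF int])
  then have mv: "v \<in> borel_measurable time_space"
    using borel_measurable_integrable[OF iv] by (simp add: measurable_cong_sets[OF sets_exp_law refl])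
  have eq: "indicator {0..} t *\<^sub>R (p * exp (- p * t)) *\<^sub>R v t = p * (indicator {0..} t * (exp (- p * t) * v t))" for t
    by simp
  have "integrable lborel (\<lambda>t. p * (indicator {0..} t * (exp (- p * t) * v t)))"
    using iv unfolding integral_exp_law(1)[OF p mv] eq .
  then show "integrable lborel (\<lambda>t. indicator {0..} t * (exp (- p * t) * v t))"
    using p by simp
  have "expectation_Tq M p Z = (LINT t|exp_law p. v t)"
    unfolding expectation_Tq_def v_def by (rule P.integral_snd[OF int, symmetric])
  also have "\<dots> = p * (LINT t|lborel. indicator {0..} t * (exp (- p * t) * v t))"
    unfolding integral_exp_law(2)[OF p mv] eq by simp
  finally show "expectation_Tq M p Z = p * (LINT t|lborel. indicator {0..} t * (exp (- p * t) * v t))" .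
qed

text \<open>An expectation at the exponential time is \<open>p\<close> times a Laplace transform at \<open>p\<close> of a function of time
  that does not depend on \<open>p\<close>; replacing \<open>p\<close> by a complex number gives the continuation.\<close>

lemma expectation_Tq_continues_closed:
  fixes Z :: "'a \<Rightarrow> real \<Rightarrow> real"
  assumes \<sigma>: "0 < \<sigma>" and int: "integrable (killed_space M \<sigma>) (\<lambda>(\<omega>, t). Z \<omega> t)"
    and g: "\<And>p. \<sigma> \<le> p \<Longrightarrow> g p = expectation_Tq M p Z"
  shows "continues_to_closed_halfplane g \<sigma>"
  unfolding continues_to_closed_halfplane_def
proof (intro exI conjI allI impI)
  let ?v = "\<lambda>t. LINT \<omega>|M. Z \<omega> t"
  let ?G = "\<lambda>z. z * laplace ?v z"
  note reg = laplace_regular[OF expectation_Tq_laplace(1)[OF \<sigma> int]]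
  show "?G analytic_on {z. \<sigma> < Re z}"
    using reg(2) by (subst analytic_on_open) (auto intro!: holomorphic_intros simp: open_halfspace_Re_gt)
  show "continuous_on {z. \<sigma> \<le> Re z} ?G"
    using reg(1) by (intro continuous_intros)
  fix p assume p: "\<sigma> \<le> p"
  then have "0 < p" using \<sigma> by simp
  from expectation_Tq_laplace(2)[OF this killed_integrable_mono[OF \<sigma> p int]]
  show "complex_of_real p * laplace ?v (complex_of_real p) = complex_of_real (g p)"
    by (simp add: g[OF p] laplace_of_real)
qed

lemma expectation_Tq_continues:
  fixes Z :: "'a \<Rightarrow> real \<Rightarrow> real"
  assumes int: "\<And>p. 0 < p \<Longrightarrow> integrable (killed_space M p) (\<lambda>(\<omega>, t). Z \<omega> t)"
    and g: "\<And>p. 0 < p \<Longrightarrow> g p = expectation_Tq M p Z"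
  shows "continues_to_halfplane g 0"
  unfolding continues_to_halfplane_def
proof (intro exI conjI allI impI)
  let ?v = "\<lambda>t. LINT \<omega>|M. Z \<omega> t"
  let ?G = "\<lambda>z. z * laplace ?v z"
  have "?G analytic_on {z. \<sigma> < Re z}" if "0 < \<sigma>" for \<sigma>
    using laplace_regular(2)[OF expectation_Tq_laplace(1)[OF that int[OF that]]]
    by (subst analytic_on_open) (auto intro!: holomorphic_intros simp: open_halfspace_Re_gt)
  then have "?G analytic_on (\<Union>\<sigma>\<in>{0<..}. {z. \<sigma> < Re z})"
    by (subst analytic_on_UN) auto
  moreover have "{z. 0 < Re z} \<subseteq> (\<Union>\<sigma>\<in>{0<..}. {z. \<sigma> < Re z})"
    using dense by fastforce
  ultimately show "?G analytic_on {z. 0 < Re z}" by (rule analytic_on_subset)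
  fix p :: real assume p: "0 < p"
  from expectation_Tq_laplace(2)[OF p int[OF p]]
  show "complex_of_real p * laplace ?v (complex_of_real p) = complex_of_real (g p)"
    by (simp add: g[OF p] laplace_of_real)
qed

end

section \<open>Integrability and value of the payoff\<close>

text \<open>On each slice the negative part exceeds the positive part by at most \<open>G\<close>, so finiteness of the
  integral of the positive part carries over to the negative part.\<close>

lemma (in pair_sigma_finite) integrable_if_part_finite:
  fixes k :: "'a \<times> 'b \<Rightarrow> real"
  assumes m [measurable]: "k \<in> borel_measurable (M1 \<Otimes>\<^sub>M M2)"
    and slice: "\<And>x. x \<in> space M1 \<Longrightarrow> integrable M2 (\<lambda>y. k (x, y))"
    and bnd: "\<And>x. x \<in> space M1 \<Longrightarrow> \<bar>LINT y|M2. k (x, y)\<bar> \<le> G x"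
    and G: "integrable M1 G"
    and fin: "(\<integral>\<^sup>+ z. ennreal (k z) \<partial>(M1 \<Otimes>\<^sub>M M2)) < \<infinity>"
  shows "integrable (M1 \<Otimes>\<^sub>M M2) k"
proof -
  have [measurable]: "G \<in> borel_measurable M1" using G by (rule borel_measurable_integrable)
  have neg: "(\<integral>\<^sup>+ y. ennreal (- k (x, y)) \<partial>M2) \<le> (\<integral>\<^sup>+ y. ennreal (k (x, y)) \<partial>M2) + ennreal (G x)"
    if x: "x \<in> space M1" for x
  proof -
    let ?a = "LINT y|M2. max 0 (k (x, y))" and ?b = "LINT y|M2. max 0 (- k (x, y))"
    have i: "integrable M2 (\<lambda>y. max 0 (k (x, y)))" "integrable M2 (\<lambda>y. max 0 (- k (x, y)))"
      using slice[OF x] by (auto intro!: integrable_max)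
    have "(\<integral>\<^sup>+ y. ennreal (k (x, y)) \<partial>M2) = (\<integral>\<^sup>+ y. ennreal (max 0 (k (x, y))) \<partial>M2)"
      by (intro nn_integral_cong) (simp add: max_def ennreal_neg)
    then have a: "(\<integral>\<^sup>+ y. ennreal (k (x, y)) \<partial>M2) = ennreal ?a"
      using nn_integral_eq_integral[OF i(1)] by simp
    have "(\<integral>\<^sup>+ y. ennreal (- k (x, y)) \<partial>M2) = (\<integral>\<^sup>+ y. ennreal (max 0 (- k (x, y))) \<partial>M2)"
      by (intro nn_integral_cong) (simp add: max_def ennreal_neg)
    then have b: "(\<integral>\<^sup>+ y. ennreal (- k (x, y)) \<partial>M2) = ennreal ?b"
      using nn_integral_eq_integral[OF i(2)] by simp
    have "?a - ?b = (LINT y|M2. max 0 (k (x, y)) - max 0 (- k (x, y)))"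
      by (rule Bochner_Integration.integral_diff[OF i, symmetric])
    also have "\<dots> = (LINT y|M2. k (x, y))"
      by (intro Bochner_Integration.integral_cong refl) (simp add: max_def)
    finally have "?b \<le> ?a + G x" using bnd[OF x] by linarith
    moreover have "0 \<le> ?a" by (intro integral_nonneg_AE) simp
    moreover have "0 \<le> G x" using bnd[OF x] by linarith
    ultimately show ?thesis unfolding a b by (simp add: ennreal_plus[symmetric] ennreal_leI del: ennreal_plus)
  qed
  have "(\<integral>\<^sup>+ z. ennreal (- k z) \<partial>(M1 \<Otimes>\<^sub>M M2)) = (\<integral>\<^sup>+ x. \<integral>\<^sup>+ y. ennreal (- k (x, y)) \<partial>M2 \<partial>M1)"
    by (rule M2.nn_integral_fst[symmetric]) measurable
  also have "\<dots> \<le> (\<integral>\<^sup>+ x. (\<integral>\<^sup>+ y. ennreal (k (x, y)) \<partial>M2) + ennreal (G x) \<partial>M1)"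
    by (intro nn_integral_mono neg)
  also have "\<dots> = (\<integral>\<^sup>+ x. (\<integral>\<^sup>+ y. ennreal (k (x, y)) \<partial>M2) \<partial>M1) + (\<integral>\<^sup>+ x. ennreal (G x) \<partial>M1)"
    by (rule nn_integral_add) measurable
  also have "(\<integral>\<^sup>+ x. (\<integral>\<^sup>+ y. ennreal (k (x, y)) \<partial>M2) \<partial>M1) = (\<integral>\<^sup>+ z. ennreal (k z) \<partial>(M1 \<Otimes>\<^sub>M M2))"
    by (rule M2.nn_integral_fst) measurable
  also have "(\<integral>\<^sup>+ z. ennreal (k z) \<partial>(M1 \<Otimes>\<^sub>M M2)) + (\<integral>\<^sup>+ x. ennreal (G x) \<partial>M1) < \<infinity>"
    using fin G by (simp add: real_integrable_def less_top[symmetric])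
  finally show ?thesis using fin m by (simp add: real_integrable_def less_top[symmetric])
qed

lemma U_plus_borel: "U_plus \<in> sets borel"
proof -
  have "U_plus = {x. 0 \<le> snd x} \<inter> {x. fst x \<le> snd x}" by (auto simp: U_plus_def)
  moreover have "closed {x::real \<times> real. 0 \<le> snd x}" "closed {x::real \<times> real. fst x \<le> snd x}"
    by (intro closed_Collect_le continuous_intros)+
  ultimately show ?thesis by (metis borel_closed closed_Int)
qed

lemma zero_ext_measurable: "cond_b f \<mu> \<Longrightarrow> zero_ext f \<in> borel_measurable borel"
proof -
  assume "cond_b f \<mu>"
  then have "f \<in> borel_measurable (restrict_space borel U_plus)" by (simp add: cond_b_def)
  then have "(\<lambda>x. indicator U_plus x *\<^sub>R f x) \<in> borel_measurable borel"
    using U_plus_borel by (subst (asm) borel_measurable_restrict_space_iff) auto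
  also have "(\<lambda>x. indicator U_plus x *\<^sub>R f x) = zero_ext f"
    by (auto simp: zero_ext_def indicator_def)
  finally show ?thesis .
qed

lemma zero_ext_bound:
  assumes "cond_b f \<mu>"
  obtains C where "\<And>x y. \<bar>zero_ext f (x, y)\<bar> \<le> C y * exp (- \<mu> * x)" "\<And>y. 0 \<le> C y"
proof -
  obtain C where C: "\<And>x y. (x, y) \<in> U_plus \<Longrightarrow> \<bar>f (x, y)\<bar> \<le> C y * exp (- \<mu> * x)"
    using assms unfolding cond_b_def by blast
  have "\<bar>zero_ext f (x, y)\<bar> \<le> \<bar>C y\<bar> * exp (- \<mu> * x)" for x y
  proof (cases "(x, y) \<in> U_plus")
    case True
    then have "\<bar>zero_ext f (x, y)\<bar> \<le> C y * exp (- \<mu> * x)" using C by (simp add: zero_ext_def)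
    also have "\<dots> \<le> \<bar>C y\<bar> * exp (- \<mu> * x)" by (intro mult_right_mono) auto
    finally show ?thesis .
  qed (simp add: zero_ext_def)
  then show ?thesis using that[of "\<lambda>y. \<bar>C y\<bar>"] by simp
qed

lemma zero_ext_negative: "y < 0 \<Longrightarrow> zero_ext f (x, y) = 0"
  by (simp add: zero_ext_def U_plus_def)

context levy_process
begin

lemma cond_a_moments:
  assumes "cond_a M X p \<mu>m \<mu>p" "0 < p"
  shows "integrable (killed_space M p) (\<lambda>z. exp (- \<mu>m * X (snd z) (fst z)))"
    "integrable (killed_space M p) (\<lambda>z. exp (- \<mu>p * X (snd z) (fst z)))"
proof -
  have le: "\<mu>m \<in> {\<mu>m..\<mu>p}" "\<mu>p \<in> {\<mu>m..\<mu>p}"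
    using assms(1) by (auto simp: cond_a_def)
  have "integrable (killed_space M p) (\<lambda>z. exp (- \<gamma> * X (snd z) (fst z)))" if "\<gamma> \<in> {\<mu>m..\<mu>p}" for \<gamma>
    using assms(1) that unfolding cond_a_def by (intro killed_exp_moment assms(2)) blast+
  from this[OF le(1)] this[OF le(2)]
  show "integrable (killed_space M p) (\<lambda>z. exp (- \<mu>m * X (snd z) (fst z)))"
    "integrable (killed_space M p) (\<lambda>z. exp (- \<mu>p * X (snd z) (fst z)))" .
qed

lemma epv_minus_eq:
  assumes "u \<in> borel_measurable borel"
  shows "epv_minus M X p u x = (LINT i|inf_law p. u (x + i))"
proof -
  have "(\<lambda>i. u (x + i)) \<in> borel_measurable borel"
    by (intro measurable_compose[OF _ assms]) auto
  from integral_distr[OF measurable_killed_functions(3) this] show ?thesis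
    by (simp add: epv_minus_def expectation_Tq_def inf_law_def split_beta')
qed

lemma epv_plus_eq:
  assumes "u \<in> borel_measurable borel"
  shows "epv_plus M X p u x = (LINT s|sup_law p. u (x + s))"
proof -
  have "(\<lambda>s. u (x + s)) \<in> borel_measurable borel"
    by (intro measurable_compose[OF _ assms]) auto
  from integral_distr[OF measurable_killed_functions(2) this] show ?thesis
    by (simp add: epv_plus_def expectation_Tq_def sup_law_def split_beta')
qed

context
  fixes f :: "real \<times> real \<Rightarrow> real" and \<mu> p :: real
  assumes f: "cond_b f \<mu>" and p: "0 < p"
    and moment: "integrable (killed_space M p) (\<lambda>z. exp (- \<mu> * X (snd z) (fst z)))"
begin

lemma measurable_zero_ext_compose:
  fixes a b :: "'c::topological_space \<Rightarrow> real"
  assumes "continuous_on UNIV a" "continuous_on UNIV b"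
  shows "(\<lambda>x. zero_ext f (a x, b x)) \<in> borel_measurable borel"
  by (rule measurable_compose[OF _ zero_ext_measurable[OF f]])
    (intro borel_measurable_continuous_onI continuous_on_Pair assms)

text \<open>The growth bound on \<open>f\<close> has a constant depending on the second variable, which is fixed on the slice.\<close>

lemma integrable_slice: "integrable (inf_law p) (\<lambda>i. zero_ext f (y + i, y'))"
proof -
  obtain C where C: "\<And>x y. \<bar>zero_ext f (x, y)\<bar> \<le> C y * exp (- \<mu> * x)" "\<And>y. 0 \<le> C y"
    using zero_ext_bound[OF f] by blast
  have "integrable (inf_law p) (\<lambda>i. (C y' * exp (- \<mu> * y)) * exp (- \<mu> * i))"
    using exp_moment_factors(2)[OF p moment] by simp
  then show ?thesis
  proof (rule Bochner_Integration.integrable_bound)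
    show "(\<lambda>i. zero_ext f (y + i, y')) \<in> borel_measurable (inf_law p)"
      using measurable_zero_ext_compose[of "\<lambda>i::real. y + i" "\<lambda>_. y'"]
      by (simp add: measurable_cong_sets[OF sets_sup_inf_law(2) refl] continuous_intros)
    show "AE i in inf_law p. norm (zero_ext f (y + i, y')) \<le> norm ((C y' * exp (- \<mu> * y)) * exp (- \<mu> * i))"
    proof (intro AE_I2)
      fix i
      have "\<bar>zero_ext f (y + i, y')\<bar> \<le> C y' * exp (- \<mu> * (y + i))" by (rule C)
      also have "\<dots> = (C y' * exp (- \<mu> * y)) * exp (- \<mu> * i)"
        by (simp add: exp_add[symmetric] algebra_simps)
      finally show "norm (zero_ext f (y + i, y')) \<le> norm ((C y' * exp (- \<mu> * y)) * exp (- \<mu> * i))"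
        using C(2)[of y'] by (simp add: abs_mult)
    qed
  qed
qed

lemma tensor_epv_minus: "tensor_id (epv_minus M X p) (zero_ext f) (y, y') = (LINT i|inf_law p. zero_ext f (y + i, y'))"
proof -
  have "(\<lambda>x. zero_ext f (x, y')) \<in> borel_measurable borel"
    by (intro measurable_zero_ext_compose continuous_intros)
  then show ?thesis by (simp add: tensor_id_def epv_minus_eq)
qed

lemma integrable_product_exp:
  "integrable (sup_law p \<Otimes>\<^sub>M inf_law p) (\<lambda>z. exp (- \<mu> * (fst z + snd z)))"
proof -
  have "(\<lambda>z::real \<times> real. exp (- \<mu> * (fst z + snd z))) \<in> borel_measurable borel"
    by (intro borel_measurable_continuous_onI continuous_intros)
  from wiener_hopf_integral(1)[OF p this] moment show ?thesis by simp
qed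

lemma sets_product: "sets (sup_law p \<Otimes>\<^sub>M inf_law p) = sets borel"
  by (simp add: borel_prod[symmetric] cong: sets_pair_measure_cong)

lemma integrable_fixed_max:
  "integrable (sup_law p \<Otimes>\<^sub>M inf_law p) (\<lambda>z. zero_ext f (x1 + fst z + snd z, x2))"
proof -
  obtain C where C: "\<And>x y. \<bar>zero_ext f (x, y)\<bar> \<le> C y * exp (- \<mu> * x)" "\<And>y. 0 \<le> C y"
    using zero_ext_bound[OF f] by blast
  have "integrable (sup_law p \<Otimes>\<^sub>M inf_law p) (\<lambda>z. (C x2 * exp (- \<mu> * x1)) * exp (- \<mu> * (fst z + snd z)))"
    using integrable_product_exp by (rule integrable_mult_right)
  then show ?thesis
  proof (rule Bochner_Integration.integrable_bound)
    show "(\<lambda>z. zero_ext f (x1 + fst z + snd z, x2)) \<in> borel_measurable (sup_law p \<Otimes>\<^sub>M inf_law p)"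
      unfolding measurable_cong_sets[OF sets_product refl]
      by (intro measurable_zero_ext_compose continuous_intros)
    show "AE z in sup_law p \<Otimes>\<^sub>M inf_law p. norm (zero_ext f (x1 + fst z + snd z, x2)) \<le>
        norm ((C x2 * exp (- \<mu> * x1)) * exp (- \<mu> * (fst z + snd z)))"
    proof (intro AE_I2)
      fix z :: "real \<times> real"
      have "\<bar>zero_ext f (x1 + fst z + snd z, x2)\<bar> \<le> C x2 * exp (- \<mu> * (x1 + fst z + snd z))" by (rule C)
      also have "\<dots> = (C x2 * exp (- \<mu> * x1)) * exp (- \<mu> * (fst z + snd z))"
        by (simp add: exp_add[symmetric] algebra_simps)
      finally show "norm (zero_ext f (x1 + fst z + snd z, x2)) \<le>
        norm ((C x2 * exp (- \<mu> * x1)) * exp (- \<mu> * (fst z + snd z)))"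
        using C(2)[of x2] by (simp add: abs_mult)
    qed
  qed
qed

text \<open>The payoff as a function of the pair (supremum, drawdown).\<close>

definition split_payoff :: "real \<Rightarrow> real \<Rightarrow> real \<times> real \<Rightarrow> real" where
  "split_payoff x1 x2 z = zero_ext f (x1 + fst z + snd z, max x2 (x1 + fst z))"

lemma measurable_split_payoff: "split_payoff x1 x2 \<in> borel_measurable borel"
  unfolding split_payoff_def[abs_def]
  by (intro measurable_zero_ext_compose continuous_intros)

lemma payoff_split:
  "payoff X f x1 x2 \<omega> t = split_payoff x1 x2 (running_sup X t \<omega>, X t \<omega> - running_sup X t \<omega>)"
  by (simp add: payoff_def split_payoff_def)

lemma payoff_integrable_iff:
  "integrable (killed_space M p) (\<lambda>(\<omega>, t). payoff X f x1 x2 \<omega> t) \<longleftrightarrow>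
    integrable (sup_law p \<Otimes>\<^sub>M inf_law p) (split_payoff x1 x2)"
  using wiener_hopf_integral(1)[OF p measurable_split_payoff] by (simp add: payoff_split split_beta')

lemma measurable_diagonal:
  "(\<lambda>y. LINT i|inf_law p. zero_ext f (y + i, y)) \<in> borel_measurable borel"
  "(\<lambda>y. LINT i|inf_law p. zero_ext f (y + i, x2)) \<in> borel_measurable borel"
proof -
  interpret I: prob_space "inf_law p" by (rule prob_space_sup_inf_law[OF p])
  have s: "sets (borel \<Otimes>\<^sub>M inf_law p) = sets (borel :: (real \<times> real) measure)"
    by (simp add: borel_prod[symmetric] cong: sets_pair_measure_cong)
  show "(\<lambda>y. LINT i|inf_law p. zero_ext f (y + i, y)) \<in> borel_measurable borel"
    "(\<lambda>y. LINT i|inf_law p. zero_ext f (y + i, x2)) \<in> borel_measurable borel"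
    by (rule I.borel_measurable_lebesgue_integral;
        simp only: measurable_cong_sets[OF s refl] split_beta';
        intro measurable_zero_ext_compose continuous_intros)+
qed

text \<open>Compare the payoff with the one whose second argument is frozen at \<open>x2\<close>.  They differ only if the
  supremum carries the path above \<open>x2\<close>.  Integrating the difference over the independent drawdown
  first produces \<open>w\<close>, then over the supremum the operator \<open>epv_plus\<close>.\<close>

lemma expectation_payoff_formula:
  assumes int: "integrable (killed_space M p) (\<lambda>(\<omega>, t). payoff X f x1 x2 \<omega> t)"
  shows "expectation_Tq M p (payoff X f x1 x2) = factorization_rhs M X f p x1 x2"
proof -
  interpret S: prob_space "sup_law p" by (rule prob_space_sup_inf_law[OF p])
  interpret I: prob_space "inf_law p" by (rule prob_space_sup_inf_law[OF p])
  interpret SI: pair_prob_space "sup_law p" "inf_law p" ..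
  let ?N = "sup_law p \<Otimes>\<^sub>M inf_law p"
  define a where "a z = zero_ext f (x1 + fst z + snd z, x2)" for z
  define D where "D s i = indicator {x2..} (x1 + s) *
      (zero_ext f (x1 + s + i, x1 + s) - zero_ext f (x1 + s + i, x2))" for s i
  have ik: "integrable ?N (split_payoff x1 x2)" using int by (simp add: payoff_integrable_iff)
  have ia: "integrable ?N a" unfolding a_def by (rule integrable_fixed_max)
  have ma: "a \<in> borel_measurable borel"
    unfolding a_def[abs_def] by (intro measurable_zero_ext_compose continuous_intros)
  have split: "split_payoff x1 x2 z - a z = (case z of (s, i) \<Rightarrow> D s i)" for z
    by (cases z) (auto simp: split_payoff_def a_def D_def indicator_def max_def)
  have iD: "integrable ?N (\<lambda>(s, i). D s i)"
    using Bochner_Integration.integrable_diff[OF ik ia] unfolding split .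
  have "expectation_Tq M p (payoff X f x1 x2) = (LINT z|?N. split_payoff x1 x2 z)"
    using wiener_hopf_integral(2)[OF p measurable_split_payoff]
    by (simp add: expectation_Tq_def payoff_split split_beta')
  also have "\<dots> = (LINT z|?N. a z) + (LINT z|?N. (case z of (s, i) \<Rightarrow> D s i))"
    unfolding split[symmetric] using ik ia by simp
  also have "(LINT z|?N. a z) = tensor_id (epv M X p) (zero_ext f) (x1, x2)"
    using wiener_hopf_integral(2)[OF p ma]
    by (simp add: a_def tensor_id_def epv_def expectation_Tq_def split_beta' add.assoc)
  also have "(LINT z|?N. (case z of (s, i) \<Rightarrow> D s i)) = (LINT s|sup_law p. LINT i|inf_law p. D s i)"
    by (rule SI.integral_fst[OF iD, symmetric])
  also have "\<dots> = (LINT s|sup_law p. w M X f p (x1 + s) x2)"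
    unfolding D_def w_def tensor_epv_minus
    using integrable_slice by (simp add: Bochner_Integration.integral_diff)
  also have "\<dots> = epv_plus M X p (\<lambda>y. w M X f p y x2) x1"
  proof (rule epv_plus_eq[symmetric])
    show "(\<lambda>y. w M X f p y x2) \<in> borel_measurable borel"
      unfolding w_def tensor_epv_minus
      by (intro borel_measurable_times borel_measurable_diff measurable_diagonal borel_measurable_indicator) simp
  qed
  finally show ?thesis by (simp add: factorization_rhs_def)
qed

text \<open>Evaluating both terms of \<open>w\<close> at the same exponential time makes \<open>w\<close> one expectation of a function
  of path and time that does not involve the rate.\<close>

lemma w_as_expectation:
  defines "Z \<equiv> \<lambda>y x2 \<omega> t. indicator {x2..} y *
      (zero_ext f (y + running_inf X t \<omega>, y) - zero_ext f (y + running_inf X t \<omega>, x2))"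
  shows "integrable (killed_space M p) (\<lambda>(\<omega>, t). Z y x2 \<omega> t)"
    and "w M X f p y x2 = expectation_Tq M p (Z y x2)"
proof -
  have m: "(\<lambda>i. zero_ext f (y + i, y')) \<in> borel_measurable borel" for y'
    by (intro measurable_zero_ext_compose continuous_intros)
  have i: "integrable (killed_space M p) (\<lambda>z. zero_ext f (y + running_inf X (snd z) (fst z), y'))" for y'
    using integrable_slice[of y y'] integrable_distr_eq[OF measurable_killed_functions(3) m]
    by (simp add: inf_law_def)
  show "integrable (killed_space M p) (\<lambda>(\<omega>, t). Z y x2 \<omega> t)"
    using i by (simp add: Z_def split_beta')
  show "w M X f p y x2 = expectation_Tq M p (Z y x2)"
    using i by (simp add: Z_def w_def tensor_id_def epv_minus_def expectation_Tq_def split_beta'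
        Bochner_Integration.integral_diff)
qed

text \<open>Below the level \<open>x2\<close> the payoff is dominated by an exponential.  Above it the constant in the growth
  bound varies with the supremum and domination fails; there the bound on the slice integrals in
  \<^const>\<open>cond_c\<close> shows that the two signs balance up to an integrable error, so that one finite part
  suffices.\<close>

lemma payoff_integrable:
  assumes c: "cond_c M X f p \<mu>m"
    and moment_m: "integrable (killed_space M p) (\<lambda>z. exp (- \<mu>m * X (snd z) (fst z)))"
    and ex: "payoff_expectation_exists M X f p x1 x2"
  shows "integrable (killed_space M p) (\<lambda>(\<omega>, t). payoff X f x1 x2 \<omega> t)"
proof -
  interpret S: prob_space "sup_law p" by (rule prob_space_sup_inf_law[OF p])
  interpret I: prob_space "inf_law p" by (rule prob_space_sup_inf_law[OF p])
  interpret SI: pair_prob_space "sup_law p" "inf_law p" ..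
  let ?N = "sup_law p \<Otimes>\<^sub>M inf_law p"
  let ?k = "split_payoff x1 x2"
  define below where "below z = indicator {..<x2} (x1 + fst z) * zero_ext f (x1 + fst z + snd z, x2)" for z :: "real \<times> real"
  define above where "above z = indicator {x2..} (x1 + fst z) * zero_ext f (x1 + fst z + snd z, x1 + fst z)" for z :: "real \<times> real"
  have k: "?k z = below z + above z" for z
    by (auto simp: split_payoff_def below_def above_def indicator_def max_def)
  have mi: "(\<lambda>z::real \<times> real. indicator A (x1 + fst z) :: real) \<in> borel_measurable borel" if "A \<in> sets borel" for A
    by (intro measurable_compose[OF _ borel_measurable_indicator[OF that]] borel_measurable_continuous_onI continuous_intros)
  have m_above: "above \<in> borel_measurable borel"
    unfolding above_def[abs_def]
    by (intro borel_measurable_times mi measurable_zero_ext_compose continuous_intros) simp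
  then have mN: "above \<in> borel_measurable ?N" by (simp add: measurable_cong_sets[OF sets_product refl])
  have i_below: "integrable ?N below"
  proof (rule Bochner_Integration.integrable_bound[OF integrable_fixed_max[of x1 x2]])
    show "below \<in> borel_measurable ?N"
      unfolding measurable_cong_sets[OF sets_product refl] below_def[abs_def]
      by (intro borel_measurable_times mi measurable_zero_ext_compose continuous_intros) simp
  qed (auto simp: below_def indicator_def intro!: AE_I2)
  obtain C where C: "\<And>y. 0 \<le> y \<Longrightarrow> \<bar>tensor_id (epv_minus M X p) (zero_ext f) (y, y)\<bar> \<le> C * exp (- \<mu>m * y)"
    using c unfolding cond_c_def by blast
  define G where "G s = (\<bar>C\<bar> * exp (- \<mu>m * x1)) * exp (- \<mu>m * s)" for s
  have iG: "integrable (sup_law p) G"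
    unfolding G_def using exp_moment_factors(1)[OF p moment_m] by simp
  have slice: "integrable (inf_law p) (\<lambda>i. above (s, i))" for s
    unfolding above_def using integrable_slice[of "x1 + s" "x1 + s"] by simp
  have bnd: "\<bar>LINT i|inf_law p. above (s, i)\<bar> \<le> G s" for s
  proof (cases "0 \<le> x1 + s")
    case True
    have "\<bar>LINT i|inf_law p. above (s, i)\<bar> \<le> \<bar>LINT i|inf_law p. zero_ext f (x1 + s + i, x1 + s)\<bar>"
      by (simp add: above_def abs_mult indicator_def)
    also have "\<dots> \<le> C * exp (- \<mu>m * (x1 + s))" using C[OF True] by (simp add: tensor_epv_minus)
    also have "\<dots> \<le> \<bar>C\<bar> * exp (- \<mu>m * (x1 + s))" by (intro mult_right_mono) auto
    also have "\<dots> = G s" by (simp add: G_def exp_add[symmetric] algebra_simps)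
    finally show ?thesis .
  next
    case False
    then show ?thesis by (simp add: above_def zero_ext_negative G_def)
  qed
  have nn: "(\<integral>\<^sup>+ z. ennreal (c * above z) \<partial>?N) \<le> (\<integral>\<^sup>+ (\<omega>, t). ennreal (c * payoff X f x1 x2 \<omega> t) \<partial>killed_space M p)" for c
  proof -
    have mk: "(\<lambda>z. ennreal (c * ?k z)) \<in> borel_measurable borel"
      using measurable_split_payoff[of x1 x2] by measurable
    have mk': "(\<lambda>z. ennreal (c * ?k z)) \<in> borel_measurable ?N"
      using mk by (simp add: measurable_cong_sets[OF sets_product refl])
    have "(\<integral>\<^sup>+ z. ennreal (c * above z) \<partial>?N) \<le> (\<integral>\<^sup>+ z. ennreal (c * ?k z) \<partial>?N)"
      by (intro nn_integral_mono) (auto simp: above_def split_payoff_def indicator_def max_def)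
    also have "\<dots> = (\<integral>\<^sup>+ s. \<integral>\<^sup>+ i. ennreal (c * ?k (s, i)) \<partial>inf_law p \<partial>sup_law p)"
      by (rule I.nn_integral_fst[OF mk', symmetric])
    also have "\<dots> = (\<integral>\<^sup>+ (\<omega>, t). ennreal (c * payoff X f x1 x2 \<omega> t) \<partial>killed_space M p)"
      using wiener_hopf_nn_integral[OF p mk] by (simp add: payoff_split split_beta')
    finally show ?thesis .
  qed
  have "integrable ?N above"
    using ex unfolding payoff_expectation_exists_def
  proof
    assume "(\<integral>\<^sup>+ (\<omega>, t). ennreal (payoff X f x1 x2 \<omega> t) \<partial>killed_space M p) < \<infinity>"
    then have "(\<integral>\<^sup>+ z. ennreal (above z) \<partial>?N) < \<infinity>" using nn[of 1] by simp
    then show ?thesis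
      by (intro SI.integrable_if_part_finite[OF mN _ _ iG]) (use slice bnd in auto)
  next
    assume "(\<integral>\<^sup>+ (\<omega>, t). ennreal (- payoff X f x1 x2 \<omega> t) \<partial>killed_space M p) < \<infinity>"
    then have "(\<integral>\<^sup>+ z. ennreal (- above z) \<partial>?N) < \<infinity>" using nn[of "-1"] by simp
    then have "integrable ?N (\<lambda>z. - above z)"
      by (intro SI.integrable_if_part_finite[OF _ _ _ iG]) (use slice bnd mN in auto)
    then show ?thesis by simp
  qed
  then have "integrable ?N ?k"
    using Bochner_Integration.integrable_add[OF i_below] by (simp add: k[abs_def])
  then show ?thesis by (simp add: payoff_integrable_iff)
qed

end

end

lemma (in prob_space) V_tilde_expectation:
  assumes q: "0 < q" and int: "integrable (killed_space M q) (\<lambda>(\<omega>, t). payoff X f x1 x2 \<omega> t)"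
  shows "q * V_tilde M X f q x1 x2 = expectation_Tq M q (payoff X f x1 x2)"
proof -
  let ?v = "\<lambda>t. LINT \<omega>|M. payoff X f x1 x2 \<omega> t"
  note E = expectation_Tq_laplace[OF q int]
  have "V_tilde M X f q x1 x2 = (LINT t|lborel. indicator {0<..} t * (exp (- q * t) * ?v t))"
    by (simp add: V_tilde_def V_def set_lebesgue_integral_def)
  also have "\<dots> = (LINT t|lborel. indicator {0..} t * (exp (- q * t) * ?v t))"
  proof -
    have eq: "(\<lambda>t. indicator {0<..} t * (exp (- q * t) * ?v t)) =
        (\<lambda>t. indicator (- {0}) t * (indicator {0..} t * (exp (- q * t) * ?v t)))"
      by (auto simp: indicator_def)
    have m: "(\<lambda>t. indicator {0..} t * (exp (- q * t) * ?v t)) \<in> borel_measurable lborel"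
      using E(1) by (rule borel_measurable_integrable)
    show ?thesis
    proof (rule integral_cong_AE[OF _ m])
      show "(\<lambda>t. indicator {0<..} t * (exp (- q * t) * ?v t)) \<in> borel_measurable lborel"
        unfolding eq by (intro borel_measurable_times borel_measurable_indicator m) simp
      show "AE t in lborel. indicator {0<..} t * (exp (- q * t) * ?v t) =
          indicator {0..} t * (exp (- q * t) * ?v t)"
        using AE_lborel_singleton[of 0] by eventually_elim (auto simp: indicator_def)
    qed
  qed
  finally show ?thesis by (simp add: E(2))
qed

section \<open>The value formula and its continuation\<close>

theorem theorem3p2:
  fixes M :: "'a measure" and F :: "real \<Rightarrow> 'a measure" and X :: "real \<Rightarrow> 'a \<Rightarrow> real"
    and f :: "real \<times> real \<Rightarrow> real" and q :: real
  assumes levy: "levy_process M F X"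
    and q: "0 < q"
    and adm: "admissible M X f q"
  shows
   "(\<forall>x1 x2. x1 \<le> x2 \<longrightarrow> payoff_expectation_exists M X f q x1 x2 \<longrightarrow>
       integrable (M \<Otimes>\<^sub>M exp_law q) (\<lambda>(\<omega>, t). payoff X f x1 x2 \<omega> t) \<and>
       q * V_tilde M X f q x1 x2 =
         tensor_id (epv M X q) (zero_ext f) (x1, x2) + epv_plus M X q (\<lambda>y. w M X f q y x2) x1)
    \<and>
    ((\<forall>p>0. admissible M X f p) \<longrightarrow>
       (\<forall>x1 x2. x1 \<le> x2 \<longrightarrow> (\<forall>p>0. payoff_expectation_exists M X f p x1 x2) \<longrightarrow>
          continues_to_halfplane (\<lambda>p. factorization_rhs M X f p x1 x2) 0) \<and>
       (\<forall>y x2. continues_to_halfplane (\<lambda>p. w M X f p y x2) 0))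
    \<and>
    ((\<forall>x1 x2. x1 \<le> x2 \<longrightarrow> payoff_expectation_exists M X f q x1 x2 \<longrightarrow>
          continues_to_closed_halfplane (\<lambda>p. factorization_rhs M X f p x1 x2) q) \<and>
       (\<forall>y x2. continues_to_closed_halfplane (\<lambda>p. w M X f p y x2) q))"
proof -
  interpret levy_process M F X by (rule levy)
  have main: "integrable (killed_space M p) (\<lambda>(\<omega>, t). payoff X f x1 x2 \<omega> t) \<and>
      expectation_Tq M p (payoff X f x1 x2) = factorization_rhs M X f p x1 x2"
    if p: "0 < p" and adm: "admissible M X f p" and ex: "payoff_expectation_exists M X f p x1 x2" for p x1 x2
  proof -
    obtain \<mu>m \<mu>p where a: "cond_a M X p \<mu>m \<mu>p" and b: "cond_b f \<mu>p" and c: "cond_c M X f p \<mu>m"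
      using adm unfolding admissible_def by blast
    note mom = cond_a_moments[OF a p]
    have "integrable (killed_space M p) (\<lambda>(\<omega>, t). payoff X f x1 x2 \<omega> t)"
      by (rule payoff_integrable[OF b p mom(2) c mom(1) ex])
    then show ?thesis using expectation_payoff_formula[OF b p mom(2)] by blast
  qed
  (* The moment bound at the rate p' persists at every rate p \<ge> p'. *)
  have w_eq: "integrable (killed_space M p) (\<lambda>(\<omega>, t). indicator {x2..} y *
        (zero_ext f (y + running_inf X t \<omega>, y) - zero_ext f (y + running_inf X t \<omega>, x2))) \<and>
      w M X f p y x2 = expectation_Tq M p (\<lambda>\<omega> t. indicator {x2..} y *
        (zero_ext f (y + running_inf X t \<omega>, y) - zero_ext f (y + running_inf X t \<omega>, x2)))"
    if p': "0 < p'" "p' \<le> p" and adm: "admissible M X f p'" for p p' y x2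
  proof -
    obtain \<mu>m \<mu>p where a: "cond_a M X p' \<mu>m \<mu>p" and b: "cond_b f \<mu>p"
      using adm unfolding admissible_def by blast
    note mom = killed_integrable_mono[OF p' cond_a_moments(2)[OF a p'(1)]]
    have "0 < p" using p' by simp
    then show ?thesis using w_as_expectation[OF b _ mom] by blast
  qed
  show ?thesis
  proof (intro conjI allI impI)
    fix x1 x2 assume ex: "payoff_expectation_exists M X f q x1 x2"
    note m = main[OF q adm ex]
    show "integrable (M \<Otimes>\<^sub>M exp_law q) (\<lambda>(\<omega>, t). payoff X f x1 x2 \<omega> t)" using m by blast
    show "q * V_tilde M X f q x1 x2 =
         tensor_id (epv M X q) (zero_ext f) (x1, x2) + epv_plus M X q (\<lambda>y. w M X f q y x2) x1"
      using m V_tilde_expectation[OF q, of X f x1 x2] by (simp add: factorization_rhs_def)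
    show "continues_to_closed_halfplane (\<lambda>p. factorization_rhs M X f p x1 x2) q"
    proof (rule expectation_Tq_continues_closed[OF q])
      show i: "integrable (killed_space M q) (\<lambda>(\<omega>, t). payoff X f x1 x2 \<omega> t)" using m by blast
      (* The bound in cond_c can fail at larger rates; what carries over is integrability of the payoff. *)
      fix p assume p: "q \<le> p"
      obtain \<mu>m \<mu>p where a: "cond_a M X q \<mu>m \<mu>p" and b: "cond_b f \<mu>p"
        using adm unfolding admissible_def by blast
      have "0 < p" using p q by simp
      then show "factorization_rhs M X f p x1 x2 = expectation_Tq M p (payoff X f x1 x2)"
        by (rule expectation_payoff_formula[OF b _ killed_integrable_mono[OF q p cond_a_moments(2)[OF a q]]
              killed_integrable_mono[OF q p i], symmetric])
    qed
  next
    fix x1 x2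
    assume "\<forall>p>0. admissible M X f p" "\<forall>p>0. payoff_expectation_exists M X f p x1 x2"
    then show "continues_to_halfplane (\<lambda>p. factorization_rhs M X f p x1 x2) 0"
      using main by (intro expectation_Tq_continues[where Z="payoff X f x1 x2"]) auto
  next
    fix y x2
    assume "\<forall>p>0. admissible M X f p"
    then show "continues_to_halfplane (\<lambda>p. w M X f p y x2) 0"
      using w_eq[OF _ order_refl, of _ x2 y] by (intro expectation_Tq_continues) auto
  next
    fix y x2
    show "continues_to_closed_halfplane (\<lambda>p. w M X f p y x2) q"
      using w_eq[OF q _ adm, of _ x2 y] by (intro expectation_Tq_continues_closed[OF q]) auto
  qed
qed

end
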